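(* Let $\mathcal{H}$ be a maximal regular unitarily invariant complete Nevanlinna--Pick space on $\mathbb{B}_d$. Let $\mathfrak{a}\subset \mathcal{M}(\mathcal{H})$ be a proper weak-$*$ closed ideal such that $\mathcal{H}_{\mathfrak{a}}$ has dimension greater than one and $\operatorname{supp}\mathfrak{a}\cap \mathbb{S}_d$ is an approximation set. Then, the Gelfand transform of $\mathcal{A}_{\mathfrak{a}}$ is not completely isometric.
   Context: Let $d\ge 1$, let $\mathbb{B}_d\subset\mathbb{C}^d$ be the open unit ball and $\mathbb{S}_d$ the unit sphere. A regular unitarily invariant complete Nevanlinna--Pick space on $\mathbb{B}_d$ is the reproducing kernel Hilbert space $\mathcal{H}$ of analytic functions on $\mathbb{B}_d$ with a kernel of the form $k(z,w)=\sum_{n=0}^\infty a_n\langle z,w\rangle^n$, where $a_0=1$, $a_n>0$ for all $n$, $\lim_{n\to\infty} a_n/a_{n+1}=1$, and such that $1-\frac{1}{k(z,w)}=\sum_{n=1}^\infty b_n\langle z,w\rangle^n$ on $\mathbb{B}_d\times\mathbb{B}_d$ with all $b_n\ge 0$ (then automatically $\sum_n b_n\le 1$). It is called maximal if $\sum_{n=1}^\infty b_n=1$. $\mathcal{M}(\mathcal{H})$ is the algebra of multipliers of $\mathcal{H}$ (functions $\psi:\mathbb{B}_d\to\mathbb{C}$ with $\psi\mathcal{H}\subset\mathcal{H}$), identified with the algebra of multiplication operators $M_\psi$; it is a weak-$*$ closed subalgebra of $B(\mathcal{H})$ and contains the polynomials. $\mathcal{A}(\mathcal{H})$ is the norm closure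 of the polynomials in $\mathcal{M}(\mathcal{H})$. For a weak-$*$ closed ideal $\mathfrak{a}\subset\mathcal{M}(\mathcal{H})$, put $[\mathfrak{a}\mathcal{H}]=\overline{\mathrm{span}}\{M_\phi f:\phi\in\mathfrak{a},f\in\mathcal{H}\}$, $\mathcal{H}_{\mathfrak{a}}=\mathcal{H}\ominus[\mathfrak{a}\mathcal{H}]$, $\psi(Z_{\mathfrak{a}})=P_{\mathcal{H}_{\mathfrak{a}}}M_\psi|_{\mathcal{H}_{\mathfrak{a}}}$ for $\psi\in\mathcal{M}(\mathcal{H})$, and $\mathfrak{z}_j=P_{\mathcal{H}_{\mathfrak{a}}}M_{z_j}|_{\mathcal{H}_{\mathfrak{a}}}$ for $1\le j\le d$. Then $\mathcal{M}_{\mathfrak{a}}=\{\psi(Z_{\mathfrak{a}}):\psi\in\mathcal{M}(\mathcal{H})\}\subset B(\mathcal{H}_{\mathfrak{a}})$ (a weak-$*$ closed commutative unital operator algebra), and $\mathcal{A}_{\mathfrak{a}}$ is the norm closure of $\{\phi(Z_{\mathfrak{a}}):\phi\in\mathcal{A}(\mathcal{H})\}$. The support of $\mathfrak{a}$ is $\operatorname{supp}\mathfrak{a}=\{(\chi(\mathfrak{z}_1),\ldots,\chi(\mathfrak{z}_d)):\chi\in\Delta(\mathcal{M}_{\mathfrak{a}})\}\subset\overline{\mathbb{B}_d}$, where $\Delta(\mathcal{M}_{\mathfrak{a}})$ is the character space of $\mathcal{M}_{\mathfrak{a}}$. A compact set $K\subset\mathbb{C}^d$ is an approximation set if the (holomorphic)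 polynomials in $z_1,\dots,z_d$ are uniformly dense in $C(K)$. For a commutative unital Banach algebra $\mathfrak{B}$, the Gelfand transform is $g:\mathfrak{B}\to C(\Delta(\mathfrak{B}))$, $g(b)(\chi)=\chi(b)$. For an operator algebra $\mathfrak{B}$, it is completely isometric if $\|[b_{ij}]\|_{\mathbb{M}_n(\mathfrak{B})}=\max_{\chi\in\Delta(\mathfrak{B})}\|[\chi(b_{ij})]\|_{\mathbb{M}_n}$ for all $n\ge1$ and $[b_{ij}]\in\mathbb{M}_n(\mathfrak{B})$. *)

theory Defs
  imports "HOL-Analysis.Analysis" "HOL-Library.Function_Algebras"
begin

section \<open>Hilbert spaces of complex-valued functions\<close>

text \<open>
  All Hilbert spaces are spaces \<open>V\<close> of functions \<open>'x \<Rightarrow> complex\<close> with an inner product \<open>ip\<close>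
  that is meaningful on \<open>V\<close> only and linear in the first argument. A function on a subset \<open>X\<close>
  of \<open>'x\<close> is represented by its extension by \<open>0\<close>, and an operator on \<open>V\<close> by its extension by \<open>0\<close>
  outside \<open>V\<close>; hence equality of functions and of operators is equality of HOL functions, and
  their sums and differences are the pointwise ones.
\<close>

type_synonym 'x cfun = "'x \<Rightarrow> complex"
type_synonym 'x cop = "'x cfun \<Rightarrow> 'x cfun"

definition cscale :: "complex \<Rightarrow> 'x cfun \<Rightarrow> 'x cfun" where
  "cscale c f = (\<lambda>x. c * f x)"

global_interpretation cfun: vector_space cscale
  by unfold_locales (auto simp: cscale_def fun_eq_iff algebra_simps)

definition hnorm :: "('x cfun \<Rightarrow> 'x cfun \<Rightarrow> complex) \<Rightarrow> 'x cfun \<Rightarrow> real" where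
  "hnorm ip f = sqrt (Re (ip f f))"

definition inner_product_on ::
    "'x cfun set \<Rightarrow> ('x cfun \<Rightarrow> 'x cfun \<Rightarrow> complex) \<Rightarrow> bool" where
  "inner_product_on V ip \<longleftrightarrow>
     cfun.subspace V \<and>
     (\<forall>f\<in>V. \<forall>g\<in>V. \<forall>h\<in>V. ip (f + g) h = ip f h + ip g h) \<and>
     (\<forall>c. \<forall>f\<in>V. \<forall>g\<in>V. ip (cscale c f) g = c * ip f g) \<and>
     (\<forall>f\<in>V. \<forall>g\<in>V. ip g f = cnj (ip f g)) \<and>
     (\<forall>f\<in>V. f \<noteq> 0 \<longrightarrow> Re (ip f f) > 0)"

definition hilbert_space_on ::
    "'x cfun set \<Rightarrow> ('x cfun \<Rightarrow> 'x cfun \<Rightarrow> complex) \<Rightarrow> bool" where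
  "hilbert_space_on V ip \<longleftrightarrow>
     inner_product_on V ip \<and>
     (\<forall>s. (\<forall>n. s n \<in> V) \<and>
          (\<forall>e>0. \<exists>N. \<forall>m\<ge>N. \<forall>n\<ge>N. hnorm ip (s m - s n) < e) \<longrightarrow>
          (\<exists>f\<in>V. (\<lambda>n. hnorm ip (s n - f)) \<longlonglongrightarrow> 0))"

definition rkhs ::
    "'x set \<Rightarrow> ('x \<Rightarrow> 'x \<Rightarrow> complex) \<Rightarrow> 'x cfun set \<Rightarrow> ('x cfun \<Rightarrow> 'x cfun \<Rightarrow> complex) \<Rightarrow> bool"
  where
  "rkhs X k H ip \<longleftrightarrow>
     hilbert_space_on H ip \<and>
     (\<forall>f\<in>H. \<forall>x. x \<notin> X \<longrightarrow> f x = 0) \<and>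
     (\<forall>w\<in>X. (\<lambda>z. if z \<in> X then k z w else 0) \<in> H \<and>
             (\<forall>f\<in>H. ip f (\<lambda>z. if z \<in> X then k z w else 0) = f w))"

text \<open>The closure in \<open>H\<close> of the linear span of \<open>S\<close>.\<close>

definition closed_span ::
    "'x cfun set \<Rightarrow> ('x cfun \<Rightarrow> 'x cfun \<Rightarrow> complex) \<Rightarrow> 'x cfun set \<Rightarrow> 'x cfun set" where
  "closed_span H ip S = {h \<in> H. \<forall>e>0. \<exists>g\<in>cfun.span S. hnorm ip (h - g) < e}"

definition orth_compl ::
    "'x cfun set \<Rightarrow> ('x cfun \<Rightarrow> 'x cfun \<Rightarrow> complex) \<Rightarrow> 'x cfun set \<Rightarrow> 'x cfun set" where
  "orth_compl H ip S = {g \<in> H. \<forall>h\<in>S. ip g h = 0}"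

definition orth_proj ::
    "('x cfun \<Rightarrow> 'x cfun \<Rightarrow> complex) \<Rightarrow> 'x cfun set \<Rightarrow> 'x cfun \<Rightarrow> 'x cfun" where
  "orth_proj ip V h = (THE p. p \<in> V \<and> (\<forall>v\<in>V. ip (h - p) v = 0))"


section \<open>Operators\<close>

definition bounded_ops ::
    "'x cfun set \<Rightarrow> ('x cfun \<Rightarrow> 'x cfun \<Rightarrow> complex) \<Rightarrow> 'x cop set" where
  "bounded_ops V ip = {T.
     (\<forall>f\<in>V. T f \<in> V) \<and> (\<forall>f. f \<notin> V \<longrightarrow> T f = 0) \<and>
     (\<forall>f\<in>V. \<forall>g\<in>V. T (f + g) = T f + T g) \<and>
     (\<forall>c. \<forall>f\<in>V. T (cscale c f) = cscale c (T f)) \<and>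
     (\<exists>C. \<forall>f\<in>V. hnorm ip (T f) \<le> C * hnorm ip f)}"

definition op_norm ::
    "'x cfun set \<Rightarrow> ('x cfun \<Rightarrow> 'x cfun \<Rightarrow> complex) \<Rightarrow> 'x cop \<Rightarrow> real" where
  "op_norm V ip T = Sup {hnorm ip (T f) | f. f \<in> V \<and> hnorm ip f \<le> 1}"

text \<open>
  The weak-* topology of \<open>B(V)\<close> as the dual of the trace class operators. A trace class operator is
  a sum of rank one operators \<open>x n \<otimes> (y n)\<^sup>*\<close> with \<open>x\<close> and \<open>y\<close> square summable, and it
  acts on \<open>T\<close> as the sum of the \<open>\<langle>T (x n), y n\<rangle>\<close>.
\<close>

definition weak_star_topology ::
    "'x cfun set \<Rightarrow> ('x cfun \<Rightarrow> 'x cfun \<Rightarrow> complex) \<Rightarrow> 'x cop topology" where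
  "weak_star_topology V ip = topology_generated_by
     {{T \<in> bounded_ops V ip. (\<Sum>n. ip (T (x n)) (y n)) \<in> U} | x y U.
        (\<forall>n::nat. x n \<in> V \<and> y n \<in> V) \<and>
        summable (\<lambda>n. (hnorm ip (x n))\<^sup>2) \<and> summable (\<lambda>n. (hnorm ip (y n))\<^sup>2) \<and> open U}"

text \<open>
  The norms of \<open>n \<times> n\<close> matrices of operators on \<open>V\<close>, acting on the Hilbert space direct sum of
  \<open>n\<close> copies of \<open>V\<close>, and of complex \<open>n \<times> n\<close> matrices. Only entries with indices below \<open>n\<close> count.
\<close>

definition op_matrix_norm ::
    "'x cfun set \<Rightarrow> ('x cfun \<Rightarrow> 'x cfun \<Rightarrow> complex) \<Rightarrow> nat \<Rightarrow> (nat \<Rightarrow> nat \<Rightarrow> 'x cop) \<Rightarrow> real" where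
  "op_matrix_norm V ip n B =
     Sup {sqrt (\<Sum>i<n. (hnorm ip (\<Sum>j<n. B i j (f j)))\<^sup>2) | f.
            (\<forall>j<n. f j \<in> V) \<and> sqrt (\<Sum>j<n. (hnorm ip (f j))\<^sup>2) \<le> 1}"

definition cmatrix_norm :: "nat \<Rightarrow> (nat \<Rightarrow> nat \<Rightarrow> complex) \<Rightarrow> real" where
  "cmatrix_norm n A =
     Sup {sqrt (\<Sum>i<n. (cmod (\<Sum>j<n. A i j * v j))\<^sup>2) | v. sqrt (\<Sum>j<n. (cmod (v j))\<^sup>2) \<le> 1}"


section \<open>Characters and the Gelfand transform\<close>

text \<open>
  The character space of a unital norm closed algebra of operators. Characters are automatically
  continuous; they are extended by \<open>0\<close> outside the algebra.
\<close>

definition characters :: "'x cop set \<Rightarrow> ('x cop \<Rightarrow> complex) set" where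
  "characters \<B> = {\<omega>.
     (\<forall>S\<in>\<B>. \<forall>T\<in>\<B>. \<omega> (S + T) = \<omega> S + \<omega> T) \<and>
     (\<forall>c. \<forall>S\<in>\<B>. \<omega> (\<lambda>f. cscale c (S f)) = c * \<omega> S) \<and>
     (\<forall>S\<in>\<B>. \<forall>T\<in>\<B>. \<omega> (S \<circ> T) = \<omega> S * \<omega> T) \<and>
     (\<exists>S\<in>\<B>. \<omega> S \<noteq> 0) \<and>
     (\<forall>S. S \<notin> \<B> \<longrightarrow> \<omega> S = 0)}"

definition gelfand_transform :: "'x cop set \<Rightarrow> 'x cop \<Rightarrow> ('x cop \<Rightarrow> complex) \<Rightarrow> complex" where
  "gelfand_transform \<B> b = (\<lambda>\<omega>\<in>characters \<B>. \<omega> b)"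

text \<open>
  For an algebra \<open>\<B>\<close> of operators on \<open>V\<close>. The two conjuncts say that the maximum over the
  characters exists and equals the matrix norm.
\<close>

definition gelfand_completely_isometric ::
    "'x cfun set \<Rightarrow> ('x cfun \<Rightarrow> 'x cfun \<Rightarrow> complex) \<Rightarrow> 'x cop set \<Rightarrow> bool" where
  "gelfand_completely_isometric V ip \<B> \<longleftrightarrow>
     (\<forall>n\<ge>1. \<forall>B. (\<forall>i<n. \<forall>j<n. B i j \<in> \<B>) \<longrightarrow>
        (\<exists>\<omega>\<in>characters \<B>.
           op_matrix_norm V ip n B = cmatrix_norm n (\<lambda>i j. gelfand_transform \<B> (B i j) \<omega>)) \<and>
        (\<forall>\<omega>\<in>characters \<B>.
           cmatrix_norm n (\<lambda>i j. gelfand_transform \<B> (B i j) \<omega>) \<le> op_matrix_norm V ip n B))"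


section \<open>Polynomials and approximation sets\<close>

definition cpolynomial :: "(complex ^ 'd) cfun \<Rightarrow> bool" where
  "cpolynomial p \<longleftrightarrow>
     (\<exists>(I :: ('d \<Rightarrow> nat) set) c. finite I \<and>
        p = (\<lambda>z. \<Sum>\<alpha>\<in>I. c \<alpha> * (\<Prod>j\<in>UNIV. z $ j ^ \<alpha> j)))"

definition approximation_set :: "(complex ^ 'd) set \<Rightarrow> bool" where
  "approximation_set K \<longleftrightarrow> compact K \<and>
     (\<forall>f :: (complex ^ 'd) cfun. continuous_on K f \<longrightarrow>
        (\<forall>e>0. \<exists>p. cpolynomial p \<and> (\<forall>z\<in>K. cmod (f z - p z) < e)))"


section \<open>Regular unitarily invariant complete Nevanlinna--Pick spaces\<close>

definition cdot :: "complex ^ 'd \<Rightarrow> complex ^ 'd \<Rightarrow> complex" where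
  "cdot z w = (\<Sum>j\<in>UNIV. z $ j * cnj (w $ j))"

definition kernel :: "(nat \<Rightarrow> real) \<Rightarrow> complex ^ 'd \<Rightarrow> complex ^ 'd \<Rightarrow> complex" where
  "kernel a z w = (\<Sum>n. of_real (a n) * cdot z w ^ n)"

text \<open>
  The space is determined by \<open>a\<close>, and so is \<open>b\<close>, whose value \<open>b 0\<close> plays no role. The functions
  in \<open>H\<close> are automatically analytic on the ball, because the kernel is.
\<close>

definition regular_ui_cnp_space ::
    "(nat \<Rightarrow> real) \<Rightarrow> (nat \<Rightarrow> real) \<Rightarrow> (complex ^ 'd) cfun set \<Rightarrow>
     ((complex ^ 'd) cfun \<Rightarrow> (complex ^ 'd) cfun \<Rightarrow> complex) \<Rightarrow> bool" where
  "regular_ui_cnp_space a b H ip \<longleftrightarrow>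
     a 0 = 1 \<and> (\<forall>n. a n > 0) \<and> (\<lambda>n. a n / a (Suc n)) \<longlonglongrightarrow> 1 \<and>
     (\<forall>n\<ge>1. b n \<ge> 0) \<and>
     (\<forall>z \<in> ball (0 :: complex ^ 'd) 1. \<forall>w\<in>ball 0 1. kernel a z w \<noteq> 0 \<and>
        (\<lambda>n. of_real (b (Suc n)) * cdot z w ^ Suc n) sums (1 - 1 / kernel a z w)) \<and>
     rkhs (ball 0 1) (kernel a) H ip"

definition maximal_cnp :: "(nat \<Rightarrow> real) \<Rightarrow> bool" where
  "maximal_cnp b \<longleftrightarrow> (\<lambda>n. b (Suc n)) sums 1"


section \<open>Multipliers and ideals\<close>

definition on_ball :: "(complex ^ 'd) cfun \<Rightarrow> (complex ^ 'd) cfun" where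
  "on_ball \<psi> = (\<lambda>z. if z \<in> ball 0 1 then \<psi> z else 0)"

definition multipliers :: "(complex ^ 'd) cfun set \<Rightarrow> (complex ^ 'd) cfun set" where
  "multipliers H = {\<psi>. (\<forall>z. z \<notin> ball 0 1 \<longrightarrow> \<psi> z = 0) \<and> (\<forall>f\<in>H. \<psi> * f \<in> H)}"

definition mult_op :: "(complex ^ 'd) cfun set \<Rightarrow> (complex ^ 'd) cfun \<Rightarrow> (complex ^ 'd) cop" where
  "mult_op H \<psi> = (\<lambda>f. if f \<in> H then \<psi> * f else 0)"

text \<open>The norm closure \<open>\<A>(H)\<close> of the polynomials in the multiplier algebra.\<close>

definition poly_multipliers ::
    "(complex ^ 'd) cfun set \<Rightarrow> ((complex ^ 'd) cfun \<Rightarrow> (complex ^ 'd) cfun \<Rightarrow> complex) \<Rightarrow>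
     (complex ^ 'd) cfun set" where
  "poly_multipliers H ip = {\<psi> \<in> multipliers H.
     \<forall>e>0. \<exists>p. cpolynomial p \<and> op_norm H ip (mult_op H \<psi> - mult_op H (on_ball p)) < e}"

definition multiplier_ideal :: "(complex ^ 'd) cfun set \<Rightarrow> (complex ^ 'd) cfun set \<Rightarrow> bool" where
  "multiplier_ideal H \<aa> \<longleftrightarrow>
     \<aa> \<subseteq> multipliers H \<and> 0 \<in> \<aa> \<and>
     (\<forall>\<phi>\<in>\<aa>. \<forall>\<theta>\<in>\<aa>. \<phi> + \<theta> \<in> \<aa>) \<and> (\<forall>\<psi>\<in>multipliers H. \<forall>\<phi>\<in>\<aa>. \<psi> * \<phi> \<in> \<aa>)"

definition weak_star_closed ::
    "(complex ^ 'd) cfun set \<Rightarrow> ((complex ^ 'd) cfun \<Rightarrow> (complex ^ 'd) cfun \<Rightarrow> complex) \<Rightarrow>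
     (complex ^ 'd) cfun set \<Rightarrow> bool" where
  "weak_star_closed H ip \<aa> \<longleftrightarrow> closedin (weak_star_topology H ip) (mult_op H ` \<aa>)"

text \<open>The space \<open>H\<^sub>\<aa>\<close>, the orthogonal complement of \<open>[\<aa>H]\<close>.\<close>

definition quotient_space ::
    "(complex ^ 'd) cfun set \<Rightarrow> ((complex ^ 'd) cfun \<Rightarrow> (complex ^ 'd) cfun \<Rightarrow> complex) \<Rightarrow>
     (complex ^ 'd) cfun set \<Rightarrow> (complex ^ 'd) cfun set" where
  "quotient_space H ip \<aa> =
     orth_compl H ip (closed_span H ip {mult_op H \<phi> f | \<phi> f. \<phi> \<in> \<aa> \<and> f \<in> H})"

text \<open>The compression \<open>\<psi>(Z\<^sub>\<aa>)\<close> of the multiplication operator to \<open>H\<^sub>\<aa>\<close>.\<close>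

definition compression ::
    "(complex ^ 'd) cfun set \<Rightarrow> ((complex ^ 'd) cfun \<Rightarrow> (complex ^ 'd) cfun \<Rightarrow> complex) \<Rightarrow>
     (complex ^ 'd) cfun set \<Rightarrow> (complex ^ 'd) cfun \<Rightarrow> (complex ^ 'd) cop" where
  "compression H ip \<aa> \<psi> =
     (\<lambda>f. if f \<in> quotient_space H ip \<aa>
          then orth_proj ip (quotient_space H ip \<aa>) (mult_op H \<psi> f) else 0)"

definition compressed_multipliers ::
    "(complex ^ 'd) cfun set \<Rightarrow> ((complex ^ 'd) cfun \<Rightarrow> (complex ^ 'd) cfun \<Rightarrow> complex) \<Rightarrow>
     (complex ^ 'd) cfun set \<Rightarrow> (complex ^ 'd) cop set" where
  "compressed_multipliers H ip \<aa> = compression H ip \<aa> ` multipliers H"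

text \<open>The norm closure \<open>\<A>\<^sub>\<aa>\<close> in \<open>B(H\<^sub>\<aa>)\<close> of the compressions of \<open>\<A>(H)\<close>.\<close>

definition compressed_poly_algebra ::
    "(complex ^ 'd) cfun set \<Rightarrow> ((complex ^ 'd) cfun \<Rightarrow> (complex ^ 'd) cfun \<Rightarrow> complex) \<Rightarrow>
     (complex ^ 'd) cfun set \<Rightarrow> (complex ^ 'd) cop set" where
  "compressed_poly_algebra H ip \<aa> = {T \<in> bounded_ops (quotient_space H ip \<aa>) ip.
     \<forall>e>0. \<exists>\<phi>\<in>poly_multipliers H ip.
       op_norm (quotient_space H ip \<aa>) ip (T - compression H ip \<aa> \<phi>) < e}"

definition ideal_support ::
    "(complex ^ 'd) cfun set \<Rightarrow> ((complex ^ 'd) cfun \<Rightarrow> (complex ^ 'd) cfun \<Rightarrow> complex) \<Rightarrow>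
     (complex ^ 'd) cfun set \<Rightarrow> (complex ^ 'd) set" where
  "ideal_support H ip \<aa> =
     {\<chi> j. m (compression H ip \<aa> (on_ball (\<lambda>z. z $ j))) | m.
        m \<in> characters (compressed_multipliers H ip \<aa>)}"

end

theory Submission
  imports Defs
begin

text \<open>
  Already the scalar Gelfand transform is not isometric. Suppose it is, and let \<open>X\<close> be the closure of the
  set of points \<open>(\<omega>(\<zz>\<^sub>1), \<dots>, \<omega>(\<zz>\<^sub>d))\<close>, so that the norm of \<open>p(Z\<^sub>\<aa>)\<close> is \<open>max\<^sub>X \<bar>p\<bar>\<close> for polynomials \<open>p\<close>.
  For every \<open>p\<close> and \<open>\<epsilon> > 0\<close>, a maximiser of \<open>\<bar>p\<bar>\<^sup>2 + \<epsilon> \<parallel>z\<parallel>\<^sup>2\<close> on \<open>X\<close> is a peak point, and powers of the peaking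
  polynomial turn it into a joint approximate eigenvalue of the adjoint coordinate operators, hence into
  a point of the support of \<open>\<aa>\<close> (by Gelfand and Mazur, applied in the multiplier algebra). A peak
  point \<open>x\<close> inside the ball would be an eigenvalue, because \<open>\<Sum> M\<^sub>j M\<^sub>j\<^sup>*\<close> is a compact perturbation of
  the identity; then the kernel function at \<open>x\<close> spans a reducing subspace, which by the identity
  \<open>1 - \<Sum> b\<^sub>n \<langle>z,w\<rangle>\<^sup>n = 1 / k\<close> is all of \<open>H\<^sub>\<aa>\<close>. So all peak points lie on the sphere and the norm of
  \<open>p(Z\<^sub>\<aa>)\<close> is the maximum of \<open>\<bar>p\<bar>\<close> over the approximation set \<open>K = supp \<aa> \<inter> S\<^sub>d\<close>. Contractive unital
  homomorphisms of \<open>C(K)\<close> respect the involution, so the compressed coordinates satisfy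
  \<open>\<Sum> \<zz>\<^sub>j \<zz>\<^sub>j\<^sup>* = 1\<close>. With \<open>\<Sum> b\<^sub>n = 1\<close> this forces every function in \<open>H\<^sub>\<aa>\<close> to vanish at the origin, and
  coinvariance then gives \<open>H\<^sub>\<aa> = 0\<close>.
\<close>

section \<open>Hilbert spaces of functions\<close>

text \<open>The detour through peak points answers an obstacle: a character of A_a need not extend
  to M_a, so a point of X need not lie in the support. A joint approximate eigenvalue of the
  adjoints does lie there, because its approximate eigenvectors show that the z_j - x_j and the
  multipliers of zero compression generate a proper ideal. The term epsilon |z|^2 isolates a
  maximiser, and as all peak points have norm 1 it distorts the comparison of values of p by at most
  epsilon.

  Operators are handled through quadratic forms on finite combinations of kernel functions, which
  are dense. There an inequality between forms follows once a power series in <z,w> has nonnegative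
  coefficients. Applied to k (1 - sum b_n <z,w>^n) = 1 this yields |v(0)|^2 + sum b_n D_n(v) <=
  |v|^2, where D_n(v) sums |L_w v|^2 over the words w of length n in the adjoint coordinates. Both
  cases end with this inequality: inside the ball the kernel function uses up its share of it
  exactly, on the sphere D_n(v) = |v|^2 uses up everything, and v(0) = 0 is left. Coinvariance
  repeats this for every L_w v, hence for every Taylor coefficient of v.\<close>

lemma quadratic_perturbation_zero:
  fixes d :: complex
  assumes "\<And>t. 2 * Re (t * d) \<le> (cmod t)\<^sup>2 * C"
  shows "d = 0"
proof (rule ccontr)
  assume "d \<noteq> 0"
  then have d: "(cmod d)\<^sup>2 > 0" by simp
  \<comment> \<open>The test value \<open>t = s * cnj d\<close> gives \<open>2 s |d|^2\<close> on
    the left and \<open>s^2 |d|^2 C\<close> on the right, so \<open>s * C \<le> 1\<close> suffices.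
    The absolute value and the 1 make \<open>s\<close> positive for every sign of
    \<open>C\<close>.\<close>
  define s where "s = 1 / (\<bar>C\<bar> + 1)"
  have s: "s > 0" "s * C \<le> 1"
    by (auto simp: s_def field_simps abs_if)
  have "2 * s * (cmod d)\<^sup>2 \<le> s\<^sup>2 * (cmod d)\<^sup>2 * C"
  proof -
    have "cnj d * d = of_real ((cmod d)\<^sup>2)"
      by (metis complex_norm_square mult.commute of_real_power)
    then have "of_real s * cnj d * d = of_real (s * (cmod d)\<^sup>2)"
      by (simp add: mult.assoc)
    then have re: "Re (of_real s * cnj d * d) = s * (cmod d)\<^sup>2"
      by (metis Re_complex_of_real)
    have "cmod (of_real s * cnj d) = s * cmod d"
      using s by (simp add: norm_mult)
    then show ?thesis
      using assms[of "of_real s * cnj d"] unfolding re by (simp add: power_mult_distrib mult.assoc)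
  qed
  then have "s * (cmod d)\<^sup>2 * 2 \<le> s * (cmod d)\<^sup>2 * (s * C)"
    by (simp add: power2_eq_square algebra_simps)
  then have "2 \<le> s * C"
    using s(1) d by (simp add: mult_le_cancel_left_pos)
  with s show False by simp
qed

locale hilbert_function_space =
  fixes V :: "'x cfun set" and ip :: "'x cfun \<Rightarrow> 'x cfun \<Rightarrow> complex"
  assumes hilbert: "hilbert_space_on V ip"
begin

abbreviation "nrm \<equiv> hnorm ip"

lemma subspace_V: "cfun.subspace V"
  using hilbert by (simp add: hilbert_space_on_def inner_product_on_def)

lemmas inner_product = hilbert[unfolded hilbert_space_on_def inner_product_on_def, THEN conjunct1]

lemma ip_add_left: "\<lbrakk>f \<in> V; g \<in> V; h \<in> V\<rbrakk> \<Longrightarrow> ip (f + g) h = ip f h + ip g h"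
  by (rule inner_product[THEN conjunct2, THEN conjunct1, rule_format])

lemma ip_scale_left: "\<lbrakk>f \<in> V; g \<in> V\<rbrakk> \<Longrightarrow> ip (cscale c f) g = c * ip f g"
  by (rule inner_product[THEN conjunct2, THEN conjunct2, THEN conjunct1, rule_format])

lemma ip_commute: "\<lbrakk>f \<in> V; g \<in> V\<rbrakk> \<Longrightarrow> ip g f = cnj (ip f g)"
  by (rule inner_product[THEN conjunct2, THEN conjunct2, THEN conjunct2, THEN conjunct1, rule_format])

lemma ip_pos: "\<lbrakk>f \<in> V; f \<noteq> 0\<rbrakk> \<Longrightarrow> Re (ip f f) > 0"
  by (rule inner_product[THEN conjunct2, THEN conjunct2, THEN conjunct2, THEN conjunct2, rule_format])

lemma zero_mem [simp]: "0 \<in> V"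
  and add_mem [simp]: "\<lbrakk>f \<in> V; g \<in> V\<rbrakk> \<Longrightarrow> f + g \<in> V"
  and diff_mem [simp]: "\<lbrakk>f \<in> V; g \<in> V\<rbrakk> \<Longrightarrow> f - g \<in> V"
  and scale_mem [simp]: "f \<in> V \<Longrightarrow> cscale c f \<in> V"
  using subspace_V cfun.subspace_0 cfun.subspace_add cfun.subspace_diff cfun.subspace_scale by blast+

lemma zero_mem' [simp]: "(\<lambda>_. 0) \<in> V"
  using zero_mem by (simp add: zero_fun_def)

lemma sum_mem: "(\<And>i. i \<in> I \<Longrightarrow> f i \<in> V) \<Longrightarrow> sum f I \<in> V"
  using subspace_V cfun.subspace_sum by blast

lemma ip_add_right: "\<lbrakk>f \<in> V; g \<in> V; h \<in> V\<rbrakk> \<Longrightarrow> ip h (f + g) = ip h f + ip h g"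
  by (metis add_mem complex_cnj_add ip_add_left ip_commute)

lemma ip_scale_right: "\<lbrakk>f \<in> V; g \<in> V\<rbrakk> \<Longrightarrow> ip f (cscale c g) = cnj c * ip f g"
  by (metis complex_cnj_mult ip_commute ip_scale_left scale_mem)

lemma ip_zero_left [simp]: "g \<in> V \<Longrightarrow> ip 0 g = 0"
  using ip_scale_left[of 0 g 0] by (simp add: cfun.scale_zero_left)

lemma ip_zero_right [simp]: "g \<in> V \<Longrightarrow> ip g 0 = 0"
  by (metis complex_cnj_zero ip_commute ip_zero_left zero_mem)

lemma ip_diff_left: "\<lbrakk>f \<in> V; g \<in> V; h \<in> V\<rbrakk> \<Longrightarrow> ip (f - g) h = ip f h - ip g h"
  using ip_add_left[of "f - g" g h] by simp

lemma ip_diff_right: "\<lbrakk>f \<in> V; g \<in> V; h \<in> V\<rbrakk> \<Longrightarrow> ip h (f - g) = ip h f - ip h g"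
  using ip_add_right[of "f - g" g h] by simp

lemma ip_sum_left:
  assumes "finite I" "\<And>i. i \<in> I \<Longrightarrow> f i \<in> V" "g \<in> V"
  shows "ip (sum f I) g = (\<Sum>i\<in>I. ip (f i) g)"
  using assms(1,2) by (induction I rule: finite_induct) (auto simp: assms(3) ip_add_left sum_mem)

lemma ip_sum_right:
  assumes "finite I" "\<And>i. i \<in> I \<Longrightarrow> f i \<in> V" "g \<in> V"
  shows "ip g (sum f I) = (\<Sum>i\<in>I. ip g (f i))"
  using assms(1,2) by (induction I rule: finite_induct) (auto simp: assms(3) ip_add_right sum_mem)

lemma ip_self: "f \<in> V \<Longrightarrow> ip f f = of_real ((nrm f)\<^sup>2)"
proof -
  assume f: "f \<in> V"
  have "Re (ip f f) \<ge> 0"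
    using ip_pos[OF f] f by (cases "f = 0") auto
  moreover have "Im (ip f f) = 0"
    using arg_cong[OF ip_commute[OF f f], of Im] by simp
  ultimately show ?thesis
    by (simp add: hnorm_def complex_eq_iff)
qed

lemma Re_ip_self: "f \<in> V \<Longrightarrow> Re (ip f f) = (nrm f)\<^sup>2"
  by (simp add: ip_self)

lemma nrm_nonneg [simp]: "f \<in> V \<Longrightarrow> 0 \<le> nrm f"
  using ip_pos[of f] by (cases "f = 0") (auto simp: hnorm_def)

lemma nrm_zero [simp]: "nrm 0 = 0"
  by (simp add: hnorm_def)

lemma nrm_eq_0_iff [simp]: "f \<in> V \<Longrightarrow> nrm f = 0 \<longleftrightarrow> f = 0"
  using ip_pos[of f] by (cases "f = 0") (auto simp: hnorm_def)

lemma nrm_scale [simp]: "f \<in> V \<Longrightarrow> nrm (cscale c f) = cmod c * nrm f"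
proof -
  assume f: "f \<in> V"
  have "complex_of_real ((nrm (cscale c f))\<^sup>2) = (c * cnj c) * ip f f"
    using f ip_self[of "cscale c f"] by (simp add: ip_scale_left ip_scale_right mult_ac)
  also have "\<dots> = complex_of_real ((cmod c * nrm f)\<^sup>2)"
    using f by (simp add: ip_self power_mult_distrib flip: complex_norm_square)
  finally have "(nrm (cscale c f))\<^sup>2 = (cmod c * nrm f)\<^sup>2"
    using of_real_eq_iff by blast
  then show ?thesis
    using f by (simp add: power2_eq_iff_nonneg)
qed

lemma nrm_add_sq:
  "\<lbrakk>f \<in> V; g \<in> V\<rbrakk> \<Longrightarrow> (nrm (f + g))\<^sup>2 = (nrm f)\<^sup>2 + 2 * Re (ip f g) + (nrm g)\<^sup>2"
  using ip_commute[of f g] by (simp add: ip_add_left ip_add_right flip: Re_ip_self)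

lemma nrm_diff_sq:
  "\<lbrakk>f \<in> V; g \<in> V\<rbrakk> \<Longrightarrow> (nrm (f - g))\<^sup>2 = (nrm f)\<^sup>2 - 2 * Re (ip f g) + (nrm g)\<^sup>2"
  using ip_commute[of f g] by (simp add: ip_diff_left ip_diff_right flip: Re_ip_self)

lemma nrm_minus_commute: "\<lbrakk>f \<in> V; g \<in> V\<rbrakk> \<Longrightarrow> nrm (f - g) = nrm (g - f)"
  using ip_commute[of f g] by (simp add: hnorm_def ip_diff_left ip_diff_right)

lemma Cauchy_Schwarz: "\<lbrakk>f \<in> V; g \<in> V\<rbrakk> \<Longrightarrow> cmod (ip f g) \<le> nrm f * nrm g"
proof (cases "g = 0")
  case False
  assume f: "f \<in> V" and g: "g \<in> V"
  define t where "t = ip f g / of_real ((nrm g)\<^sup>2)"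
  have pos: "nrm g > 0"
    using False g nrm_nonneg[OF g] by (simp add: less_le)
  have "0 \<le> (nrm (f - cscale t g))\<^sup>2"
    by simp
  also have "\<dots> = (nrm f)\<^sup>2 - 2 * Re (cnj t * ip f g) + (cmod t)\<^sup>2 * (nrm g)\<^sup>2"
    using f g by (simp add: nrm_diff_sq ip_scale_right power_mult_distrib)
  also have "cnj t * ip f g = of_real ((cmod (ip f g))\<^sup>2 / (nrm g)\<^sup>2)"
    by (simp add: t_def mult.commute[of "cnj (ip f g)"] flip: complex_norm_square)
  also have "(cmod t)\<^sup>2 * (nrm g)\<^sup>2 = (cmod (ip f g))\<^sup>2 / (nrm g)\<^sup>2"
  proof -
    have "cmod t = cmod (ip f g) / (nrm g)\<^sup>2"
      using g by (simp add: t_def norm_divide norm_power)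
    then show ?thesis
      using pos by (simp add: power2_eq_square)
  qed
  finally have "(cmod (ip f g))\<^sup>2 \<le> (nrm f * nrm g)\<^sup>2"
    using pos by (simp add: field_simps power_mult_distrib)
  then show ?thesis
    using f g by (meson nrm_nonneg mult_nonneg_nonneg power2_le_imp_le)
qed auto

lemma nrm_triangle: "\<lbrakk>f \<in> V; g \<in> V\<rbrakk> \<Longrightarrow> nrm (f + g) \<le> nrm f + nrm g"
proof -
  assume f: "f \<in> V" and g: "g \<in> V"
  have "Re (ip f g) \<le> nrm f * nrm g"
    using Cauchy_Schwarz[OF f g] complex_Re_le_cmod order_trans by blast
  then have "(nrm (f + g))\<^sup>2 \<le> (nrm f + nrm g)\<^sup>2"
    using f g by (simp add: nrm_add_sq power2_sum)
  then show ?thesis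
    using f g by (meson add_nonneg_nonneg nrm_nonneg power2_le_imp_le)
qed

lemma nrm_triangle_diff:
  "\<lbrakk>f \<in> V; g \<in> V; h \<in> V\<rbrakk> \<Longrightarrow> nrm (f - h) \<le> nrm (f - g) + nrm (g - h)"
  using nrm_triangle[of "f - g" "g - h"] by simp

lemma nrm_diff_le: "\<lbrakk>f \<in> V; g \<in> V\<rbrakk> \<Longrightarrow> nrm (f - g) \<le> nrm f + nrm g"
  using nrm_triangle_diff[of f 0 g] nrm_minus_commute[of 0 g] by simp

lemma nrm_reverse_triangle: "\<lbrakk>f \<in> V; g \<in> V\<rbrakk> \<Longrightarrow> \<bar>nrm f - nrm g\<bar> \<le> nrm (f - g)"
  using nrm_triangle[of "f - g" g] nrm_triangle[of "g - f" f] nrm_minus_commute[of f g]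
  by simp

section \<open>Norm convergence and the Riesz representation\<close>

definition hconv :: "(nat \<Rightarrow> 'x cfun) \<Rightarrow> 'x cfun \<Rightarrow> bool" where
  "hconv s f \<longleftrightarrow> (\<forall>n. s n \<in> V) \<and> f \<in> V \<and> (\<lambda>n. nrm (s n - f)) \<longlonglongrightarrow> 0"

lemma hconv_const: "f \<in> V \<Longrightarrow> hconv (\<lambda>_. f) f"
  by (simp add: hconv_def)

lemma hconv_nrm: "hconv s f \<Longrightarrow> (\<lambda>n. nrm (s n)) \<longlonglongrightarrow> nrm f"
  unfolding hconv_def
  by (intro LIMSEQ_I) (smt (verit, best) LIMSEQ_D nrm_reverse_triangle real_norm_def)

lemma hconv_ip:
  assumes "hconv s f" "hconv t g"
  shows "(\<lambda>n. ip (s n) (t n)) \<longlonglongrightarrow> ip f g"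
proof -
  have mem: "s n \<in> V" "t n \<in> V" "f \<in> V" "g \<in> V" for n
    using assms by (auto simp: hconv_def)
  have "(\<lambda>n. nrm (s n - f) * nrm (t n) + nrm f * nrm (t n - g)) \<longlonglongrightarrow> 0 * nrm g + nrm f * 0"
    using assms hconv_nrm[OF assms(2)] unfolding hconv_def by (intro tendsto_intros) auto
  then have lim: "(\<lambda>n. nrm (s n - f) * nrm (t n) + nrm f * nrm (t n - g)) \<longlonglongrightarrow> 0"
    by simp
  have "cmod (ip (s n) (t n) - ip f g) \<le> nrm (s n - f) * nrm (t n) + nrm f * nrm (t n - g)" for n
  proof -
    have "ip (s n) (t n) - ip f g = ip (s n - f) (t n) + ip f (t n - g)"
      using mem by (simp add: ip_diff_left ip_diff_right)
    then show ?thesis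
      using Cauchy_Schwarz[of "s n - f" "t n"] Cauchy_Schwarz[of f "t n - g"] mem
      by (metis (no_types, lifting) add_mono diff_mem norm_triangle_le)
  qed
  then show ?thesis
    by (subst LIM_zero_iff[symmetric]) (rule Lim_null_comparison[OF _ lim], simp)
qed

lemma Cauchy_hconv:
  assumes "\<And>n. s n \<in> V" "\<And>e. e > 0 \<Longrightarrow> \<exists>N. \<forall>m\<ge>N. \<forall>n\<ge>N. nrm (s m - s n) < e"
  obtains f where "hconv s f"
proof -
  have "\<exists>f\<in>V. (\<lambda>n. nrm (s n - f)) \<longlonglongrightarrow> 0"
    using hilbert assms unfolding hilbert_space_on_def by blast
  then show ?thesis
    using that assms(1) by (auto simp: hconv_def)
qed

text \<open>Telescoping. The gliding hump and the Neumann series below both converge through it; the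
  hump also needs the tail bound.\<close>

lemma geometric_hconv:
  assumes s: "\<And>n. s n \<in> V" and step: "\<And>n. nrm (s (Suc n) - s n) \<le> A * r ^ n"
    and r: "0 \<le> r" "r < 1"
  obtains f where "hconv s f" "\<And>n. nrm (f - s n) \<le> A * r ^ n / (1 - r)"
proof -
  have A: "0 \<le> A"
    using step[of 0] s by (metis diff_mem mult.right_neutral nrm_nonneg order_trans power_0)
  \<comment> \<open>The factor \<open>1 - r ^ m\<close> makes the induction exact; the bound without
    it does not reproduce itself.\<close>
  have tele: "nrm (s (n + m) - s n) \<le> A * r ^ n * (1 - r ^ m) / (1 - r)" for n m
  proof (induction m)
    case (Suc m)
    have "nrm (s (n + Suc m) - s n) \<le> nrm (s (Suc (n + m)) - s (n + m)) + nrm (s (n + m) - s n)"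
      using s by (simp add: nrm_triangle_diff)
    also have "\<dots> \<le> A * r ^ (n + m) + A * r ^ n * (1 - r ^ m) / (1 - r)"
      by (intro add_mono step Suc)
    also have "\<dots> = A * r ^ n * (1 - r ^ Suc m) / (1 - r)"
      using r by (simp add: field_simps power_add)
    finally show ?case .
  qed (use s r in \<open>simp flip: zero_fun_def\<close>)
  have tele': "nrm (s (n + m) - s n) \<le> A * r ^ n / (1 - r)" for n m
  proof -
    have "A * r ^ n * (1 - r ^ m) \<le> A * r ^ n * 1"
      using A r by (intro mult_left_mono) auto
    then show ?thesis
      using tele[of n m] r by (smt (verit) divide_right_mono mult.right_neutral)
  qed
  have lim: "(\<lambda>n. A * r ^ n / (1 - r)) \<longlonglongrightarrow> 0"
    using r by (auto intro!: tendsto_eq_intros LIMSEQ_power_zero)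
  have "\<exists>N. \<forall>m\<ge>N. \<forall>n\<ge>N. nrm (s m - s n) < e" if "e > 0" for e
  proof -
    obtain N where N: "A * r ^ N / (1 - r) < e / 2"
      using order_tendstoD(2)[OF lim half_gt_zero[OF \<open>e > 0\<close>]] unfolding eventually_sequentially by blast
    have "nrm (s m - s n) < e" if "m \<ge> N" "n \<ge> N" for m n
    proof -
      have "nrm (s m - s N) \<le> A * r ^ N / (1 - r)" "nrm (s n - s N) \<le> A * r ^ N / (1 - r)"
        using tele'[of N "m - N"] tele'[of N "n - N"] that by simp_all
      then show ?thesis
        using nrm_triangle_diff[of "s m" "s N" "s n", OF s s s]
          nrm_minus_commute[of "s n" "s N", OF s s] N by linarith
    qed
    then show ?thesis by blast
  qed
  with s obtain f where f: "hconv s f"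
    using Cauchy_hconv by blast
  have "nrm (f - s n) \<le> A * r ^ n / (1 - r)" for n
  proof -
    have "(\<lambda>m. nrm (s (m + n) - f)) \<longlonglongrightarrow> 0"
      using f LIMSEQ_ignore_initial_segment unfolding hconv_def by blast
    then have "(\<lambda>m. nrm (s (m + n) - f) + A * r ^ n / (1 - r)) \<longlonglongrightarrow> 0 + A * r ^ n / (1 - r)"
      by (intro tendsto_intros)
    moreover have "nrm (f - s n) \<le> nrm (s (m + n) - f) + A * r ^ n / (1 - r)" for m
      using nrm_triangle_diff[of f "s (m + n)" "s n"] tele'[of n m] s f
        nrm_minus_commute[of f "s (m + n)"] by (auto simp: hconv_def add.commute)
    ultimately show ?thesis
      by (metis (no_types, lifting) LIMSEQ_le_const add_0)
  qed
  with f that show ?thesis by blast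
qed

text \<open>
  The functional lives on the parameter space \<open>F\<close>, so that it need not be well defined on the
  image of \<open>\<Phi>\<close> a priori. The representing vector minimises \<open>\<parallel>\<Phi> c\<parallel>\<^sup>2 - 2 Re (l c)\<close>.
\<close>

lemma Riesz_parametrized:
  fixes F :: "'y cfun set"
  assumes F: "cfun.subspace F"
    and \<Phi>: "\<And>c. c \<in> F \<Longrightarrow> \<Phi> c \<in> V" "\<And>c d. \<lbrakk>c \<in> F; d \<in> F\<rbrakk> \<Longrightarrow> \<Phi> (c + d) = \<Phi> c + \<Phi> d"
      "\<And>t c. c \<in> F \<Longrightarrow> \<Phi> (cscale t c) = cscale t (\<Phi> c)"
    and l: "\<And>c d. \<lbrakk>c \<in> F; d \<in> F\<rbrakk> \<Longrightarrow> l (c + d) = l c + l d"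
      "\<And>t c. c \<in> F \<Longrightarrow> l (cscale t c) = t * l c" "\<And>c. c \<in> F \<Longrightarrow> cmod (l c) \<le> C * nrm (\<Phi> c)"
  obtains s g where "\<And>n. s n \<in> F" "hconv (\<lambda>n. \<Phi> (s n)) g" "\<And>c. c \<in> F \<Longrightarrow> l c = ip (\<Phi> c) g"
proof -
  define J where "J c = (nrm (\<Phi> c))\<^sup>2 - 2 * Re (l c)" for c
  have Fadd: "c + d \<in> F" and Fsc: "cscale t c \<in> F" if "c \<in> F" "d \<in> F" for c d t
    using that F cfun.subspace_add cfun.subspace_scale by blast+
  have F0: "0 \<in> F"
    using F cfun.subspace_0 by blast
  have J_low: "- C\<^sup>2 \<le> J c" if "c \<in> F" for c
  proof -
    have "Re (l c) \<le> C * nrm (\<Phi> c)"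
      using l(3)[OF that] complex_Re_le_cmod order_trans by blast
    moreover have "0 \<le> (nrm (\<Phi> c) - C)\<^sup>2" by simp
    ultimately show ?thesis
      unfolding J_def power2_diff by (simp add: mult.commute)
  qed
  define I where "I = Inf (J ` F)"
  have bdd: "bdd_below (J ` F)"
    using J_low by (meson bdd_belowI2)
  have I_le: "I \<le> J c" if "c \<in> F" for c
    unfolding I_def using that bdd by (simp add: cInf_lower)
  have "\<exists>c\<in>F. J c < I + 1 / real (Suc n)" for n
  proof -
    have "Inf (J ` F) < I + 1 / real (Suc n)"
      by (simp add: I_def)
    then show ?thesis
      using cInf_lessD[of "J ` F"] F0 by blast
  qed
  then obtain s where s: "\<And>n. s n \<in> F" "\<And>n. J (s n) < I + 1 / real (Suc n)"
    by metis
  have J_add: "J (c + cscale t d) = J c + 2 * Re (t * (ip (\<Phi> d) (\<Phi> c) - l d)) + (cmod t)\<^sup>2 * (nrm (\<Phi> d))\<^sup>2"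
    if "c \<in> F" "d \<in> F" for c d t
  proof -
    have "Re (ip (\<Phi> c) (cscale t (\<Phi> d))) = Re (t * ip (\<Phi> d) (\<Phi> c))"
      using ip_commute[of "cscale t (\<Phi> d)" "\<Phi> c"] that \<Phi>(1) by (simp add: ip_scale_left)
    then show ?thesis
      using that by (simp add: J_def \<Phi> l Fsc nrm_add_sq power_mult_distrib algebra_simps)
  qed
  \<comment> \<open>A midpoint again has \<open>J \<ge> I\<close>, so two near-minimisers have
    nearby images: a minimising sequence has Cauchy images.\<close>
  have par: "(nrm (\<Phi> c - \<Phi> d))\<^sup>2 = 2 * J c + 2 * J d - 4 * J (cscale (1/2) (c + d))"
    if "c \<in> F" "d \<in> F" for c d
  proof -
    have "(nrm (cscale (1/2) (\<Phi> c + \<Phi> d)))\<^sup>2 = (nrm (\<Phi> c + \<Phi> d))\<^sup>2 / 4"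
      using that \<Phi>(1) by (simp add: power_divide)
    moreover have "Re (l (cscale (1/2) (c + d))) = (Re (l c) + Re (l d)) / 2"
      using that by (simp add: l Fadd)
    moreover have "\<Phi> (cscale (1/2) (c + d)) = cscale (1/2) (\<Phi> c + \<Phi> d)"
      using that by (simp add: \<Phi> Fadd)
    ultimately show ?thesis
      using that \<Phi>(1) by (simp add: J_def nrm_add_sq nrm_diff_sq)
  qed
  have "\<exists>N. \<forall>m\<ge>N. \<forall>n\<ge>N. nrm (\<Phi> (s m) - \<Phi> (s n)) < e" if "e > 0" for e
  proof -
    obtain N where N: "1 / real (Suc N) < e\<^sup>2 / 4"
      using \<open>e > 0\<close> by (elim nat_approx_posE[of "e\<^sup>2 / 4", rotated]) simp
    have "nrm (\<Phi> (s m) - \<Phi> (s n)) < e" if "m \<ge> N" "n \<ge> N" for m n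
    proof -
      have "1 / real (Suc m) \<le> 1 / real (Suc N)" "1 / real (Suc n) \<le> 1 / real (Suc N)"
        using that by (auto simp: field_simps)
      then have "(nrm (\<Phi> (s m) - \<Phi> (s n)))\<^sup>2 < e\<^sup>2"
        using par[OF s(1)[of m] s(1)[of n]] s(2)[of m] s(2)[of n] N
          I_le[OF Fsc[OF Fadd[OF s(1)[of m] s(1)[of n]] F0, of "1/2"]]
        by linarith
      then show ?thesis
        using \<open>e > 0\<close> power2_less_imp_less by fastforce
    qed
    then show ?thesis by blast
  qed
  then obtain g where g: "hconv (\<lambda>n. \<Phi> (s n)) g"
    using Cauchy_hconv[of "\<lambda>n. \<Phi> (s n)"] s(1) \<Phi>(1) by blast
  have "l d = ip (\<Phi> d) g" if d: "d \<in> F" for d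
  proof -
    \<comment> \<open>Near-minimality of \<open>s n\<close> costs at most
      \<open>1 / (n + 1)\<close>. In the limit the term linear in \<open>t\<close> is dominated by
      the quadratic one, hence it vanishes.\<close>
    have "2 * Re (t * (l d - ip (\<Phi> d) g)) \<le> (cmod t)\<^sup>2 * (nrm (\<Phi> d))\<^sup>2" for t
    proof -
      have lim: "(\<lambda>n. 1 / real (Suc n) + 2 * Re (t * (ip (\<Phi> d) (\<Phi> (s n)) - l d)) + (cmod t)\<^sup>2 * (nrm (\<Phi> d))\<^sup>2)
          \<longlonglongrightarrow> 0 + 2 * Re (t * (ip (\<Phi> d) g - l d)) + (cmod t)\<^sup>2 * (nrm (\<Phi> d))\<^sup>2"
        using hconv_ip[OF hconv_const[OF \<Phi>(1)[OF d]] g]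
        by (intro tendsto_intros LIMSEQ_Suc lim_1_over_n)
      have "0 \<le> 1 / real (Suc n) + 2 * Re (t * (ip (\<Phi> d) (\<Phi> (s n)) - l d)) + (cmod t)\<^sup>2 * (nrm (\<Phi> d))\<^sup>2" for n
        using I_le[OF Fadd[OF s(1)[of n] Fsc[OF d d, of t]]] J_add[OF s(1)[of n] d, of t] s(2)[of n]
        by linarith
      then have "0 \<le> 0 + 2 * Re (t * (ip (\<Phi> d) g - l d)) + (cmod t)\<^sup>2 * (nrm (\<Phi> d))\<^sup>2"
        by (intro LIMSEQ_le_const[OF lim]) blast
      then show ?thesis by (simp add: algebra_simps)
    qed
    then show ?thesis
      using quadratic_perturbation_zero by (metis eq_iff_diff_eq_0)
  qed
  then show ?thesis
    using that s(1) g by blast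
qed

lemma Riesz:
  assumes "\<And>f g. \<lbrakk>f \<in> V; g \<in> V\<rbrakk> \<Longrightarrow> l (f + g) = l f + l g"
    "\<And>t f. f \<in> V \<Longrightarrow> l (cscale t f) = t * l f" "\<And>f. f \<in> V \<Longrightarrow> cmod (l f) \<le> C * nrm f"
  obtains g where "g \<in> V" "\<And>f. f \<in> V \<Longrightarrow> l f = ip f g"
proof -
  obtain s g where "\<And>n. s n \<in> V" "hconv (\<lambda>n. s n) g" "\<And>f. f \<in> V \<Longrightarrow> l f = ip f g"
    by (rule Riesz_parametrized[OF subspace_V, of "\<lambda>f. f" l C]) (use assms in auto)
  with that show ?thesis
    by (auto simp: hconv_def)
qed

lemma vector_eqI: "\<lbrakk>f \<in> V; g \<in> V; \<And>h. h \<in> V \<Longrightarrow> ip h f = ip h g\<rbrakk> \<Longrightarrow> f = g"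
  by (metis diff_mem eq_iff_diff_eq_0 ip_diff_right ip_self nrm_eq_0_iff of_real_eq_0_iff zero_eq_power2)

end

section \<open>Kernels, multipliers and their adjoints\<close>

lemma cscale_apply: "cscale t c w = t * c w"
  by (simp add: cscale_def)

locale rk_space =
  fixes X :: "'x set" and k :: "'x \<Rightarrow> 'x \<Rightarrow> complex" and H :: "'x cfun set"
    and ip :: "'x cfun \<Rightarrow> 'x cfun \<Rightarrow> complex"
  assumes rkhs: "rkhs X k H ip"

sublocale rk_space \<subseteq> hilbert_function_space H ip
  using rkhs by unfold_locales (simp add: rkhs_def)

context rk_space begin

definition kern :: "'x \<Rightarrow> 'x cfun" where
  "kern w = (\<lambda>z. if z \<in> X then k z w else 0)"

lemma vanish: "\<lbrakk>f \<in> H; x \<notin> X\<rbrakk> \<Longrightarrow> f x = 0"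
  using rkhs by (simp add: rkhs_def)

lemma kern_mem [simp]: "w \<in> X \<Longrightarrow> kern w \<in> H"
  and ip_kern: "\<lbrakk>f \<in> H; w \<in> X\<rbrakk> \<Longrightarrow> ip f (kern w) = f w"
  using rkhs by (simp_all add: rkhs_def kern_def)

lemma ip_kern_left: "\<lbrakk>f \<in> H; w \<in> X\<rbrakk> \<Longrightarrow> ip (kern w) f = cnj (f w)"
  using ip_commute ip_kern kern_mem by metis

lemma ip_kern_kern: "\<lbrakk>w \<in> X; z \<in> X\<rbrakk> \<Longrightarrow> ip (kern w) (kern z) = k z w"
  by (simp add: ip_kern) (simp add: kern_def)

lemma hconv_eval:
  assumes "hconv s f"
  shows "(\<lambda>n. s n x) \<longlonglongrightarrow> f x"
proof (cases "x \<in> X")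
  case True
  have "(\<lambda>n. ip (s n) (kern x)) \<longlonglongrightarrow> ip f (kern x)"
    using assms hconv_const[OF kern_mem[OF True]] hconv_ip by blast
  then show ?thesis
    using assms True by (simp add: hconv_def ip_kern)
next
  case False
  then show ?thesis
    using assms by (simp add: hconv_def vanish)
qed

section \<open>Finite combinations of kernel functions\<close>

definition coeffs :: "'x cfun set" where
  "coeffs = {c. finite {x. c x \<noteq> 0} \<and> {x. c x \<noteq> 0} \<subseteq> X}"

text \<open>Combinations are parametrised by their coefficients: kernel functions may be linearly
  dependent, so the adjoint of a multiplication, known at first on kernel functions only, is well
  defined on coefficients, where it is pointwise multiplication by the conjugate.\<close>

definition comb :: "'x cfun \<Rightarrow> 'x cfun" where
  "comb c = (\<Sum>w | c w \<noteq> 0. cscale (c w) (kern w))"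

lemma subspace_coeffs: "cfun.subspace coeffs"
proof (rule cfun.subspaceI)
  fix c d assume "c \<in> coeffs" "d \<in> coeffs"
  moreover have "{x. (c + d) x \<noteq> 0} \<subseteq> {x. c x \<noteq> 0} \<union> {x. d x \<noteq> 0}"
    by auto
  ultimately show "c + d \<in> coeffs"
    unfolding coeffs_def by (auto intro: finite_subset)
next
  fix t c assume "c \<in> coeffs"
  then show "cscale t c \<in> coeffs"
    unfolding coeffs_def cscale_def by (auto intro: finite_subset)
qed (simp add: coeffs_def)

lemma coeffs_times: "c \<in> coeffs \<Longrightarrow> u * c \<in> coeffs"
  unfolding coeffs_def by (auto intro: finite_subset[of _ "{x. c x \<noteq> 0}"])

lemma comb_eq:
  assumes "finite S" "{w. c w \<noteq> 0} \<subseteq> S"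
  shows "comb c = (\<Sum>w\<in>S. cscale (c w) (kern w))"
  unfolding comb_def using assms
  by (intro sum.mono_neutral_left) (auto simp: cscale_def zero_fun_def)

lemma comb_mem [simp]: "c \<in> coeffs \<Longrightarrow> comb c \<in> H"
  unfolding comb_def coeffs_def by (auto intro!: sum_mem)

lemma comb_add:
  assumes "c \<in> coeffs" "d \<in> coeffs"
  shows "comb (c + d) = comb c + comb d"
proof -
  let ?S = "{x. c x \<noteq> 0} \<union> {x. d x \<noteq> 0}"
  have "finite ?S"
    using assms by (simp add: coeffs_def)
  then show ?thesis
    by (subst (1 2 3) comb_eq[of ?S]) (auto simp: cfun.scale_left_distrib sum.distrib)
qed

lemma comb_scale:
  assumes "c \<in> coeffs"
  shows "comb (cscale t c) = cscale t (comb c)"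
proof -
  let ?S = "{x. c x \<noteq> 0}"
  have "finite ?S"
    using assms by (simp add: coeffs_def)
  then show ?thesis
    by (subst (1 2) comb_eq[of ?S]) (auto simp: cfun.scale_sum_right cscale_apply)
qed

lemma ip_comb_right:
  assumes "f \<in> H" "c \<in> coeffs"
  shows "ip f (comb c) = (\<Sum>w | c w \<noteq> 0. cnj (c w) * f w)"
proof -
  have *: "finite {w. c w \<noteq> 0}" "{w. c w \<noteq> 0} \<subseteq> X"
    using assms by (auto simp: coeffs_def)
  have "ip f (comb c) = (\<Sum>w | c w \<noteq> 0. ip f (cscale (c w) (kern w)))"
    unfolding comb_def using * assms by (intro ip_sum_right) auto
  also have "\<dots> = (\<Sum>w | c w \<noteq> 0. cnj (c w) * f w)"
    using * assms by (intro sum.cong) (auto simp: ip_scale_right ip_kern subset_iff)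
  finally show ?thesis .
qed

lemma single_coeffs: "w \<in> X \<Longrightarrow> (\<lambda>x. if x = w then t else 0) \<in> coeffs"
  by (auto simp: coeffs_def)

lemma comb_single: "w \<in> X \<Longrightarrow> comb (\<lambda>x. if x = w then t else 0) = cscale t (kern w)"
  by (subst comb_eq[of "{w}"]) auto

text \<open>Riesz over the coefficient space returns a limit of combinations that pairs with every
  kernel function as \<open>f\<close> does; by the reproducing property it agrees with
  \<open>f\<close> pointwise.\<close>

lemma comb_dense:
  assumes "f \<in> H"
  obtains s where "\<And>n. s n \<in> coeffs" "hconv (\<lambda>n. comb (s n)) f"
proof -
  obtain s g where s: "\<And>n. s n \<in> coeffs" "hconv (\<lambda>n. comb (s n)) g"
    and g: "\<And>c. c \<in> coeffs \<Longrightarrow> ip (comb c) f = ip (comb c) g"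
    by (rule Riesz_parametrized[OF subspace_coeffs, of comb "\<lambda>c. ip (comb c) f" "nrm f"])
      (use assms in \<open>auto simp: comb_add comb_scale ip_add_left ip_scale_left Cauchy_Schwarz mult.commute[of "nrm f"]\<close>)
  have gH: "g \<in> H"
    using s by (simp add: hconv_def)
  have "f = g"
  proof
    fix x
    show "f x = g x"
    proof (cases "x \<in> X")
      case True
      then show ?thesis
        using g[OF single_coeffs[OF True, of 1]] assms gH
        by (simp add: comb_single ip_kern_left)
    next
      case False
      then show ?thesis
        using vanish[OF assms] vanish[OF gH] by simp
    qed
  qed
  with s that show ?thesis by blast
qed

section \<open>Multipliers and their boundedness\<close>

definition multiplier :: "'x cfun \<Rightarrow> bool" where
  "multiplier \<psi> \<longleftrightarrow> (\<forall>x. x \<notin> X \<longrightarrow> \<psi> x = 0) \<and> (\<forall>f\<in>H. \<psi> * f \<in> H)"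

lemma multiplier_mem [simp]: "\<lbrakk>multiplier \<psi>; f \<in> H\<rbrakk> \<Longrightarrow> \<psi> * f \<in> H"
  by (simp add: multiplier_def)

lemma ip_times_comb:
  assumes "\<psi> * f \<in> H" "f \<in> H" "c \<in> coeffs"
  shows "ip (\<psi> * f) (comb c) = ip f (comb ((\<lambda>w. cnj (\<psi> w)) * c))"
proof -
  have "finite {w. c w \<noteq> 0}"
    using assms by (simp add: coeffs_def)
  then show ?thesis
    unfolding ip_comb_right[OF assms(1,3)] ip_comb_right[OF assms(2) coeffs_times[OF assms(3)]]
    by (intro sum.mono_neutral_cong_right) auto
qed

text \<open>The Riesz vector of the functional sending \<open>c\<close> to the pairing of
  \<open>comb ((\<lambda>w. cnj (\<psi> w)) * c)\<close> with \<open>f\<close> has the value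
  \<open>\<psi> x * f x\<close> at each point, so it is \<open>\<psi> * f\<close>.\<close>

lemma multiplierI_bounded:
  assumes van: "\<And>x. x \<notin> X \<Longrightarrow> \<psi> x = 0"
    and bd: "\<And>c. c \<in> coeffs \<Longrightarrow> nrm (comb ((\<lambda>w. cnj (\<psi> w)) * c)) \<le> C * nrm (comb c)"
  shows "multiplier \<psi>"
  unfolding multiplier_def
proof (intro conjI ballI allI impI van)
  fix f assume f: "f \<in> H"
  let ?u = "\<lambda>w. cnj (\<psi> w)"
  obtain s g where s: "hconv (\<lambda>n. comb (s n)) g"
    and g: "\<And>c. c \<in> coeffs \<Longrightarrow> ip (comb (?u * c)) f = ip (comb c) g"
  proof (rule Riesz_parametrized[OF subspace_coeffs, of comb "\<lambda>c. ip (comb (?u * c)) f" "C * nrm f"])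
    fix c d assume "c \<in> coeffs" "d \<in> coeffs"
    then show "ip (comb (?u * (c + d))) f = ip (comb (?u * c)) f + ip (comb (?u * d)) f"
      using f by (simp add: distrib_left comb_add coeffs_times ip_add_left)
  next
    fix t c assume "c \<in> coeffs"
    moreover have "?u * cscale t c = cscale t (?u * c)"
      by (auto simp: cscale_def)
    ultimately show "ip (comb (?u * cscale t c)) f = t * ip (comb (?u * c)) f"
      using f by (simp add: comb_scale coeffs_times ip_scale_left)
  next
    fix c assume c: "c \<in> coeffs"
    have "cmod (ip (comb (?u * c)) f) \<le> nrm (comb (?u * c)) * nrm f"
      using c f by (simp add: Cauchy_Schwarz coeffs_times)
    also have "\<dots> \<le> C * nrm (comb c) * nrm f"
      using bd c f by (simp add: mult_right_mono)
    finally show "cmod (ip (comb (?u * c)) f) \<le> C * nrm f * nrm (comb c)"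
      by (simp add: mult_ac)
  qed (auto simp: comb_add comb_scale)
  have gH: "g \<in> H"
    using s by (simp add: hconv_def)
  have "\<psi> x * f x = g x" for x
  proof (cases "x \<in> X")
    case True
    have "?u * (\<lambda>y. if y = x then 1 else 0) = (\<lambda>y. if y = x then ?u x else 0)"
      by auto
    then show ?thesis
      using g[OF single_coeffs[OF True, of 1]] f gH True
      by (simp add: comb_single ip_kern_left ip_scale_left flip: complex_cnj_mult)
  next
    case False
    then show ?thesis
      using van vanish[OF gH] by simp
  qed
  then have "\<psi> * f = g"
    by auto
  with gH show "\<psi> * f \<in> H" by simp
qed

text \<open>A gliding hump replaces the closed graph theorem.\<close>

lemma multiplier_bounded_on_combs:
  assumes \<psi>: "multiplier \<psi>"
  shows "\<exists>C. \<forall>c\<in>coeffs. nrm (comb ((\<lambda>w. cnj (\<psi> w)) * c)) \<le> C * nrm (comb c)"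
proof (rule ccontr)
  assume neg: "\<not> ?thesis"
  define A where "A c = comb ((\<lambda>w. cnj (\<psi> w)) * c)" for c
  have "\<forall>n::nat. \<exists>c\<in>coeffs. nrm (A c) > 4 ^ n * nrm (comb c)"
    using neg by (auto simp: A_def not_le)
  then obtain c where c: "\<And>n. c n \<in> coeffs" and big: "\<And>n. nrm (A (c n)) > 4 ^ n * nrm (comb (c n))"
    by metis
  define u where "u n = A (c n)" for n
  have u: "u n \<in> H" for n
    by (simp add: u_def A_def c coeffs_times)
  have upos: "nrm (u n) > 0" for n
  proof -
    have "0 \<le> 4 ^ n * nrm (comb (c n))"
      using c by simp
    also have "\<dots> < nrm (u n)"
      using big by (simp add: u_def)
    finally show ?thesis .
  qed
  \<comment> \<open>\<open>y n\<close> points along \<open>u n\<close> and has norm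
    \<open>3^-(n+1)\<close>, while \<open>u n\<close> exceeds \<open>4^n\<close> times the norm of
    the combination it comes from: growth 4 beats decay 3.\<close>
  define y where "y n = cscale (of_real ((1/3) ^ Suc n / nrm (u n))) (u n)" for n
  have y: "y n \<in> H" for n
    using u by (simp add: y_def)
  have ny: "nrm (y n) = (1/3) ^ Suc n" for n
    unfolding y_def nrm_scale[OF u] using upos[of n] by (simp add: norm_divide norm_power)
  have yu: "cmod (ip (y n) (u n)) = (1/3) ^ Suc n * nrm (u n)" for n
    unfolding y_def ip_scale_left[OF u u] ip_self[OF u] using upos[of n]
    by (simp add: norm_mult norm_divide norm_power power2_eq_square)
  \<comment> \<open>The two candidates differ by \<open>2 y n\<close>, so one of them pairs with
    \<open>u n\<close> at least as strongly as \<open>y n\<close> alone; earlier terms cannot cancel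
    the hump.\<close>
  define x where "x = rec_nat 0 (\<lambda>n v. if cmod (ip (v + y n) (u n)) \<ge> cmod (ip (y n) (u n)) then v + y n else v - y n)"
  have xSuc: "x (Suc n) = (if cmod (ip (x n + y n) (u n)) \<ge> cmod (ip (y n) (u n)) then x n + y n else x n - y n)" for n
    by (simp add: x_def)
  have x: "x n \<in> H" for n
    by (induction n) (auto simp: xSuc y, simp add: x_def)
  have far: "cmod (ip (x (Suc n)) (u n)) \<ge> cmod (ip (y n) (u n))" for n
  proof -
    have "ip (x n + y n) (u n) - ip (x n - y n) (u n) = 2 * ip (y n) (u n)"
      using x y u by (simp add: ip_add_left ip_diff_left)
    then have "2 * cmod (ip (y n) (u n)) \<le> cmod (ip (x n + y n) (u n)) + cmod (ip (x n - y n) (u n))"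
      by (metis norm_mult norm_numeral norm_triangle_ineq4)
    then show ?thesis
      by (auto simp: xSuc)
  qed
  have step: "nrm (x (Suc n) - x n) \<le> 1/3 * (1/3) ^ n" for n
  proof -
    have "x (Suc n) - x n = y n \<or> x n - x (Suc n) = y n"
      by (simp add: xSuc)
    then show ?thesis
      using ny[of n] nrm_minus_commute[OF x x, of n "Suc n"] by auto
  qed
  obtain z where z: "hconv x z" "\<And>n. nrm (z - x n) \<le> 1/3 * (1/3) ^ n / (1 - 1/3)"
    using geometric_hconv[of x "1/3" "1/3"] x step by auto
  have zH: "z \<in> H"
    using z by (simp add: hconv_def)
  have "(4/3) ^ n \<le> 6 * nrm (\<psi> * z)" for n :: nat
  proof -
    \<comment> \<open>Everything added after the step \<open>n\<close> has total norm at most half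
      of \<open>3^-(n+1)\<close>, so half of the hump survives in the limit
      \<open>z\<close>.\<close>
    have "cmod (ip (z - x (Suc n)) (u n)) \<le> nrm (z - x (Suc n)) * nrm (u n)"
      using zH x u by (simp add: Cauchy_Schwarz)
    also have "\<dots> \<le> (1/2 * (1/3) ^ Suc n) * nrm (u n)"
      using z(2)[of "Suc n"] upos[of n] by (intro mult_right_mono) auto
    finally have "cmod (ip (z - x (Suc n)) (u n)) \<le> (1/2 * (1/3) ^ Suc n) * nrm (u n)" .
    moreover have "ip (x (Suc n)) (u n) = ip z (u n) - ip (z - x (Suc n)) (u n)"
      using zH x u by (simp add: ip_diff_left)
    ultimately have "1/2 * (1/3) ^ Suc n * nrm (u n) \<le> cmod (ip z (u n))"
      using far[of n] yu[of n] norm_triangle_ineq4[of "ip z (u n)" "ip (z - x (Suc n)) (u n)"]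
      by simp
    also have "\<dots> = cmod (ip (\<psi> * z) (comb (c n)))"
      unfolding u_def A_def using zH c \<psi> by (simp add: ip_times_comb)
    also have "\<dots> \<le> nrm (\<psi> * z) * nrm (comb (c n))"
      using zH c \<psi> by (simp add: Cauchy_Schwarz)
    also have "\<dots> \<le> nrm (\<psi> * z) * (nrm (u n) / 4 ^ n)"
      using big[of n] zH \<psi> by (intro mult_left_mono) (auto simp: u_def field_simps)
    finally have "(1/2 * (1/3) ^ Suc n) * nrm (u n) \<le> (nrm (\<psi> * z) / 4 ^ n) * nrm (u n)"
      by simp
    then have "1/2 * (1/3) ^ Suc n \<le> nrm (\<psi> * z) / 4 ^ n"
      using upos[of n] by (simp only: mult_le_cancel_right_pos)
    then show ?thesis
      by (simp add: field_simps power_divide)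
  qed
  moreover obtain n :: nat where "6 * nrm (\<psi> * z) < (4/3) ^ n"
    using real_arch_pow[of "4/3"] by auto
  ultimately show False
    using not_less by blast
qed

text \<open>Testing \<open>\<psi> * f\<close> against combinations that converge to
  \<open>\<psi> * f\<close> itself turns the bound for the adjoint on combinations into a bound for
  \<open>\<psi>\<close>.\<close>

lemma multiplier_bounded:
  assumes \<psi>: "multiplier \<psi>"
  obtains C where "C \<ge> 0" "\<And>f. f \<in> H \<Longrightarrow> nrm (\<psi> * f) \<le> C * nrm f"
proof -
  obtain C where C: "\<And>c. c \<in> coeffs \<Longrightarrow> nrm (comb ((\<lambda>w. cnj (\<psi> w)) * c)) \<le> C * nrm (comb c)"
    using multiplier_bounded_on_combs[OF \<psi>] by blast
  have "nrm (\<psi> * f) \<le> \<bar>C\<bar> * nrm f" if f: "f \<in> H" for f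
  proof (cases "\<psi> * f = 0")
    case False
    have \<psi>f: "\<psi> * f \<in> H"
      using \<psi> f by simp
    obtain s where s: "\<And>n. s n \<in> coeffs" "hconv (\<lambda>n. comb (s n)) (\<psi> * f)"
      using comb_dense[OF \<psi>f] by blast
    have "cmod (ip (\<psi> * f) (comb (s n))) \<le> nrm f * (\<bar>C\<bar> * nrm (comb (s n)))" for n
    proof -
      have "cmod (ip (\<psi> * f) (comb (s n))) \<le> nrm f * nrm (comb ((\<lambda>w. cnj (\<psi> w)) * s n))"
        using s \<psi> f by (simp add: ip_times_comb Cauchy_Schwarz coeffs_times)
      also have "\<dots> \<le> nrm f * (\<bar>C\<bar> * nrm (comb (s n)))"
      proof (intro mult_left_mono)
        have "C * nrm (comb (s n)) \<le> \<bar>C\<bar> * nrm (comb (s n))"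
          using s(1) by (intro mult_right_mono) auto
        then show "nrm (comb ((\<lambda>w. cnj (\<psi> w)) * s n)) \<le> \<bar>C\<bar> * nrm (comb (s n))"
          using C[OF s(1), of n] by linarith
      qed (use f in simp)
      finally show ?thesis .
    qed
    moreover have "(\<lambda>n. cmod (ip (\<psi> * f) (comb (s n)))) \<longlonglongrightarrow> cmod (ip (\<psi> * f) (\<psi> * f))"
      using hconv_ip[OF hconv_const[OF \<psi>f] s(2)] by (rule tendsto_norm)
    moreover have "(\<lambda>n. nrm f * (\<bar>C\<bar> * nrm (comb (s n)))) \<longlonglongrightarrow> nrm f * (\<bar>C\<bar> * nrm (\<psi> * f))"
      using hconv_nrm[OF s(2)] by (intro tendsto_intros)
    ultimately have "cmod (ip (\<psi> * f) (\<psi> * f)) \<le> nrm f * (\<bar>C\<bar> * nrm (\<psi> * f))"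
      by (meson LIMSEQ_le)
    then have "nrm (\<psi> * f) * nrm (\<psi> * f) \<le> (\<bar>C\<bar> * nrm f) * nrm (\<psi> * f)"
      using ip_self[OF \<psi>f] by (simp add: norm_power power2_eq_square mult_ac norm_mult)
    moreover have "nrm (\<psi> * f) > 0"
      using False \<psi>f by (metis less_le nrm_eq_0_iff nrm_nonneg)
    ultimately show ?thesis
      by (simp only: mult_le_cancel_right_pos)
  qed (use f in simp)
  then show ?thesis
    using that[of "\<bar>C\<bar>"] by simp
qed

section \<open>Adjoints of multiplication operators\<close>

definition adj :: "'x cfun \<Rightarrow> 'x cfun \<Rightarrow> 'x cfun" where
  "adj \<psi> v = (THE g. g \<in> H \<and> (\<forall>f\<in>H. ip (\<psi> * f) v = ip f g))"

lemma times_cscale: "\<psi> * cscale t f = cscale t (\<psi> * f)" "cscale t \<psi> * f = cscale t (\<psi> * f)"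
  for \<psi> f :: "'x cfun"
  by (auto simp: cscale_def mult_ac)

lemma adj:
  assumes \<psi>: "multiplier \<psi>" and v: "v \<in> H"
  shows "adj \<psi> v \<in> H \<and> (\<forall>f\<in>H. ip (\<psi> * f) v = ip f (adj \<psi> v))"
proof -
  obtain C where C: "\<And>f. f \<in> H \<Longrightarrow> nrm (\<psi> * f) \<le> C * nrm f"
    using multiplier_bounded[OF \<psi>] by blast
  obtain g where g: "g \<in> H" "\<And>f. f \<in> H \<Longrightarrow> ip (\<psi> * f) v = ip f g"
  proof (rule Riesz[of "\<lambda>f. ip (\<psi> * f) v" "C * nrm v"])
    fix f assume f: "f \<in> H"
    have "cmod (ip (\<psi> * f) v) \<le> nrm (\<psi> * f) * nrm v"
      using \<psi> f v by (simp add: Cauchy_Schwarz)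
    also have "\<dots> \<le> C * nrm f * nrm v"
      using C f v by (simp add: mult_right_mono)
    finally show "cmod (ip (\<psi> * f) v) \<le> C * nrm v * nrm f"
      by (simp add: mult_ac)
  qed (use \<psi> v in \<open>auto simp: distrib_left ip_add_left times_cscale ip_scale_left\<close>)
  show ?thesis
    unfolding adj_def
    by (rule theI[of "\<lambda>g. g \<in> H \<and> (\<forall>f\<in>H. ip (\<psi> * f) v = ip f g)" g])
      (use g vector_eqI in auto)
qed

lemma adj_mem [simp]: "\<lbrakk>multiplier \<psi>; v \<in> H\<rbrakk> \<Longrightarrow> adj \<psi> v \<in> H"
  and ip_adj: "\<lbrakk>multiplier \<psi>; v \<in> H; f \<in> H\<rbrakk> \<Longrightarrow> ip f (adj \<psi> v) = ip (\<psi> * f) v"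
  using adj by auto

lemma ip_adj_left: "\<lbrakk>multiplier \<psi>; v \<in> H; f \<in> H\<rbrakk> \<Longrightarrow> ip (adj \<psi> v) f = ip v (\<psi> * f)"
  by (metis adj_mem ip_adj ip_commute multiplier_mem)

lemma adj_eqI:
  "\<lbrakk>multiplier \<psi>; v \<in> H; g \<in> H; \<And>f. f \<in> H \<Longrightarrow> ip (\<psi> * f) v = ip f g\<rbrakk> \<Longrightarrow> adj \<psi> v = g"
  by (rule vector_eqI) (auto simp: ip_adj)

lemma adj_add: "\<lbrakk>multiplier \<psi>; v \<in> H; w \<in> H\<rbrakk> \<Longrightarrow> adj \<psi> (v + w) = adj \<psi> v + adj \<psi> w"
  by (rule adj_eqI) (auto simp: ip_add_right ip_adj)

lemma adj_scale: "\<lbrakk>multiplier \<psi>; v \<in> H\<rbrakk> \<Longrightarrow> adj \<psi> (cscale t v) = cscale t (adj \<psi> v)"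
  by (rule adj_eqI) (auto simp: ip_scale_right ip_adj)

lemma adj_diff: "\<lbrakk>multiplier \<psi>; v \<in> H; w \<in> H\<rbrakk> \<Longrightarrow> adj \<psi> (v - w) = adj \<psi> v - adj \<psi> w"
  by (rule adj_eqI) (auto simp: ip_diff_right ip_adj)

lemma multiplier_zero [simp]: "multiplier 0"
  by (simp add: multiplier_def)

lemma multiplier_add: "\<lbrakk>multiplier \<psi>; multiplier \<phi>\<rbrakk> \<Longrightarrow> multiplier (\<psi> + \<phi>)"
  by (simp add: multiplier_def distrib_right)

lemma multiplier_diff: "\<lbrakk>multiplier \<psi>; multiplier \<phi>\<rbrakk> \<Longrightarrow> multiplier (\<psi> - \<phi>)"
  by (simp add: multiplier_def left_diff_distrib)

lemma multiplier_times: "\<lbrakk>multiplier \<psi>; multiplier \<phi>\<rbrakk> \<Longrightarrow> multiplier (\<psi> * \<phi>)"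
  by (simp add: multiplier_def mult.assoc)

lemma multiplier_scale: "multiplier \<psi> \<Longrightarrow> multiplier (cscale t \<psi>)"
  by (simp add: multiplier_def times_cscale) (simp add: cscale_def)

text \<open>Multipliers vanish off \<open>X\<close>, so the unit of their algebra is
  \<open>indicator X\<close> and not the constant 1.\<close>

lemma unit_times: "f \<in> H \<Longrightarrow> indicator X * f = f"
  by (rule ext) (use vanish in \<open>auto simp: indicator_def\<close>)

lemma multiplier_unit: "multiplier (indicator X)"
  using unit_times by (auto simp: multiplier_def)

lemma multiplier_times_unit: "multiplier \<psi> \<Longrightarrow> indicator X * \<psi> = \<psi>"
  by (rule ext) (auto simp: multiplier_def indicator_def)

lemma adj_unit: "v \<in> H \<Longrightarrow> adj (indicator X) v = v"
  by (rule adj_eqI) (auto simp: multiplier_unit unit_times)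

lemma adj_plus:
  "\<lbrakk>multiplier \<psi>; multiplier \<phi>; v \<in> H\<rbrakk> \<Longrightarrow> adj (\<psi> + \<phi>) v = adj \<psi> v + adj \<phi> v"
  by (rule adj_eqI) (auto simp: multiplier_add distrib_right ip_add_left ip_add_right ip_adj)

lemma adj_minus:
  "\<lbrakk>multiplier \<psi>; multiplier \<phi>; v \<in> H\<rbrakk> \<Longrightarrow> adj (\<psi> - \<phi>) v = adj \<psi> v - adj \<phi> v"
  by (rule adj_eqI) (auto simp: multiplier_diff left_diff_distrib ip_diff_left ip_diff_right ip_adj)

lemma adj_times:
  "\<lbrakk>multiplier \<psi>; multiplier \<phi>; v \<in> H\<rbrakk> \<Longrightarrow> adj (\<psi> * \<phi>) v = adj \<phi> (adj \<psi> v)"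
  by (rule adj_eqI) (auto simp: multiplier_times ip_adj mult.assoc)

lemma adj_cscale:
  "\<lbrakk>multiplier \<psi>; v \<in> H\<rbrakk> \<Longrightarrow> adj (cscale t \<psi>) v = cscale (cnj t) (adj \<psi> v)"
  by (rule adj_eqI) (auto simp: multiplier_scale times_cscale ip_scale_left ip_scale_right ip_adj)

lemma adj_kern:
  assumes "multiplier \<psi>" "w \<in> X"
  shows "adj \<psi> (kern w) = cscale (cnj (\<psi> w)) (kern w)"
  using assms by (intro adj_eqI) (auto simp: ip_kern ip_scale_right)

lemma adj_comb:
  assumes "multiplier \<psi>" "c \<in> coeffs"
  shows "adj \<psi> (comb c) = comb ((\<lambda>w. cnj (\<psi> w)) * c)"
  using assms by (intro adj_eqI) (auto simp: coeffs_times ip_times_comb)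

lemma adj_bounded:
  assumes "multiplier \<psi>"
  obtains C where "C \<ge> 0" "\<And>v. v \<in> H \<Longrightarrow> nrm (adj \<psi> v) \<le> C * nrm v"
proof -
  obtain C where C: "C \<ge> 0" "\<And>f. f \<in> H \<Longrightarrow> nrm (\<psi> * f) \<le> C * nrm f"
    using multiplier_bounded[OF assms] by blast
  have "nrm (adj \<psi> v) \<le> C * nrm v" if v: "v \<in> H" for v
  proof (cases "adj \<psi> v = 0")
    case False
    let ?w = "adj \<psi> v"
    have w: "?w \<in> H"
      using assms v by simp
    have "nrm ?w * nrm ?w = Re (ip (\<psi> * ?w) v)"
      using Re_ip_self[OF w] ip_adj[OF assms v w] by (simp add: power2_eq_square)
    also have "\<dots> \<le> nrm (\<psi> * ?w) * nrm v"
      using w v assms by (metis Cauchy_Schwarz complex_Re_le_cmod multiplier_mem order_trans)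
    also have "\<dots> \<le> C * nrm ?w * nrm v"
      using C(2)[OF w] v by (simp add: mult_right_mono)
    finally have "nrm ?w * nrm ?w \<le> (C * nrm v) * nrm ?w"
      by (simp add: mult_ac)
    moreover have "nrm ?w > 0"
      using False w by (metis less_le nrm_eq_0_iff nrm_nonneg)
    ultimately show ?thesis
      by (simp only: mult_le_cancel_right_pos)
  qed (use C v in simp)
  with C(1) that show ?thesis by blast
qed

lemma adj_hconv:
  assumes \<psi>: "multiplier \<psi>" and s: "hconv s f"
  shows "hconv (\<lambda>n. adj \<psi> (s n)) (adj \<psi> f)"
proof -
  obtain C where C: "\<And>v. v \<in> H \<Longrightarrow> nrm (adj \<psi> v) \<le> C * nrm v"
    using adj_bounded[OF \<psi>] by blast
  have mem: "s n \<in> H" "f \<in> H" for n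
    using s by (auto simp: hconv_def)
  have "(\<lambda>n. C * nrm (s n - f)) \<longlonglongrightarrow> C * 0"
    using s unfolding hconv_def by (intro tendsto_intros) auto
  then have "(\<lambda>n. C * nrm (s n - f)) \<longlonglongrightarrow> 0" by simp
  then have "(\<lambda>n. nrm (adj \<psi> (s n) - adj \<psi> f)) \<longlonglongrightarrow> 0"
    by (rule Lim_null_comparison[rotated]) (use C mem \<psi> in \<open>simp flip: adj_diff\<close>)
  then show ?thesis
    using mem \<psi> by (simp add: hconv_def)
qed

end

section \<open>The row of coordinate operators\<close>

lemma cmod_cdot_le: "cmod (cdot z w) \<le> norm z * norm w"
proof -
  have "cmod (cdot z w) \<le> (\<Sum>j\<in>UNIV. cmod (z $ j) * cmod (w $ j))"
    unfolding cdot_def by (rule order_trans[OF norm_sum]) (simp add: norm_mult)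
  also have "\<dots> \<le> norm z * norm w"
    using L2_set_mult_ineq[of "\<lambda>j. cmod (z $ j)" "\<lambda>j. cmod (w $ j)" UNIV] by (simp add: norm_vec_def)
  finally show ?thesis .
qed

lemma norm_vec_sq: "(norm (x :: complex ^ 'd))\<^sup>2 = (\<Sum>j\<in>UNIV. (cmod (x $ j))\<^sup>2)"
  by (simp add: norm_vec_def L2_set_def sum_nonneg)

lemma cdot_self: "cdot z z = of_real ((norm z)\<^sup>2)"
  by (simp only: norm_vec_sq of_real_sum complex_norm_square cdot_def)

lemma Re_cdot: "Re (cdot z x) = ((norm z)\<^sup>2 + (norm x)\<^sup>2 - (norm (z - x))\<^sup>2) / 2"
proof -
  have "Re (cdot z x) = inner z x"
    by (simp add: cdot_def inner_vec_def inner_complex_def)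
  then show ?thesis
    by (simp add: dot_norm_neg)
qed

lemma cmod_cdot_less_1: "\<lbrakk>z \<in> ball 0 1; w \<in> ball 0 1\<rbrakk> \<Longrightarrow> cmod (cdot z w) < 1"
  using cmod_cdot_le[of z w] mult_strict_mono'[of "norm z" 1 "norm w" 1] by simp

text \<open>Splitting one factor \<open>cdot z w\<close> into coordinates and absorbing them into
  the coefficients lowers \<open>n\<close>, which is why \<open>c\<close> varies in the induction.
  For \<open>n = 0\<close> the sum is a squared modulus.\<close>

lemma cdot_power_psd:
  fixes S :: "(complex ^ 'd) set"
  assumes "finite S"
  shows "0 \<le> Re (\<Sum>w\<in>S. \<Sum>z\<in>S. c w * cnj (c z) * cdot z w ^ n)"
proof (induction n arbitrary: c)
  case 0
  have "(\<Sum>w\<in>S. \<Sum>z\<in>S. c w * cnj (c z)) = of_real ((cmod (\<Sum>w\<in>S. c w))\<^sup>2)"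
    unfolding complex_norm_square cnj_sum sum_product ..
  then show ?case
    by (simp del: of_real_power)
next
  case (Suc n)
  have "(\<Sum>w\<in>S. \<Sum>z\<in>S. c w * cnj (c z) * cdot z w ^ Suc n)
      = (\<Sum>w\<in>S. \<Sum>z\<in>S. \<Sum>j\<in>UNIV. (c w * cnj (w $ j)) * cnj (c z * cnj (z $ j)) * cdot z w ^ n)"
    by (simp add: cdot_def[of _ w for w] sum_distrib_left sum_distrib_right mult_ac)
  also have "\<dots> = (\<Sum>j\<in>UNIV. \<Sum>w\<in>S. \<Sum>z\<in>S. (c w * cnj (w $ j)) * cnj (c z * cnj (z $ j)) * cdot z w ^ n)"
    by (subst (2) sum.swap) (subst sum.swap, rule refl)
  finally have eq: "(\<Sum>w\<in>S. \<Sum>z\<in>S. c w * cnj (c z) * cdot z w ^ Suc n) = \<dots>" .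
  show ?case
    unfolding eq by (subst Re_sum) (intro sum_nonneg Suc.IH)
qed

text \<open>The source of the operator inequalities below: on kernel combinations a difference of
  two forms becomes such a double sum, and what remains is to check the signs of
  \<open>\<gamma> n\<close>.\<close>

lemma power_series_kernel_psd:
  fixes S :: "(complex ^ 'd) set"
  assumes S: "finite S" and \<gamma>: "\<And>n. \<gamma> n \<ge> 0"
    and Q: "\<And>z w. \<lbrakk>z \<in> S; w \<in> S\<rbrakk> \<Longrightarrow> (\<lambda>n. of_real (\<gamma> n) * cdot z w ^ n) sums Q z w"
  shows "0 \<le> Re (\<Sum>w\<in>S. \<Sum>z\<in>S. c w * cnj (c z) * Q z w)"
proof -
  have "(\<lambda>n. \<Sum>w\<in>S. \<Sum>z\<in>S. c w * cnj (c z) * (of_real (\<gamma> n) * cdot z w ^ n))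
      sums (\<Sum>w\<in>S. \<Sum>z\<in>S. c w * cnj (c z) * Q z w)"
    by (intro sums_sum sums_mult Q)
  then have "(\<lambda>n. Re (\<Sum>w\<in>S. \<Sum>z\<in>S. c w * cnj (c z) * (of_real (\<gamma> n) * cdot z w ^ n)))
      sums Re (\<Sum>w\<in>S. \<Sum>z\<in>S. c w * cnj (c z) * Q z w)"
    by (rule sums_Re)
  moreover have "(\<Sum>w\<in>S. \<Sum>z\<in>S. c w * cnj (c z) * (of_real (\<gamma> n) * cdot z w ^ n))
      = of_real (\<gamma> n) * (\<Sum>w\<in>S. \<Sum>z\<in>S. c w * cnj (c z) * cdot z w ^ n)" for n
    by (simp add: sum_distrib_left mult_ac)
  ultimately have "(\<lambda>n. \<gamma> n * Re (\<Sum>w\<in>S. \<Sum>z\<in>S. c w * cnj (c z) * cdot z w ^ n))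
      sums Re (\<Sum>w\<in>S. \<Sum>z\<in>S. c w * cnj (c z) * Q z w)"
    by simp
  then show ?thesis
    by (rule sums_le[OF _ sums_zero, rotated]) (intro mult_nonneg_nonneg \<gamma> cdot_power_psd[OF S])
qed

locale maximal_cnp_space =
  fixes a b :: "nat \<Rightarrow> real" and H :: "(complex ^ 'd) cfun set"
    and ip :: "(complex ^ 'd) cfun \<Rightarrow> (complex ^ 'd) cfun \<Rightarrow> complex"
  assumes cnp: "regular_ui_cnp_space a b H ip" and maximal: "maximal_cnp b"

sublocale maximal_cnp_space \<subseteq> rk_space "ball 0 1" "kernel a" H ip
  using cnp by unfold_locales (simp add: regular_ui_cnp_space_def)

context maximal_cnp_space begin

lemma a0: "a 0 = 1"
  and a_pos: "a n > 0"
  and a_ratio: "(\<lambda>n. a n / a (Suc n)) \<longlonglongrightarrow> 1"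
  and b_nonneg: "n \<ge> 1 \<Longrightarrow> b n \<ge> 0"
  using cnp unfolding regular_ui_cnp_space_def by blast+

lemma kernel_nz_and_b_series:
  "\<forall>z\<in>ball 0 1. \<forall>w\<in>ball 0 1. kernel a z w \<noteq> 0 \<and>
    (\<lambda>n. of_real (b (Suc n)) * cdot z w ^ Suc n) sums (1 - 1 / kernel a (z :: complex ^ 'd) w)"
  using cnp unfolding regular_ui_cnp_space_def by (elim conjE)

lemmas kernel_nz = kernel_nz_and_b_series[rule_format, THEN conjunct1]
  and b_series = kernel_nz_and_b_series[rule_format, THEN conjunct2]

lemma b_sums: "(\<lambda>n. b (Suc n)) sums 1"
  using maximal by (simp add: maximal_cnp_def)

lemma a_summable:
  assumes "cmod x < 1"
  shows "summable (\<lambda>n. cmod (of_real (a n) * x ^ n))"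
proof -
  define r where "r = (1 + cmod x) / 2"
  have r: "cmod x < r" "r < 1" "0 < r"
    using assms norm_ge_zero[of x] unfolding r_def by (simp_all add: field_simps add_pos_nonneg)
  have "(\<lambda>n. cmod x * inverse (a n / a (Suc n))) \<longlonglongrightarrow> cmod x * inverse 1"
    by (intro tendsto_intros a_ratio) simp
  then have "\<forall>\<^sub>F n in sequentially. cmod x * inverse (a n / a (Suc n)) < r"
    using r by (intro order_tendstoD) auto
  then obtain N where N: "\<And>n. n \<ge> N \<Longrightarrow> cmod x * inverse (a n / a (Suc n)) < r"
    by (auto simp: eventually_sequentially)
  have "norm (cmod (of_real (a (Suc n)) * x ^ Suc n)) \<le> r * norm (cmod (of_real (a n) * x ^ n))"
    if "n \<ge> N" for n
  proof -
    have "cmod x * a (Suc n) \<le> r * a n"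
      using N[OF that] a_pos[of n] a_pos[of "Suc n"] by (simp add: field_simps)
    then have "cmod x ^ n * (cmod x * a (Suc n)) \<le> cmod x ^ n * (r * a n)"
      by (intro mult_left_mono) auto
    then show ?thesis
      using a_pos[of n] a_pos[of "Suc n"] by (simp add: norm_mult norm_power mult_ac)
  qed
  then show ?thesis
    using r by (intro summable_ratio_test[of r N]) auto
qed

lemma kernel_sums:
  assumes "z \<in> ball 0 1" "w \<in> ball 0 1"
  shows "(\<lambda>n. of_real (a n) * cdot z w ^ n) sums kernel a z w"
  unfolding kernel_def
  by (rule summable_sums, rule summable_norm_cancel, rule a_summable[OF cmod_cdot_less_1[OF assms]])

lemma kernel_0: "kernel a 0 w = 1" "kernel a z 0 = 1"
proof -
  have "(\<lambda>n. of_real (a n) * (0::complex) ^ n) sums of_real (a 0)"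
    by (rule powser_sums_zero)
  then show "kernel a 0 w = 1" "kernel a z 0 = 1"
    by (simp_all add: kernel_def cdot_def a0 sums_iff)
qed

lemma ip_comb_comb:
  assumes "finite S" "S \<subseteq> ball 0 1" "{w. c w \<noteq> 0} \<subseteq> S" "{w. d w \<noteq> 0} \<subseteq> S"
  shows "ip (comb c) (comb d) = (\<Sum>w\<in>S. \<Sum>z\<in>S. c w * cnj (d z) * kernel a z w)"
proof -
  have mem: "w \<in> S \<Longrightarrow> kern w \<in> H" for w
    using assms by auto
  have "ip (comb c) (comb d) = (\<Sum>w\<in>S. \<Sum>z\<in>S. ip (cscale (c w) (kern w)) (cscale (d z) (kern z)))"
    unfolding comb_eq[OF assms(1,3)] comb_eq[OF assms(1,4)]
    using assms(1) mem by (subst ip_sum_left) (auto intro!: sum.cong sum_mem ip_sum_right)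
  also have "\<dots> = (\<Sum>w\<in>S. \<Sum>z\<in>S. c w * cnj (d z) * kernel a z w)"
    using assms(2) mem
    by (intro sum.cong refl) (auto simp: ip_scale_left ip_scale_right ip_kern_kern subset_iff)
  finally show ?thesis .
qed

lemma nrm_comb_sq:
  assumes "finite S" "S \<subseteq> ball 0 1" "{w. c w \<noteq> 0} \<subseteq> S"
  shows "(nrm (comb c))\<^sup>2 = Re (\<Sum>w\<in>S. \<Sum>z\<in>S. c w * cnj (c z) * kernel a z w)"
proof -
  have "c \<in> coeffs"
    using assms finite_subset by (auto simp: coeffs_def)
  then show ?thesis
    using Re_ip_self[of "comb c"] ip_comb_comb[OF assms assms(3)] by simp
qed

section \<open>The coordinate multipliers\<close>

definition coord :: "'d \<Rightarrow> (complex ^ 'd) cfun" where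
  "coord j = on_ball (\<lambda>z. z $ j)"

lemma cdot_kernel_sums:
  assumes "z \<in> ball 0 1" "w \<in> ball 0 1"
  shows "(\<lambda>n. of_real (if n = 0 then 0 else a (n - 1)) * cdot z w ^ n) sums (cdot z w * kernel a z w)"
proof -
  have "(\<lambda>n. cdot z w * (of_real (a n) * cdot z w ^ n)) sums (cdot z w * kernel a z w)"
    using kernel_sums[OF assms] by (rule sums_mult)
  then show ?thesis
    using sums_Suc_iff[of "\<lambda>n. of_real (if n = 0 then 0 else a (n - 1)) * cdot z w ^ n"]
    by (simp add: mult_ac)
qed

text \<open>The ratios \<open>a n / a (Suc n)\<close> converge, so some \<open>K\<close> bounds them
  and the series of \<open>K k - \<langle>z,w\<rangle> k\<close> has nonnegative coefficients. This
  bounds the whole row of adjoint coordinates by \<open>sqrt K\<close> on kernel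
  combinations.\<close>

lemma multiplier_coord: "multiplier (coord j)"
proof -
  obtain K where K: "K > 0" "\<And>n. norm (a n / a (Suc n)) \<le> K"
    using convergent_imp_Bseq[OF convergentI[OF a_ratio]] by (rule BseqE) blast
  have aK: "a n \<le> K * a (Suc n)" for n
    using K(2)[of n] a_pos[of n] a_pos[of "Suc n"] by (simp add: field_simps)
  have "nrm (comb ((\<lambda>w. cnj (coord j w)) * c)) \<le> sqrt K * nrm (comb c)" if c: "c \<in> coeffs" for c
  proof -
    let ?S = "{w. c w \<noteq> 0}"
    have S: "finite ?S" "?S \<subseteq> ball 0 1"
      using c by (auto simp: coeffs_def)
    have eq: "(nrm (comb ((\<lambda>w. cnj (coord i w)) * c)))\<^sup>2
        = Re (\<Sum>w\<in>?S. \<Sum>z\<in>?S. c w * cnj (c z) * (z $ i * cnj (w $ i) * kernel a z w))" for i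
    proof -
      let ?d = "(\<lambda>w. cnj (coord i w)) * c"
      have "(nrm (comb ?d))\<^sup>2 = Re (\<Sum>w\<in>?S. \<Sum>z\<in>?S. ?d w * cnj (?d z) * kernel a z w)"
        by (rule nrm_comb_sq[OF S]) auto
      also have "\<dots> = Re (\<Sum>w\<in>?S. \<Sum>z\<in>?S. c w * cnj (c z) * (z $ i * cnj (w $ i) * kernel a z w))"
        by (intro arg_cong[of _ _ Re] sum.cong refl) (use S in \<open>auto simp: coord_def on_ball_def subset_iff\<close>)
      finally show ?thesis .
    qed
    \<comment> \<open>The sum over all coordinates has the kernel
      \<open>cdot z w * kernel a z w\<close>, a power series in \<open>cdot z w\<close>, which a
      single coordinate has not.\<close>
    have "(nrm (comb ((\<lambda>w. cnj (coord j w)) * c)))\<^sup>2 \<le> (\<Sum>i\<in>UNIV. (nrm (comb ((\<lambda>w. cnj (coord i w)) * c)))\<^sup>2)"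
      by (rule member_le_sum) auto
    also have "\<dots> = Re (\<Sum>w\<in>?S. \<Sum>z\<in>?S. c w * cnj (c z) * (cdot z w * kernel a z w))"
    proof -
      have "(\<Sum>w\<in>?S. \<Sum>z\<in>?S. c w * cnj (c z) * (cdot z w * kernel a z w))
          = (\<Sum>w\<in>?S. \<Sum>z\<in>?S. \<Sum>i\<in>UNIV. c w * cnj (c z) * (z $ i * cnj (w $ i) * kernel a z w))"
        by (simp add: cdot_def sum_distrib_left sum_distrib_right)
      also have "\<dots> = (\<Sum>i\<in>UNIV. \<Sum>w\<in>?S. \<Sum>z\<in>?S. c w * cnj (c z) * (z $ i * cnj (w $ i) * kernel a z w))"
        by (subst (2) sum.swap) (subst sum.swap, rule refl)
      finally show ?thesis
        by (simp add: eq)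
    qed
    also have "\<dots> \<le> K * (nrm (comb c))\<^sup>2"
    proof -
      have "0 \<le> Re (\<Sum>w\<in>?S. \<Sum>z\<in>?S. c w * cnj (c z) * (of_real K * kernel a z w - cdot z w * kernel a z w))"
      proof (rule power_series_kernel_psd[OF S(1), of "\<lambda>n. K * a n - (if n = 0 then 0 else a (n - 1))"])
        show "0 \<le> K * a n - (if n = 0 then 0 else a (n - 1))" for n
          using aK[of "n - 1"] K(1) a_pos[of n] by (cases n) auto
        fix z w assume "z \<in> ?S" "w \<in> ?S"
        then have "z \<in> ball 0 1" "w \<in> ball 0 1"
          using S by auto
        from sums_diff[OF sums_mult[OF kernel_sums[OF this], of "of_real K"] cdot_kernel_sums[OF this]]
        show "(\<lambda>n. of_real (K * a n - (if n = 0 then 0 else a (n - 1))) * cdot z w ^ n)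
            sums (of_real K * kernel a z w - cdot z w * kernel a z w)"
          by (simp add: left_diff_distrib mult.assoc)
      qed
      also have "(\<Sum>w\<in>?S. \<Sum>z\<in>?S. c w * cnj (c z) * (of_real K * kernel a z w - cdot z w * kernel a z w))
          = of_real K * (\<Sum>w\<in>?S. \<Sum>z\<in>?S. c w * cnj (c z) * kernel a z w)
            - (\<Sum>w\<in>?S. \<Sum>z\<in>?S. c w * cnj (c z) * (cdot z w * kernel a z w))"
        by (simp add: sum_distrib_left right_diff_distrib sum_subtractf mult_ac)
      finally show ?thesis
        using nrm_comb_sq[OF S, of c] by simp
    qed
    finally have "(nrm (comb ((\<lambda>w. cnj (coord j w)) * c)))\<^sup>2 \<le> (sqrt K * nrm (comb c))\<^sup>2"
      using K(1) by (simp add: power_mult_distrib)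
    then show ?thesis
      using K(1) c by (meson comb_mem mult_nonneg_nonneg nrm_nonneg power2_le_imp_le real_sqrt_ge_zero less_imp_le)
  qed
  then show ?thesis
    by (intro multiplierI_bounded) (auto simp: coord_def on_ball_def)
qed

section \<open>Quadratic forms of words in the adjoint coordinates\<close>

abbreviation "L j \<equiv> adj (coord j)"

text \<open>The sum of \<open>q\<close> over all words of length \<open>n\<close> in the
  \<open>L j\<close> applied to \<open>v\<close>. On kernel combinations \<open>dform n\<close> has
  the kernel \<open>\<langle>z,w\<rangle>^n k(z,w)\<close> and \<open>eform n\<close> the kernel
  \<open>\<langle>z,w\<rangle>^n\<close>; one recursion serves both.\<close>

primrec wform :: "((complex ^ 'd) cfun \<Rightarrow> real) \<Rightarrow> nat \<Rightarrow> (complex ^ 'd) cfun \<Rightarrow> real" where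
  "wform q 0 v = q v"
| "wform q (Suc n) v = (\<Sum>j\<in>UNIV. wform q n (L j v))"

abbreviation "dform \<equiv> wform (\<lambda>v. (nrm v)\<^sup>2)"
abbreviation "eform \<equiv> wform (\<lambda>v. (cmod (v 0))\<^sup>2)"

lemma L_mem [simp]: "v \<in> H \<Longrightarrow> L j v \<in> H"
  by (simp add: multiplier_coord)

lemma wform_nonneg: "(\<And>v. q v \<ge> 0) \<Longrightarrow> wform q n v \<ge> 0"
  by (induction n arbitrary: v) (auto intro: sum_nonneg)

text \<open>\<open>L j\<close> multiplies the coefficient at \<open>w\<close> by
  \<open>cnj (w $ j)\<close>, so the sum over \<open>j\<close> contributes one factor
  \<open>cdot z w\<close> per step.\<close>

lemma wform_comb:
  assumes S: "finite S" "S \<subseteq> ball 0 1"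
    and q: "\<And>c. {w. c w \<noteq> 0} \<subseteq> S \<Longrightarrow> q (comb c) = Re (\<Sum>w\<in>S. \<Sum>z\<in>S. c w * cnj (c z) * Q z w)"
    and c: "{w. c w \<noteq> 0} \<subseteq> S"
  shows "wform q n (comb c) = Re (\<Sum>w\<in>S. \<Sum>z\<in>S. c w * cnj (c z) * (cdot z w ^ n * Q z w))"
  using c
proof (induction n arbitrary: c)
  case 0
  then show ?case by (simp add: q)
next
  case (Suc n)
  have "c \<in> coeffs"
    using Suc.prems S finite_subset by (auto simp: coeffs_def)
  then have L: "L j (comb c) = comb ((\<lambda>w. cnj (coord j w)) * c)" for j
    by (simp add: adj_comb multiplier_coord)
  have "wform q n (L j (comb c))
      = Re (\<Sum>w\<in>S. \<Sum>z\<in>S. c w * cnj (c z) * ((z $ j * cnj (w $ j)) * (cdot z w ^ n * Q z w)))" for j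
  proof -
    let ?d = "(\<lambda>w. cnj (coord j w)) * c"
    have "wform q n (comb ?d) = Re (\<Sum>w\<in>S. \<Sum>z\<in>S. ?d w * cnj (?d z) * (cdot z w ^ n * Q z w))"
      using Suc.prems by (intro Suc.IH) auto
    also have "\<dots> = Re (\<Sum>w\<in>S. \<Sum>z\<in>S. c w * cnj (c z) * ((z $ j * cnj (w $ j)) * (cdot z w ^ n * Q z w)))"
      by (intro arg_cong[of _ _ Re] sum.cong refl) (use S in \<open>auto simp: coord_def on_ball_def subset_iff\<close>)
    finally show ?thesis
      unfolding L .
  qed
  moreover have "(\<Sum>w\<in>S. \<Sum>z\<in>S. c w * cnj (c z) * (cdot z w ^ Suc n * Q z w))
      = (\<Sum>j\<in>UNIV. \<Sum>w\<in>S. \<Sum>z\<in>S. c w * cnj (c z) * ((z $ j * cnj (w $ j)) * (cdot z w ^ n * Q z w)))"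
  proof -
    have "(\<Sum>w\<in>S. \<Sum>z\<in>S. c w * cnj (c z) * (cdot z w ^ Suc n * Q z w))
        = (\<Sum>w\<in>S. \<Sum>z\<in>S. \<Sum>j\<in>UNIV. c w * cnj (c z) * ((z $ j * cnj (w $ j)) * (cdot z w ^ n * Q z w)))"
      by (simp add: cdot_def[of _ w for w] sum_distrib_left sum_distrib_right mult_ac)
    also have "\<dots> = (\<Sum>j\<in>UNIV. \<Sum>w\<in>S. \<Sum>z\<in>S. c w * cnj (c z) * ((z $ j * cnj (w $ j)) * (cdot z w ^ n * Q z w)))"
      by (subst (2) sum.swap) (subst sum.swap, rule refl)
    finally show ?thesis .
  qed
  ultimately show ?case
    by simp
qed

lemma dform_comb:
  assumes "finite S" "S \<subseteq> ball 0 1" "{w. c w \<noteq> 0} \<subseteq> S"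
  shows "dform n (comb c) = Re (\<Sum>w\<in>S. \<Sum>z\<in>S. c w * cnj (c z) * (cdot z w ^ n * kernel a z w))"
  using assms by (intro wform_comb nrm_comb_sq)

lemma eform_comb:
  assumes S: "finite S" "S \<subseteq> ball 0 1" and c: "{w. c w \<noteq> 0} \<subseteq> S"
  shows "eform n (comb c) = Re (\<Sum>w\<in>S. \<Sum>z\<in>S. c w * cnj (c z) * cdot z w ^ n)"
proof -
  have "(cmod (comb c 0))\<^sup>2 = Re (\<Sum>w\<in>S. \<Sum>z\<in>S. c w * cnj (c z) * 1)" if "{w. c w \<noteq> 0} \<subseteq> S" for c
  proof -
    have "comb c 0 = (\<Sum>w\<in>S. c w * kern w 0)"
      unfolding comb_eq[OF S(1) that] using S(1) by (induction S rule: finite_induct) (auto simp: cscale_apply)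
    also have "\<dots> = (\<Sum>w\<in>S. c w)"
      by (simp add: kern_def kernel_0)
    finally have "complex_of_real ((cmod (comb c 0))\<^sup>2) = (\<Sum>w\<in>S. \<Sum>z\<in>S. c w * cnj (c z) * 1)"
      by (simp only: complex_norm_square cnj_sum sum_product mult_1_right)
    then show ?thesis
      by (metis Re_complex_of_real)
  qed
  from wform_comb[OF S this c] show ?thesis
    by simp
qed

lemma wform_hconv:
  assumes q: "\<And>s v. hconv s v \<Longrightarrow> (\<lambda>i. q (s i)) \<longlonglongrightarrow> q v" and s: "hconv s v"
  shows "(\<lambda>i. wform q n (s i)) \<longlonglongrightarrow> wform q n v"
  using s
proof (induction n arbitrary: s v)
  case (Suc n)
  then show ?case
    using adj_hconv[OF multiplier_coord] by (auto intro!: tendsto_sum)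
qed (simp add: q)

lemma dform_hconv: "hconv s v \<Longrightarrow> (\<lambda>i. dform n (s i)) \<longlonglongrightarrow> dform n v"
  by (rule wform_hconv) (auto intro: tendsto_intros hconv_nrm)

lemma eform_hconv: "hconv s v \<Longrightarrow> (\<lambda>i. eform n (s i)) \<longlonglongrightarrow> eform n v"
  by (rule wform_hconv) (intro tendsto_intros hconv_eval)

text \<open>The difference of the two sides has the kernel
  \<open>k - 1 - \<Sum>_{n\<le>m} b_n \<langle>z,w\<rangle>^n k\<close>, the 1 being evaluation at
  the origin. By the identity for \<open>1 - 1/k\<close> it equals
  \<open>k \<Sum>_{n>m} b_n \<langle>z,w\<rangle>^n\<close>, a product of two series with
  nonnegative coefficients.\<close>

lemma row_contraction:
  assumes v: "v \<in> H"
  shows "(\<Sum>n=1..m. b n * dform n v) + (cmod (v 0))\<^sup>2 \<le> (nrm v)\<^sup>2"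
proof -
  have comb: "(\<Sum>n=1..m. b n * dform n (comb c)) + eform 0 (comb c) \<le> dform 0 (comb c)"
    if c: "c \<in> coeffs" for c
  proof -
    let ?S = "{w. c w \<noteq> 0}"
    have S: "finite ?S" "?S \<subseteq> ball 0 1"
      using c by (auto simp: coeffs_def)
    \<comment> \<open>The tail of the series of \<open>1 - 1/k\<close> beyond \<open>m\<close>. The
      index 0 is never in the tail, so all its coefficients are nonnegative.\<close>
    define \<beta> where "\<beta> n = (if n > m then b n else 0)" for n
    have \<beta>0: "\<beta> n \<ge> 0" for n
      using b_nonneg[of n] by (auto simp: \<beta>_def)
    have "0 \<le> Re (\<Sum>w\<in>?S. \<Sum>z\<in>?S. c w * cnj (c z) *
        (kernel a z w - 1 - (\<Sum>n=1..m. of_real (b n) * (cdot z w ^ n * kernel a z w))))"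
    proof (rule power_series_kernel_psd[OF S(1), of "\<lambda>N. \<Sum>i\<le>N. a i * \<beta> (N - i)"])
      show "0 \<le> (\<Sum>i\<le>N. a i * \<beta> (N - i))" for N
        using \<beta>0 a_pos by (intro sum_nonneg mult_nonneg_nonneg) (auto intro: less_imp_le)
      fix z w assume "z \<in> ?S" "w \<in> ?S"
      then have zw: "z \<in> ball 0 1" "w \<in> ball 0 1"
        using S by auto
      let ?x = "cdot z w" and ?k = "kernel a z w"
      have x: "cmod ?x < 1"
        using cmod_cdot_less_1 zw by blast
      have "(\<lambda>n. of_real (if n = 0 then 0 else b n) * ?x ^ n) sums (1 - 1 / ?k)"
        using b_series[OF zw] sums_Suc_iff[of "\<lambda>n. of_real (if n = 0 then 0 else b n) * ?x ^ n"] by simp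
      moreover have "(\<lambda>n. if n \<in> {1..m} then of_real (b n) * ?x ^ n else 0) sums (\<Sum>n=1..m. of_real (b n) * ?x ^ n)"
        by (rule sums_If_finite_set) simp
      ultimately have "(\<lambda>n. of_real (if n = 0 then 0 else b n) * ?x ^ n - (if n \<in> {1..m} then of_real (b n) * ?x ^ n else 0))
          sums (1 - 1 / ?k - (\<Sum>n=1..m. of_real (b n) * ?x ^ n))"
        by (rule sums_diff)
      also have "(\<lambda>n. of_real (if n = 0 then 0 else b n) * ?x ^ n - (if n \<in> {1..m} then of_real (b n) * ?x ^ n else 0))
          = (\<lambda>n. of_real (\<beta> n) * ?x ^ n)"
        by (auto simp: \<beta>_def fun_eq_iff)
      finally have \<beta>s: "(\<lambda>n. of_real (\<beta> n) * ?x ^ n) sums (1 - 1 / ?k - (\<Sum>n=1..m. of_real (b n) * ?x ^ n))" .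
      have sb: "summable (\<lambda>n. cmod (of_real (\<beta> n) * ?x ^ n))"
      proof (rule summable_comparison_test')
        show "summable b"
          using b_sums summable_Suc_iff sums_summable by blast
        show "norm (cmod (of_real (\<beta> n) * ?x ^ n)) \<le> b n" if "n \<ge> 1" for n
          using b_nonneg[OF that] x by (auto simp: \<beta>_def norm_mult norm_power power_le_one intro: mult_left_le)
      qed
      have "(\<lambda>N. \<Sum>i\<le>N. (of_real (a i) * ?x ^ i) * (of_real (\<beta> (N - i)) * ?x ^ (N - i)))
          sums ((\<Sum>n. of_real (a n) * ?x ^ n) * (\<Sum>n. of_real (\<beta> n) * ?x ^ n))"
        by (rule Cauchy_product_sums[OF a_summable[OF x] sb])
      also have "(\<Sum>n. of_real (a n) * ?x ^ n) * (\<Sum>n. of_real (\<beta> n) * ?x ^ n)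
          = ?k * (1 - 1 / ?k - (\<Sum>n=1..m. of_real (b n) * ?x ^ n))"
        using sums_unique[OF kernel_sums[OF zw]] sums_unique[OF \<beta>s] by simp
      also have "\<dots> = ?k - 1 - (\<Sum>n=1..m. of_real (b n) * (?x ^ n * ?k))"
        using kernel_nz[OF zw] by (simp add: field_simps sum_distrib_left)
      also have "(\<lambda>N. \<Sum>i\<le>N. (of_real (a i) * ?x ^ i) * (of_real (\<beta> (N - i)) * ?x ^ (N - i)))
          = (\<lambda>N. of_real (\<Sum>i\<le>N. a i * \<beta> (N - i)) * ?x ^ N)"
      proof
        fix N
        have "(of_real (a i) * ?x ^ i) * (of_real (\<beta> (N - i)) * ?x ^ (N - i)) = of_real (a i * \<beta> (N - i)) * ?x ^ N"
          if "i \<le> N" for i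
        proof -
          have "?x ^ i * ?x ^ (N - i) = ?x ^ N"
            using that by (simp flip: power_add)
          then show ?thesis
            by (metis (no_types, lifting) mult.assoc mult.left_commute of_real_mult)
        qed
        then show "(\<Sum>i\<le>N. (of_real (a i) * ?x ^ i) * (of_real (\<beta> (N - i)) * ?x ^ (N - i)))
            = of_real (\<Sum>i\<le>N. a i * \<beta> (N - i)) * ?x ^ N"
          by (simp add: sum_distrib_right del: of_real_mult)
      qed
      finally show "(\<lambda>N. of_real (\<Sum>i\<le>N. a i * \<beta> (N - i)) * ?x ^ N)
          sums (?k - 1 - (\<Sum>n=1..m. of_real (b n) * (?x ^ n * ?k)))" .
    qed
    also have "(\<Sum>w\<in>?S. \<Sum>z\<in>?S. c w * cnj (c z) *
        (kernel a z w - 1 - (\<Sum>n=1..m. of_real (b n) * (cdot z w ^ n * kernel a z w))))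
      = (\<Sum>w\<in>?S. \<Sum>z\<in>?S. c w * cnj (c z) * kernel a z w) - (\<Sum>w\<in>?S. \<Sum>z\<in>?S. c w * cnj (c z))
        - (\<Sum>n=1..m. of_real (b n) * (\<Sum>w\<in>?S. \<Sum>z\<in>?S. c w * cnj (c z) * (cdot z w ^ n * kernel a z w)))"
    proof -
      have "(\<Sum>n=1..m. of_real (b n) * (\<Sum>w\<in>?S. \<Sum>z\<in>?S. c w * cnj (c z) * (cdot z w ^ n * kernel a z w)))
          = (\<Sum>w\<in>?S. \<Sum>n=1..m. \<Sum>z\<in>?S. c w * cnj (c z) * (of_real (b n) * (cdot z w ^ n * kernel a z w)))"
        by (subst sum.swap) (simp add: sum_distrib_left mult_ac)
      also have "\<dots> = (\<Sum>w\<in>?S. \<Sum>z\<in>?S. c w * cnj (c z) * (\<Sum>n=1..m. of_real (b n) * (cdot z w ^ n * kernel a z w)))"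
        by (subst sum.swap) (simp add: sum_distrib_left)
      finally show ?thesis
        by (simp add: right_diff_distrib sum_subtractf)
    qed
    finally show ?thesis
      using S by (simp add: dform_comb[OF S] eform_comb[OF S] nrm_comb_sq[OF S] del: wform.simps)
  qed
  obtain s where s: "\<And>n. s n \<in> coeffs" "hconv (\<lambda>n. comb (s n)) v"
    using comb_dense[OF v] by blast
  have "(\<Sum>n=1..m. b n * dform n v) + eform 0 v \<le> dform 0 v"
  proof (rule LIMSEQ_le)
    show "(\<lambda>i. (\<Sum>n=1..m. b n * dform n (comb (s i))) + eform 0 (comb (s i)))
        \<longlonglongrightarrow> (\<Sum>n=1..m. b n * dform n v) + eform 0 v"
      by (intro tendsto_intros dform_hconv eform_hconv s)
    show "(\<lambda>i. dform 0 (comb (s i))) \<longlonglongrightarrow> dform 0 v"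
      by (intro dform_hconv s)
  qed (use comb[OF s(1)] in blast)
  then show ?thesis by simp
qed

text \<open>
  \<open>dform 1\<close> is the form of \<open>\<Sum>\<^sub>j M\<^sub>j M\<^sub>j\<^sup>*\<close>, which by \<open>a\<^sub>n / a\<^sub>n\<^sub>+\<^sub>1 \<longlonglongrightarrow> 1\<close> is a compact
  perturbation of the identity.
\<close>

lemma row_essentially_coisometric:
  assumes \<theta>: "\<theta> < 1"
  obtains m where "\<And>v. v \<in> H \<Longrightarrow> \<theta> * (nrm v)\<^sup>2 \<le> dform 1 v + (\<Sum>n\<le>m. a n * eform n v)"
proof -
  obtain m where m: "\<And>n. n \<ge> m \<Longrightarrow> a n / a (Suc n) > \<theta>"
    using order_tendstoD(1)[OF a_ratio \<theta>] by (auto simp: eventually_sequentially)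
  have am: "a n \<ge> \<theta> * a (Suc n)" if "n \<ge> m" for n
    using m[OF that] a_pos[of "Suc n"] by (simp add: field_simps)
  have comb: "\<theta> * dform 0 (comb c) \<le> dform 1 (comb c) + (\<Sum>n\<le>m. a n * eform n (comb c))"
    if c: "c \<in> coeffs" for c
  proof -
    let ?S = "{w. c w \<noteq> 0}"
    have S: "finite ?S" "?S \<subseteq> ball 0 1"
      using c by (auto simp: coeffs_def)
    \<comment> \<open>The coefficients of \<open>\<langle>z,w\<rangle> k - \<theta> k +
      \<Sum>_{n\<le>m} a_n \<langle>z,w\<rangle>^n\<close>. Beyond \<open>m\<close> the ratio
      condition makes them nonnegative, up to \<open>m\<close> the added \<open>a n\<close>
      does.\<close>
    define \<gamma> where "\<gamma> n = (if n = 0 then 0 else a (n - 1)) - \<theta> * a n + (if n \<in> {..m} then a n else 0)" for n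
    have "0 \<le> Re (\<Sum>w\<in>?S. \<Sum>z\<in>?S. c w * cnj (c z) *
        (cdot z w * kernel a z w - of_real \<theta> * kernel a z w + (\<Sum>n\<le>m. of_real (a n) * cdot z w ^ n)))"
    proof (rule power_series_kernel_psd[OF S(1), of \<gamma>])
      show "0 \<le> \<gamma> n" for n
      proof (cases "n \<le> m")
        case True
        have "\<theta> * a n \<le> a n"
          using \<theta> a_pos[of n] by simp
        then show ?thesis
          using True a_pos[of "n - 1"] by (cases n) (simp_all add: \<gamma>_def)
      next
        case False
        then show ?thesis
          using am[of "n - 1"] by (cases n) (auto simp: \<gamma>_def)
      qed
      fix z w assume "z \<in> ?S" "w \<in> ?S"
      then have zw: "z \<in> ball 0 1" "w \<in> ball 0 1"
        using S by auto
      let ?x = "cdot z w" and ?k = "kernel a z w"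
      have "(\<lambda>n. if n \<in> {..m} then of_real (a n) * ?x ^ n else 0) sums (\<Sum>n\<le>m. of_real (a n) * ?x ^ n)"
        by (rule sums_If_finite_set) simp
      from sums_add[OF sums_diff[OF cdot_kernel_sums[OF zw] sums_mult[OF kernel_sums[OF zw], of "of_real \<theta>"]] this]
      show "(\<lambda>n. of_real (\<gamma> n) * ?x ^ n) sums (?x * ?k - of_real \<theta> * ?k + (\<Sum>n\<le>m. of_real (a n) * ?x ^ n))"
        by (rule sums_cong[THEN iffD1, rotated]) (auto simp: \<gamma>_def algebra_simps)
    qed
    also have "(\<Sum>w\<in>?S. \<Sum>z\<in>?S. c w * cnj (c z) *
        (cdot z w * kernel a z w - of_real \<theta> * kernel a z w + (\<Sum>n\<le>m. of_real (a n) * cdot z w ^ n)))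
      = (\<Sum>w\<in>?S. \<Sum>z\<in>?S. c w * cnj (c z) * (cdot z w ^ 1 * kernel a z w))
        - of_real \<theta> * (\<Sum>w\<in>?S. \<Sum>z\<in>?S. c w * cnj (c z) * kernel a z w)
        + (\<Sum>n\<le>m. of_real (a n) * (\<Sum>w\<in>?S. \<Sum>z\<in>?S. c w * cnj (c z) * cdot z w ^ n))"
    proof -
      have "(\<Sum>n\<le>m. of_real (a n) * (\<Sum>w\<in>?S. \<Sum>z\<in>?S. c w * cnj (c z) * cdot z w ^ n))
          = (\<Sum>w\<in>?S. \<Sum>n\<le>m. \<Sum>z\<in>?S. c w * cnj (c z) * (of_real (a n) * cdot z w ^ n))"
        by (subst sum.swap) (simp add: sum_distrib_left mult_ac)
      also have "\<dots> = (\<Sum>w\<in>?S. \<Sum>z\<in>?S. c w * cnj (c z) * (\<Sum>n\<le>m. of_real (a n) * cdot z w ^ n))"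
        by (subst sum.swap) (simp add: sum_distrib_left)
      finally show ?thesis
        by (simp add: algebra_simps sum_subtractf sum.distrib sum_distrib_left)
    qed
    finally show ?thesis
      using S by (simp add: dform_comb[OF S] eform_comb[OF S] nrm_comb_sq[OF S] del: wform.simps One_nat_def)
  qed
  show ?thesis
  proof (rule that)
    fix v assume v: "v \<in> H"
    obtain s where s: "\<And>n. s n \<in> coeffs" "hconv (\<lambda>n. comb (s n)) v"
      using comb_dense[OF v] by blast
    have "\<theta> * dform 0 v \<le> dform 1 v + (\<Sum>n\<le>m. a n * eform n v)"
    proof (rule LIMSEQ_le)
      show "(\<lambda>i. \<theta> * dform 0 (comb (s i))) \<longlonglongrightarrow> \<theta> * dform 0 v"
        by (intro tendsto_intros dform_hconv s)
      show "(\<lambda>i. dform 1 (comb (s i)) + (\<Sum>n\<le>m. a n * eform n (comb (s i))))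
          \<longlonglongrightarrow> dform 1 v + (\<Sum>n\<le>m. a n * eform n v)"
        by (intro tendsto_intros dform_hconv eform_hconv s)
    qed (use comb[OF s(1)] in blast)
    then show "\<theta> * (nrm v)\<^sup>2 \<le> dform 1 v + (\<Sum>n\<le>m. a n * eform n v)"
      by simp
  qed
qed

text \<open>For a nonnegative form this law yields \<open>q (u - v) \<le> 2 q u + 2 q v\<close>, a
  substitute for the triangle inequality in the density argument of
  \<open>eform_eq_0_imp_zero\<close>.\<close>

lemma wform_parallelogram:
  assumes q: "\<And>u v. \<lbrakk>u \<in> H; v \<in> H\<rbrakk> \<Longrightarrow> q (u + v) + q (u - v) = 2 * q u + 2 * q v"
    and "u \<in> H" "v \<in> H"
  shows "wform q n (u + v) + wform q n (u - v) = 2 * wform q n u + 2 * wform q n v"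
  using assms(2,3)
proof (induction n arbitrary: u v)
  case (Suc n)
  have "(\<Sum>j\<in>UNIV. wform q n (L j (u + v)) + wform q n (L j (u - v)))
      = (\<Sum>j\<in>UNIV. 2 * wform q n (L j u) + 2 * wform q n (L j v))"
  proof (rule sum.cong[OF refl])
    fix j
    show "wform q n (L j (u + v)) + wform q n (L j (u - v)) = 2 * wform q n (L j u) + 2 * wform q n (L j v)"
      unfolding adj_add[OF multiplier_coord Suc.prems] adj_diff[OF multiplier_coord Suc.prems]
      by (rule Suc.IH) (simp_all add: Suc.prems)
  qed
  then show ?case
    unfolding wform.simps sum.distrib sum_distrib_left .
qed (simp add: q)

lemma eform_parallelogram:
  assumes "u \<in> H" "v \<in> H"
  shows "eform n (u + v) + eform n (u - v) = 2 * eform n u + 2 * eform n v"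
proof (rule wform_parallelogram[OF _ assms])
  fix u v :: "(complex ^ 'd) cfun"
  show "(cmod ((u + v) 0))\<^sup>2 + (cmod ((u - v) 0))\<^sup>2 = 2 * (cmod (u 0))\<^sup>2 + 2 * (cmod (v 0))\<^sup>2"
    unfolding cmod_power2 by (simp add: power2_eq_square algebra_simps)
qed

text \<open>\<open>eform n v\<close> is a weighted square sum of the Taylor coefficients of \<open>v\<close> of degree \<open>n\<close>.\<close>

lemma eform_eq_0_imp_zero:
  assumes v: "v \<in> H" and e0: "\<And>n. eform n v = 0"
  shows "v = 0"
proof -
  have lim: "(\<lambda>m. \<Sum>n<m. a n * eform n (comb c)) \<longlonglongrightarrow> (nrm (comb c))\<^sup>2" if c: "c \<in> coeffs" for c
  proof -
    let ?S = "{w. c w \<noteq> 0}"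
    have S: "finite ?S" "?S \<subseteq> ball 0 1"
      using c by (auto simp: coeffs_def)
    have "(\<lambda>n. \<Sum>w\<in>?S. \<Sum>z\<in>?S. c w * cnj (c z) * (of_real (a n) * cdot z w ^ n))
        sums (\<Sum>w\<in>?S. \<Sum>z\<in>?S. c w * cnj (c z) * kernel a z w)"
      using S by (intro sums_sum sums_mult kernel_sums) auto
    then have "(\<lambda>n. Re (\<Sum>w\<in>?S. \<Sum>z\<in>?S. c w * cnj (c z) * (of_real (a n) * cdot z w ^ n)))
        sums (nrm (comb c))\<^sup>2"
      unfolding nrm_comb_sq[OF S order_refl] by (rule sums_Re)
    moreover have "Re (\<Sum>w\<in>?S. \<Sum>z\<in>?S. c w * cnj (c z) * (of_real (a n) * cdot z w ^ n)) = a n * eform n (comb c)" for n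
    proof -
      have "(\<Sum>w\<in>?S. \<Sum>z\<in>?S. c w * cnj (c z) * (of_real (a n) * cdot z w ^ n))
        = of_real (a n) * (\<Sum>w\<in>?S. \<Sum>z\<in>?S. c w * cnj (c z) * cdot z w ^ n)"
        by (simp add: sum_distrib_left mult_ac)
      then show ?thesis
        by (simp add: eform_comb[OF S order_refl])
    qed
    ultimately show ?thesis
      by (simp add: sums_def)
  qed
  \<comment> \<open>\<open>R m u\<close> measures the part of \<open>u\<close> of degree at least
    \<open>m\<close>. It tends to 0 on kernel combinations, but at \<open>v\<close> it stays equal
    to the full squared norm.\<close>
  define R where "R m u = (nrm u)\<^sup>2 - (\<Sum>n<m. a n * eform n u)" for m u
  have R0: "0 \<le> R m u" if u: "u \<in> H" for m u
  proof -
    have comb: "(\<Sum>n<m. a n * eform n (comb c)) \<le> (nrm (comb c))\<^sup>2" if "c \<in> coeffs" for c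
    proof (rule incseq_le[OF _ lim[OF that]])
      show "incseq (\<lambda>m. \<Sum>n<m. a n * eform n (comb c))"
      proof (intro incseq_SucI)
        have "0 \<le> a m * eform m (comb c)" for m
          by (intro mult_nonneg_nonneg wform_nonneg less_imp_le[OF a_pos]) simp
        then show "(\<Sum>n<m. a n * eform n (comb c)) \<le> (\<Sum>n<Suc m. a n * eform n (comb c))" for m
          by simp
      qed
    qed
    obtain s where s: "\<And>n. s n \<in> coeffs" "hconv (\<lambda>n. comb (s n)) u"
      using comb_dense[OF u] by blast
    have "(\<Sum>n<m. a n * eform n u) \<le> (nrm u)\<^sup>2"
    proof (rule LIMSEQ_le)
      show "(\<lambda>i. (nrm (comb (s i)))\<^sup>2) \<longlonglongrightarrow> (nrm u)\<^sup>2"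
        by (intro tendsto_intros hconv_nrm s)
      show "(\<lambda>i. \<Sum>n<m. a n * eform n (comb (s i))) \<longlonglongrightarrow> (\<Sum>n<m. a n * eform n u)"
        by (intro tendsto_intros eform_hconv s)
    qed (use comb[OF s(1)] in blast)
    then show ?thesis by (simp add: R_def)
  qed
  have R1: "R m u \<le> (nrm u)\<^sup>2" for m u
  proof -
    have "0 \<le> (\<Sum>n<m. a n * eform n u)"
      by (intro sum_nonneg mult_nonneg_nonneg wform_nonneg less_imp_le[OF a_pos]) simp
    then show ?thesis
      by (simp add: R_def)
  qed
  have par: "R m (u + w) + R m (u - w) = 2 * R m u + 2 * R m w" if "u \<in> H" "w \<in> H" for m u w
  proof -
    have "a n * eform n (u + w) + a n * eform n (u - w) = 2 * (a n * eform n u) + 2 * (a n * eform n w)" for n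
      using arg_cong[OF eform_parallelogram[OF that, of n], of "\<lambda>t. a n * t"] by (simp add: algebra_simps)
    then have "(\<Sum>n<m. a n * eform n (u + w)) + (\<Sum>n<m. a n * eform n (u - w))
        = 2 * (\<Sum>n<m. a n * eform n u) + 2 * (\<Sum>n<m. a n * eform n w)"
      by (simp add: sum_distrib_left flip: sum.distrib)
    then show ?thesis
      using that by (simp add: R_def nrm_add_sq nrm_diff_sq)
  qed
  \<comment> \<open>Write \<open>v\<close> as \<open>u - (u - v)\<close> with a combination
    \<open>u\<close>. As \<open>m\<close> grows \<open>R m u\<close> disappears, and only the
    distance from \<open>v\<close> to \<open>u\<close> remains.\<close>
  have le: "(nrm v)\<^sup>2 \<le> 2 * (nrm (comb c - v))\<^sup>2" if c: "c \<in> coeffs" for c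
  proof -
    have "(nrm v)\<^sup>2 \<le> 2 * R m (comb c) + 2 * (nrm (comb c - v))\<^sup>2" for m
    proof -
      let ?u = "comb c"
      have "(nrm v)\<^sup>2 = R m v"
        by (simp add: R_def e0)
      also have "\<dots> = R m (?u - (?u - v))"
        by simp
      also have "\<dots> \<le> 2 * R m ?u + 2 * R m (?u - v)"
        using par[of ?u "?u - v" m] R0[of "?u + (?u - v)" m] c v
        by (smt (verit, best) add_mem comb_mem diff_mem)
      also have "\<dots> \<le> 2 * R m ?u + 2 * (nrm (?u - v))\<^sup>2"
        using R1[of m "?u - v"] by simp
      finally show ?thesis .
    qed
    moreover have "(\<lambda>m. 2 * R m (comb c) + 2 * (nrm (comb c - v))\<^sup>2)
        \<longlonglongrightarrow> 2 * ((nrm (comb c))\<^sup>2 - (nrm (comb c))\<^sup>2) + 2 * (nrm (comb c - v))\<^sup>2"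
      unfolding R_def by (intro tendsto_intros lim c)
    ultimately have "(nrm v)\<^sup>2 \<le> 2 * ((nrm (comb c))\<^sup>2 - (nrm (comb c))\<^sup>2) + 2 * (nrm (comb c - v))\<^sup>2"
      by (intro LIMSEQ_le_const) auto
    then show ?thesis by simp
  qed
  obtain s where s: "\<And>n. s n \<in> coeffs" "hconv (\<lambda>n. comb (s n)) v"
    using comb_dense[OF v] by blast
  have "(\<lambda>n. 2 * (nrm (comb (s n) - v))\<^sup>2) \<longlonglongrightarrow> 2 * 0\<^sup>2"
    using s(2) unfolding hconv_def by (intro tendsto_intros) auto
  then have "(nrm v)\<^sup>2 \<le> 2 * 0\<^sup>2"
    by (rule LIMSEQ_le_const) (use le s in blast)
  then show ?thesis
    using v by simp
qed

end

section \<open>Characters of the multiplier algebra\<close>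

text \<open>A seminorm stands in for the norm of a quotient algebra: \<open>q\<close> will be the
  distance to a maximal ideal, and \<open>eqv\<close> is equality in the quotient.\<close>

locale seminormed_function_algebra =
  fixes A :: "'x cfun set" and q :: "'x cfun \<Rightarrow> real"
  assumes const_mem [simp]: "(\<lambda>_. c) \<in> A"
    and plus_mem [simp]: "\<lbrakk>f \<in> A; g \<in> A\<rbrakk> \<Longrightarrow> f + g \<in> A"
    and times_mem [simp]: "\<lbrakk>f \<in> A; g \<in> A\<rbrakk> \<Longrightarrow> f * g \<in> A"
    and q_plus: "\<lbrakk>f \<in> A; g \<in> A\<rbrakk> \<Longrightarrow> q (f + g) \<le> q f + q g"
    and q_times: "\<lbrakk>f \<in> A; g \<in> A\<rbrakk> \<Longrightarrow> q (f * g) \<le> q f * q g"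
    and q_const: "f \<in> A \<Longrightarrow> q ((\<lambda>_. c) * f) = cmod c * q f"
begin

abbreviation K :: "complex \<Rightarrow> 'x cfun" where "K c \<equiv> (\<lambda>_. c)"

lemma minus_mem [simp]: "\<lbrakk>f \<in> A; g \<in> A\<rbrakk> \<Longrightarrow> f - g \<in> A"
proof -
  assume "f \<in> A" "g \<in> A"
  then have "f + K (- 1) * g \<in> A" by simp
  also have "f + K (- 1) * g = f - g" by (auto simp: fun_eq_iff)
  finally show ?thesis .
qed

lemma one_mem [simp]: "1 \<in> A" and zero_mem [simp]: "0 \<in> A"
  using const_mem[of 1] const_mem[of 0] by (simp_all add: one_fun_def zero_fun_def)

lemma power_mem [simp]: "f \<in> A \<Longrightarrow> f ^ n \<in> A"
  by (induction n) auto

lemma q_zero [simp]: "q 0 = 0"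
  using q_const[of 0 0] by (simp add: times_fun_def zero_fun_def)

lemma q_uminus: "\<lbrakk>f \<in> A; g \<in> A\<rbrakk> \<Longrightarrow> q (f - g) = q (g - f)"
proof -
  assume *: "f \<in> A" "g \<in> A"
  have "K (- 1) * (f - g) = g - f" by (auto simp: fun_eq_iff)
  then show ?thesis
    using q_const[of "f - g" "- 1"] * by simp
qed

lemma q_nonneg: "f \<in> A \<Longrightarrow> 0 \<le> q f"
proof -
  assume f: "f \<in> A"
  have "q (f + (0 - f)) \<le> q f + q (0 - f)"
    by (rule q_plus[OF f minus_mem[OF zero_mem f]])
  moreover have "q (0 - f) = q (f - 0)"
    by (rule q_uminus[OF zero_mem f])
  ultimately show ?thesis by simp
qed

lemma q_triangle: "\<lbrakk>f \<in> A; g \<in> A; h \<in> A\<rbrakk> \<Longrightarrow> q (f - h) \<le> q (f - g) + q (g - h)"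
  using q_plus[of "f - g" "g - h"] by simp

lemma q_power: "\<lbrakk>n > 0; f \<in> A\<rbrakk> \<Longrightarrow> q (f ^ n) \<le> q f ^ n"
proof (induction n rule: nat_induct_non_zero)
  case (Suc n)
  then have "q (f ^ Suc n) \<le> q f * q (f ^ n)"
    by (simp add: q_times)
  also have "\<dots> \<le> q f * q f ^ n"
    using Suc by (intro mult_left_mono q_nonneg) auto
  finally show ?case
    unfolding power_Suc .
qed simp

definition eqv :: "'x cfun \<Rightarrow> 'x cfun \<Rightarrow> bool" where
  "eqv f g \<longleftrightarrow> f \<in> A \<and> g \<in> A \<and> q (f - g) = 0"

lemma eqv_sym: "eqv f g \<Longrightarrow> eqv g f"
  unfolding eqv_def using q_uminus by metis

lemma eqv_trans [trans]: "eqv f g \<Longrightarrow> eqv g h \<Longrightarrow> eqv f h"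
  unfolding eqv_def using q_triangle[of f g h] q_nonneg[of "f - h"] by simp

lemma eqv_plus: "eqv f g \<Longrightarrow> eqv f' g' \<Longrightarrow> eqv (f + f') (g + g')"
  unfolding eqv_def
  using q_plus[of "f - g" "f' - g'"] q_nonneg[of "(f + f') - (g + g')"]
  by (simp add: algebra_simps)

lemma eqv_times_left: "eqv f g \<Longrightarrow> h \<in> A \<Longrightarrow> eqv (h * f) (h * g)"
  unfolding eqv_def
  using q_times[of h "f - g"] q_nonneg[of "h * f - h * g"]
  by (simp add: algebra_simps)

lemma eqv_q: "eqv f g \<Longrightarrow> q f = q g"
  unfolding eqv_def
  using q_triangle[of f g 0] q_triangle[of g f 0] q_uminus[of f g] by simp

lemma eqv_minus_swap: "eqv (f - g) h \<Longrightarrow> f \<in> A \<Longrightarrow> g \<in> A \<Longrightarrow> eqv (f - h) g"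
  unfolding eqv_def by (metis diff_diff_eq2 add.commute diff_diff_eq minus_mem)

text \<open>
  Otherwise \<open>G c = c (c - a)\<^sup>-\<^sup>1\<close> is defined on the whole plane. Its average over the vertices of a
  regular \<open>N\<close>-gon through \<open>c\<close> is \<open>c\<^sup>N (c\<^sup>N - a\<^sup>N)\<^sup>-\<^sup>1\<close>, which for \<open>N \<rightarrow> \<infinity>\<close> tends to \<open>1\<close> outside the
  spectral radius of \<open>a\<close>. By uniform continuity of \<open>G\<close> it stays near \<open>1\<close> a little inside the
  spectral radius, which is absurd.
\<close>

theorem Gelfand_Mazur:
  assumes a: "a \<in> A" and q1: "q 1 \<noteq> 0"
  obtains c where "\<And>\<theta>. \<theta> \<in> A \<Longrightarrow> q ((K c - a) * \<theta> - 1) \<noteq> 0"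
proof (rule ccontr)
  assume "\<not> thesis"
  then have "\<forall>c. \<exists>\<theta>\<in>A. q ((K c - a) * \<theta> - 1) = 0"
    using that by blast
  then obtain R where R [simp]: "\<And>c. R c \<in> A" and R0: "\<And>c. q ((K c - a) * R c - 1) = 0"
    by metis
  note [simp] = a
  have Req: "eqv ((K c - a) * R c) 1" for c
    using R0 by (simp add: eqv_def)
  have q1': "q 1 \<ge> 1"
  proof -
    have "q 1 \<le> q 1 * q 1"
      using q_times[of 1 1] by simp
    moreover have "q 1 > 0"
      using q1 q_nonneg[of 1] by simp
    ultimately show ?thesis by simp
  qed
  \<comment> \<open>The resolvent identity \<open>R c - R d = (d - c) R c R d\<close>, valid modulo
    \<open>eqv\<close>.\<close>
  have Rdiff: "q (R c - R d) \<le> cmod (c - d) * q (R c) * q (R d)" for c d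
  proof -
    have "eqv (R c) (R c * ((K d - a) * R d))"
      using eqv_times_left[OF eqv_sym[OF Req[of d]] R[of c]] by simp
    moreover have "eqv (R d) (R d * ((K c - a) * R c))"
      using eqv_times_left[OF eqv_sym[OF Req[of c]] R[of d]] by simp
    then have "eqv (K (- 1) * R d) (K (- 1) * (R d * ((K c - a) * R c)))"
      by (rule eqv_times_left) simp
    ultimately have "eqv (R c + K (- 1) * R d) (R c * ((K d - a) * R d) + K (- 1) * (R d * ((K c - a) * R c)))"
      by (rule eqv_plus)
    also have "R c * ((K d - a) * R d) + K (- 1) * (R d * ((K c - a) * R c)) = K (d - c) * (R c * R d)"
      by (auto simp: fun_eq_iff algebra_simps)
    also have "R c + K (- 1) * R d = R c - R d"
      by (auto simp: fun_eq_iff)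
    finally have "q (R c - R d) = q (K (d - c) * (R c * R d))"
      by (rule eqv_q)
    also have "\<dots> = cmod (d - c) * q (R c * R d)"
      by (rule q_const) simp
    also have "\<dots> \<le> cmod (d - c) * (q (R c) * q (R d))"
      by (intro mult_left_mono q_times) auto
    finally show ?thesis
      by (simp add: norm_minus_commute mult.assoc)
  qed
  have cont: "isCont (\<lambda>c. q (R c)) c" for c
  proof -
    let ?B = "q (R c)"
    have B: "?B \<ge> 0"
      by (simp add: q_nonneg)
    \<comment> \<open>\<open>tri\<close> bounds \<open>q (R d)\<close> partly by itself, with a
      factor \<open>|d - c| ?B\<close> of at most 1/2 in this disc, so the term is absorbed. The 1
      in the radius covers \<open>?B = 0\<close>.\<close>
    have near: "\<bar>q (R d) - ?B\<bar> \<le> 2 * ?B\<^sup>2 * cmod (d - c)" if "cmod (d - c) < 1 / (2 * ?B + 1)" for d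
    proof -
      have tri: "\<bar>q (R d) - ?B\<bar> \<le> cmod (d - c) * ?B * q (R d)"
        using q_triangle[of "R d" "R c" 0] q_triangle[of "R c" "R d" 0] Rdiff[of c d]
          q_uminus[of "R c" "R d"] by (simp add: norm_minus_commute)
      have "cmod (d - c) * (2 * ?B + 1) < 1"
        using that B by (simp add: field_simps)
      then have "cmod (d - c) * ?B \<le> 1 / 2"
        using norm_ge_zero[of "d - c"] unfolding distrib_left by linarith
      then have "cmod (d - c) * ?B * q (R d) \<le> 1 / 2 * q (R d)"
        by (intro mult_right_mono q_nonneg) auto
      then have "q (R d) \<le> 2 * ?B"
        using tri by linarith
      then have "cmod (d - c) * ?B * q (R d) \<le> cmod (d - c) * ?B * (2 * ?B)"
        using B by (intro mult_left_mono) auto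
      then show ?thesis
        using tri by (simp add: power2_eq_square algebra_simps)
    qed
    have "((\<lambda>d. 2 * ?B\<^sup>2 * cmod (d - c)) \<longlongrightarrow> 2 * ?B\<^sup>2 * cmod (c - c)) (at c)"
      by (intro tendsto_intros)
    then have lim: "((\<lambda>d. 2 * ?B\<^sup>2 * cmod (d - c)) \<longlongrightarrow> 0) (at c)"
      by simp
    have "\<forall>\<^sub>F d in at c. norm (q (R d) - ?B) \<le> 2 * ?B\<^sup>2 * cmod (d - c)"
      unfolding eventually_at using near B
      by (intro exI[of _ "1 / (2 * ?B + 1)"]) (auto simp: dist_norm)
    then have "((\<lambda>d. q (R d) - ?B) \<longlongrightarrow> 0) (at c)"
      by (rule Lim_null_comparison[OF _ lim])
    then show ?thesis
      unfolding isCont_def by (simp add: LIM_zero_iff)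
  qed
  define G where "G c = K c * R c" for c
  have G [simp]: "G c \<in> A" for c
    by (simp add: G_def)
  have G_lip: "\<exists>B>0. \<forall>c d. cmod c \<le> r \<and> cmod d \<le> r \<longrightarrow> q (G c - G d) \<le> B * cmod (c - d)" for r
  proof -
    have "bounded ((\<lambda>c. q (R c)) ` cball 0 r)"
      using cont by (intro compact_imp_bounded compact_continuous_image)
        (auto intro: continuous_at_imp_continuous_on)
    then obtain M where M: "M > 0" "\<And>c. cmod c \<le> r \<Longrightarrow> norm (q (R c)) \<le> M"
      unfolding bounded_pos by auto
    have MR: "q (R c) \<le> M" if "cmod c \<le> r" for c
      using M(2)[OF that] by simp
    have "q (G c - G d) \<le> (M + \<bar>r\<bar> * M * M) * cmod (c - d)" if cd: "cmod c \<le> r" "cmod d \<le> r" for c d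
    proof -
      have "G c - G d = K (c - d) * R c + K d * (R c - R d)"
        by (auto simp: G_def fun_eq_iff algebra_simps)
      then have "q (G c - G d) \<le> q (K (c - d) * R c) + q (K d * (R c - R d))"
        by (simp add: q_plus)
      also have "\<dots> = cmod (c - d) * q (R c) + cmod d * q (R c - R d)"
        by (simp add: q_const)
      also have "\<dots> \<le> cmod (c - d) * M + \<bar>r\<bar> * (cmod (c - d) * M * M)"
      proof (intro add_mono mult_mono)
        have "cmod (c - d) * q (R c) * q (R d) \<le> cmod (c - d) * M * M"
          using M(1) MR cd by (intro mult_mono mult_left_mono mult_nonneg_nonneg q_nonneg) auto
        with Rdiff[of c d] show "q (R c - R d) \<le> cmod (c - d) * M * M" by linarith
      qed (use cd MR q_nonneg in auto)
      finally show ?thesis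
        by (simp add: algebra_simps)
    qed
    moreover have "M + \<bar>r\<bar> * M * M > 0"
      using M(1) by (simp add: add_pos_nonneg)
    ultimately show ?thesis by blast
  qed
  \<comment> \<open>\<open>\<omega> m\<close> is a \<open>2^m\<close>-th root of -1. Averaging over
    \<open>c\<close> and \<open>\<omega> m * c\<close> at each stage makes \<open>T m\<close> the
    average of \<open>G\<close> over the regular \<open>2^m\<close>-gon through
    \<open>c\<close>.\<close>
  define \<omega> where "\<omega> m = cis (pi / 2 ^ m)" for m :: nat
  have \<omega>_norm: "cmod (\<omega> m) = 1" for m
    by (simp add: \<omega>_def)
  have \<omega>_pow: "\<omega> m ^ (2 ^ m) = - 1" for m
    unfolding \<omega>_def by (subst Complex.DeMoivre) simp
  define T where "T = rec_nat G (\<lambda>m t c. K (1/2) * (t c + t (\<omega> m * c)))"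
  have T0: "T 0 = G" and TS: "T (Suc m) c = K (1/2) * (T m c + T m (\<omega> m * c))" for m c
    by (simp_all add: T_def)
  have T [simp]: "T m c \<in> A" for m c
    by (induction m arbitrary: c) (simp_all add: T0 TS)
  have Teq: "eqv ((K (c ^ 2 ^ m) - a ^ 2 ^ m) * T m c) (K (c ^ 2 ^ m))" for m c
  proof (induction m arbitrary: c)
    case 0
    have "eqv (K c * ((K c - a) * R c)) (K c * 1)"
      by (rule eqv_times_left[OF Req]) simp
    then show ?case
      unfolding power_0 power_one_right T0 G_def by (simp only: mult_ac mult_1_right mult_1_left)
  next
    case (Suc m)
    \<comment> \<open>The half sum of \<open>c^N (c^N - a^N)^-1\<close> and
      \<open>c^N (c^N + a^N)^-1\<close> is \<open>c^(2N) (c^(2N) - a^(2N))^-1\<close>, and the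
      second summand is the first one at \<open>?c'\<close>. The combination below is this identity
      with denominators cleared.\<close>
    let ?N = "2 ^ m :: nat" and ?c' = "\<omega> m * c"
    have p: "?c' ^ ?N = - (c ^ ?N)"
      by (simp add: power_mult_distrib \<omega>_pow)
    have "eqv (K (1/2) * ((K (c ^ ?N) + a ^ ?N) * ((K (c ^ ?N) - a ^ ?N) * T m c)))
        (K (1/2) * ((K (c ^ ?N) + a ^ ?N) * K (c ^ ?N)))"
      by (intro eqv_times_left Suc.IH) auto
    moreover have "eqv (K (- (1/2)) * ((K (c ^ ?N) - a ^ ?N) * ((K (?c' ^ ?N) - a ^ ?N) * T m ?c')))
        (K (- (1/2)) * ((K (c ^ ?N) - a ^ ?N) * K (?c' ^ ?N)))"
      by (intro eqv_times_left Suc.IH) auto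
    ultimately have "eqv (K (1/2) * ((K (c ^ ?N) + a ^ ?N) * ((K (c ^ ?N) - a ^ ?N) * T m c))
        + K (- (1/2)) * ((K (c ^ ?N) - a ^ ?N) * ((K (?c' ^ ?N) - a ^ ?N) * T m ?c')))
        (K (1/2) * ((K (c ^ ?N) + a ^ ?N) * K (c ^ ?N)) + K (- (1/2)) * ((K (c ^ ?N) - a ^ ?N) * K (?c' ^ ?N)))"
      by (rule eqv_plus)
    moreover have "K (1/2) * ((K (c ^ ?N) + a ^ ?N) * ((K (c ^ ?N) - a ^ ?N) * T m c))
        + K (- (1/2)) * ((K (c ^ ?N) - a ^ ?N) * ((K (?c' ^ ?N) - a ^ ?N) * T m ?c'))
        = (K (c ^ 2 ^ Suc m) - a ^ 2 ^ Suc m) * T (Suc m) c"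
      unfolding p TS power_Suc mult_2 power_add
      by (auto simp: fun_eq_iff algebra_simps)
    moreover have "K (1/2) * ((K (c ^ ?N) + a ^ ?N) * K (c ^ ?N)) + K (- (1/2)) * ((K (c ^ ?N) - a ^ ?N) * K (?c' ^ ?N))
        = K (c ^ 2 ^ Suc m)"
      unfolding p power_Suc mult_2 power_add by (auto simp: fun_eq_iff algebra_simps)
    ultimately show ?case by (simp only:)
  qed
  \<comment> \<open>Averaging over rotations preserves a bound that holds on the whole circle, so
    the estimate is uniform in \<open>m\<close>.\<close>
  have Tdiff: "q (T m (of_real r * u) - T m (of_real t * u)) \<le> \<eta>"
    if "\<And>z. cmod z = 1 \<Longrightarrow> q (G (of_real r * z) - G (of_real t * z)) \<le> \<eta>" "cmod u = 1" for m r t u \<eta>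
    using that(2)
  proof (induction m arbitrary: u)
    case (Suc m)
    have "cmod (\<omega> m * u) = 1"
      using Suc.prems by (simp add: norm_mult \<omega>_norm)
    note 1 = Suc.IH[OF Suc.prems] and 2 = Suc.IH[OF this]
    have "T (Suc m) (of_real r * u) - T (Suc m) (of_real t * u)
        = K (1/2) * ((T m (of_real r * u) - T m (of_real t * u))
          + (T m (of_real r * (\<omega> m * u)) - T m (of_real t * (\<omega> m * u))))"
      by (auto simp: TS fun_eq_iff algebra_simps)
    then have "q (T (Suc m) (of_real r * u) - T (Suc m) (of_real t * u))
        = 1/2 * q ((T m (of_real r * u) - T m (of_real t * u))
          + (T m (of_real r * (\<omega> m * u)) - T m (of_real t * (\<omega> m * u))))"
      by (simp add: q_const)
    also have "\<dots> \<le> 1/2 * (q (T m (of_real r * u) - T m (of_real t * u))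
          + q (T m (of_real r * (\<omega> m * u)) - T m (of_real t * (\<omega> m * u))))"
      by (intro mult_left_mono q_plus) auto
    also have "\<dots> \<le> 1/2 * (\<eta> + \<eta>)"
      by (intro mult_left_mono add_mono 1 2) simp
    finally show ?case
      by (simp only: mult_2[symmetric] mult.assoc[symmetric])
  qed (use that in \<open>simp add: T0\<close>)
  \<comment> \<open>The infimum of \<open>S\<close> is the spectral radius of \<open>a\<close> in
    the seminorm \<open>q\<close>, computed along the powers \<open>2^m\<close>.\<close>
  define S where "S = {r. r > 0 \<and> (\<lambda>m. q (a ^ 2 ^ m) / r ^ 2 ^ m) \<longlonglongrightarrow> 0}"
  have pow_lim: "(\<lambda>m. (s / r) ^ 2 ^ m) \<longlonglongrightarrow> 0" if "0 \<le> s" "s < r" for s r :: real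
  proof -
    have "(\<lambda>n. (s / r) ^ n) \<longlonglongrightarrow> 0"
      using that by (intro LIMSEQ_power_zero) auto
    moreover have "strict_mono (\<lambda>m. 2 ^ m :: nat)"
      by (rule strict_monoI) simp
    ultimately show ?thesis
      using LIMSEQ_subseq_LIMSEQ[of "\<lambda>n. (s / r) ^ n" 0 "\<lambda>m. 2 ^ m"] by (simp add: o_def)
  qed
  have S_I: "r \<in> S" if "0 \<le> s" "s < r" "\<And>m. m \<ge> m0 \<Longrightarrow> q (a ^ 2 ^ m) \<le> s ^ 2 ^ m" for s r m0
  proof -
    have "\<forall>\<^sub>F m in sequentially. norm (q (a ^ 2 ^ m) / r ^ 2 ^ m) \<le> (s / r) ^ 2 ^ m"
      unfolding eventually_sequentially
    proof (intro exI[of _ m0] allI impI)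
      fix m assume "m0 \<le> m"
      then have "q (a ^ 2 ^ m) / r ^ 2 ^ m \<le> s ^ 2 ^ m / r ^ 2 ^ m"
        using that by (intro divide_right_mono) auto
      then show "norm (q (a ^ 2 ^ m) / r ^ 2 ^ m) \<le> (s / r) ^ 2 ^ m"
        using that q_nonneg[of "a ^ 2 ^ m"] by (simp add: power_divide)
    qed
    then show ?thesis
      using that pow_lim[OF that(1,2)] by (auto simp: S_def intro: Lim_null_comparison)
  qed
  define r0 where "r0 = q a + 1"
  have "r0 \<in> S"
    by (rule S_I[of "q a" _ 0]) (auto simp: r0_def q_nonneg q_power)
  define \<rho> where "\<rho> = Inf S"
  have bdd: "bdd_below S"
    by (rule bdd_belowI[of _ 0]) (auto simp: S_def)
  have \<rho>_le: "\<rho> \<le> r0"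
    using \<open>r0 \<in> S\<close> bdd by (simp add: \<rho>_def cInf_lower)
  obtain B where B: "B > 0" "\<And>c d. \<lbrakk>cmod c \<le> r0 + 1; cmod d \<le> r0 + 1\<rbrakk> \<Longrightarrow> q (G c - G d) \<le> B * cmod (c - d)"
    using G_lip[of "r0 + 1"] by blast
  \<comment> \<open>A radial step shorter than \<open>\<delta>\<close> moves \<open>G\<close>, hence
    every \<open>T m\<close>, by at most 1/4; \<open>\<delta> \<le> 1\<close> keeps the radii in the
    disc where the constant \<open>B\<close> is valid.\<close>
  define \<delta> where "\<delta> = min 1 (1 / (4 * B))"
  have \<delta>: "0 < \<delta>" "\<delta> \<le> 1" "B * \<delta> \<le> 1 / 4"
    using B(1) by (auto simp: \<delta>_def min_def field_simps)
  obtain r where r: "r \<in> S" "r < \<rho> + \<delta> / 2"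
    using cInf_lessD[of S "\<rho> + \<delta> / 2"] \<open>r0 \<in> S\<close> \<delta> by (auto simp: \<rho>_def)
  have r_pos: "r > 0" and r_lim: "(\<lambda>m. q (a ^ 2 ^ m) / r ^ 2 ^ m) \<longlonglongrightarrow> 0"
    using r by (auto simp: S_def)
  have \<rho>r: "\<rho> \<le> r"
    using r bdd by (simp add: \<rho>_def cInf_lower)
  \<comment> \<open>Just inside the spectral radius, or 0 when that radius is at most
    \<open>\<delta> / 2\<close>. At 0 every \<open>T m\<close> vanishes, so closeness to 1 is
    already absurd there.\<close>
  define t where "t = (if \<rho> > \<delta> / 2 then \<rho> - \<delta> / 2 else 0)"
  have t: "0 \<le> t" "t < r" "r - t < \<delta>"
    using r r_pos \<rho>r \<delta> by (auto simp: t_def)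
  have near_rt: "q (T m (of_real r) - T m (of_real t)) \<le> 1/4" for m
  proof -
    have "q (G (of_real r * z) - G (of_real t * z)) \<le> 1/4" if "cmod z = 1" for z
    proof -
      have "q (G (of_real r * z) - G (of_real t * z)) \<le> B * cmod (of_real r * z - of_real t * z)"
        using that r t r_pos \<rho>_le \<delta> by (intro B(2)) (auto simp: norm_mult)
      also have "cmod (of_real r * z - of_real t * z) = r - t"
        using that t by (simp add: norm_mult flip: left_diff_distrib of_real_diff)
      also have "B * (r - t) \<le> B * \<delta>"
        using t B by simp
      finally have "q (G (of_real r * z) - G (of_real t * z)) \<le> B * \<delta>" .
      then show ?thesis
        using \<delta> by simp
    qed
    from Tdiff[OF this, of 1 m] show ?thesis by simp
  qed
  have quot: "eqv (T m (of_real s) - 1) (K (1 / of_real s ^ 2 ^ m) * a ^ 2 ^ m * T m (of_real s))" if "s > 0" for m s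
  proof -
    let ?c = "complex_of_real s ^ 2 ^ m"
    have nz: "?c \<noteq> 0"
      using that by simp
    have "eqv (K (1 / ?c) * ((K ?c - a ^ 2 ^ m) * T m (of_real s))) (K (1 / ?c) * K ?c)"
      by (intro eqv_times_left Teq) simp
    moreover have "K (1 / ?c) * K ?c = 1"
      using nz by (auto simp: fun_eq_iff)
    moreover have "K (1 / ?c) * ((K ?c - a ^ 2 ^ m) * T m (of_real s))
        = T m (of_real s) - K (1 / ?c) * a ^ 2 ^ m * T m (of_real s)"
      using nz by (auto simp: fun_eq_iff field_simps)
    ultimately have "eqv (T m (of_real s) - K (1 / ?c) * a ^ 2 ^ m * T m (of_real s)) 1"
      by (simp only:)
    then show ?thesis
      by (rule eqv_minus_swap) simp_all
  qed
  have qD: "q (K (1 / of_real s ^ 2 ^ m) * a ^ 2 ^ m) = q (a ^ 2 ^ m) / s ^ 2 ^ m" if "s > 0" for m s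
    using that by (simp add: q_const norm_divide norm_power)
  \<comment> \<open>With this threshold \<open>q (?T - 1) \<le> ?e * q ?T\<close> and
    \<open>q ?T \<le> 2 * q 1\<close> give the bound 1/4 in \<open>Tr\<close>.\<close>
  have "\<forall>\<^sub>F m in sequentially. q (a ^ 2 ^ m) / r ^ 2 ^ m < 1 / (8 * q 1)"
    using r_lim q1' by (intro order_tendstoD) auto
  then obtain m0 where m0: "\<And>m. m \<ge> m0 \<Longrightarrow> q (a ^ 2 ^ m) / r ^ 2 ^ m < 1 / (8 * q 1)"
    by (auto simp: eventually_sequentially)
  have Tr: "q (T m (of_real r) - 1) \<le> 1/4" if "m \<ge> m0" for m
  proof -
    let ?T = "T m (of_real r)" and ?e = "q (a ^ 2 ^ m) / r ^ 2 ^ m"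
    have e: "0 \<le> ?e" "?e < 1 / (8 * q 1)" "?e \<le> 1/2"
    proof -
      show "0 \<le> ?e"
        using r_pos by (simp add: q_nonneg)
      show "?e < 1 / (8 * q 1)"
        by (rule m0[OF that])
      also have "1 / (8 * q 1) \<le> 1/2"
        using q1' by (simp add: field_simps)
      finally show "?e \<le> 1/2" by simp
    qed
    have "q (?T - 1) \<le> ?e * q ?T"
      using eqv_q[OF quot[OF r_pos, of m]] q_times[of "K (1 / of_real r ^ 2 ^ m) * a ^ 2 ^ m" ?T] qD[OF r_pos, of m]
      by simp
    moreover have "q ?T \<le> q (?T - 1) + q 1"
      using q_plus[of "?T - 1" 1] by simp
    moreover have "?e * q ?T \<le> 1/2 * q ?T"
      using e by (intro mult_right_mono q_nonneg) auto
    ultimately have T2: "q ?T \<le> 2 * q 1"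
      by linarith
    have "q (?T - 1) \<le> ?e * (2 * q 1)"
      using \<open>q (?T - 1) \<le> ?e * q ?T\<close> mult_left_mono[OF T2 e(1)] by linarith
    also have "\<dots> \<le> 1 / (8 * q 1) * (2 * q 1)"
      using e q1' by (intro mult_right_mono) auto
    also have "\<dots> = 1/4"
      using q1' by simp
    finally show ?thesis .
  qed
  have Tt: "q (T m (of_real t) - 1) \<le> 1/2" if "m \<ge> m0" for m
    using q_triangle[of "T m (of_real t)" "T m (of_real r)" 1] Tr[OF that] near_rt[of m]
      q_uminus[of "T m (of_real t)" "T m (of_real r)"] by simp
  show False
  proof (cases "\<rho> > \<delta> / 2")
    case False
    then have "t = 0" by (simp add: t_def)
    have "T m 0 = 0" for m
      by (induction m) (auto simp: T0 TS G_def fun_eq_iff)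
    then have "q (0 - 1) \<le> 1/2"
      using Tt[of m0] \<open>t = 0\<close> by simp
    then show False
      using q1' q_uminus[of 0 1] by simp
  next
    case True
    then have t_pos: "t > 0" and t\<rho>: "t < \<rho>"
      using \<delta> by (auto simp: t_def)
    \<comment> \<open>\<open>?D\<close> is \<open>a^N / t^N\<close>, and \<open>?D * ?T\<close> is
      equivalent to \<open>?T - 1\<close>, of size at most 1/2. So
      \<open>q ?D \<le> 1/2 + q ?D / 2\<close>, which gives \<open>q ?D \<le> 1\<close> and then a
      radius in \<open>S\<close> below its infimum.\<close>
    have "q (a ^ 2 ^ m) \<le> t ^ 2 ^ m" if "m \<ge> m0" for m
    proof -
      let ?T = "T m (of_real t)" and ?D = "K (1 / of_real t ^ 2 ^ m) * a ^ 2 ^ m"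
      have "q ?D \<le> q (?D * ?T) + q (?D * (?T - 1))"
        using q_triangle[of "?D" "?D * ?T" 0] q_uminus[of "?D * ?T" "?D"] by (simp add: algebra_simps)
      moreover have "q (?D * (?T - 1)) \<le> q ?D * (1/2)"
        using q_times[of ?D "?T - 1"] mult_left_mono[OF Tt[OF that] q_nonneg[of ?D]] by simp
      moreover have "q (?D * ?T) \<le> 1/2"
        using eqv_q[OF quot[OF t_pos, of m]] Tt[OF that] by simp
      ultimately have "q ?D \<le> 1" by linarith
      then show ?thesis
        unfolding qD[OF t_pos] using t_pos by simp
    qed
    then have "(t + \<rho>) / 2 \<in> S"
      using t_pos t\<rho> by (intro S_I[of t _ m0]) auto
    then show False
      using bdd t\<rho> cInf_lower[of "(t + \<rho>) / 2" S] by (simp add: \<rho>_def)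
  qed
qed

end

section \<open>The quotient of the multiplier algebra by a maximal ideal\<close>

lemma le_Inf_plus:
  fixes x :: real
  assumes "S \<noteq> {}" "T \<noteq> {}" "\<And>s t. \<lbrakk>s \<in> S; t \<in> T\<rbrakk> \<Longrightarrow> x \<le> s + t"
  shows "x \<le> Inf S + Inf T"
proof -
  have "x - t \<le> Inf S" if "t \<in> T" for t
    using assms that by (intro cInf_greatest) (auto simp: algebra_simps)
  then have "x - Inf S \<le> Inf T"
    using assms by (intro cInf_greatest) (auto simp: algebra_simps)
  then show ?thesis by simp
qed

lemma le_mult_Inf:
  fixes x :: real
  assumes "S \<noteq> {}" "t \<ge> 0" "\<And>s. s \<in> S \<Longrightarrow> x \<le> t * s"
  shows "x \<le> t * Inf S"
proof (cases "t = 0")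
  case False
  then have "x / t \<le> Inf S"
    using assms by (intro cInf_greatest) (auto simp: field_simps)
  then show ?thesis
    using False assms by (simp add: field_simps)
qed (use assms in auto)

lemma le_Inf_times:
  fixes x :: real
  assumes "S \<noteq> {}" "T \<noteq> {}" "\<And>s. s \<in> S \<Longrightarrow> s \<ge> 0" "\<And>t. t \<in> T \<Longrightarrow> t \<ge> 0"
    "\<And>s t. \<lbrakk>s \<in> S; t \<in> T\<rbrakk> \<Longrightarrow> x \<le> s * t"
  shows "x \<le> Inf S * Inf T"
proof -
  have "x \<le> t * Inf S" if "t \<in> T" for t
    using assms that by (intro le_mult_Inf) (auto simp: mult.commute)
  moreover have "Inf S \<ge> 0"
    using assms by (intro cInf_greatest) auto
  ultimately show ?thesis
    using assms by (intro le_mult_Inf) (auto simp: mult.commute)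
qed

context rk_space begin

definition mult_ideal :: "'x cfun set \<Rightarrow> bool" where
  "mult_ideal J \<longleftrightarrow> J \<subseteq> Collect multiplier \<and> 0 \<in> J \<and> (\<forall>f\<in>J. \<forall>g\<in>J. f + g \<in> J) \<and>
     (\<forall>\<psi>. multiplier \<psi> \<longrightarrow> (\<forall>f\<in>J. \<psi> * f \<in> J))"

lemma mult_ideal_scale:
  assumes "mult_ideal J" "f \<in> J"
  shows "cscale t f \<in> J"
proof -
  have "cscale t (indicator X) * f \<in> J"
    using assms multiplier_scale[OF multiplier_unit] unfolding mult_ideal_def by blast
  moreover have "multiplier f"
    using assms by (auto simp: mult_ideal_def)
  ultimately show ?thesis
    by (simp add: times_cscale multiplier_times_unit)
qed

lemma mult_ideal_diff:
  assumes "mult_ideal J" "f \<in> J" "g \<in> J"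
  shows "f - g \<in> J"
proof -
  have "f + cscale (- 1) g \<in> J"
    using assms mult_ideal_scale[OF assms(1,3), of "- 1"] unfolding mult_ideal_def by blast
  moreover have "f + cscale (- 1) g = f - g"
    by (auto simp: cscale_def fun_eq_iff)
  ultimately show ?thesis by simp
qed

lemma maximal_mult_ideal:
  assumes J0: "mult_ideal J0" "indicator X \<notin> J0"
  obtains J where "mult_ideal J" "indicator X \<notin> J" "J0 \<subseteq> J"
    "\<And>J'. \<lbrakk>mult_ideal J'; indicator X \<notin> J'; J \<subseteq> J'\<rbrakk> \<Longrightarrow> J' = J"
proof -
  define \<I> where "\<I> = {J. mult_ideal J \<and> indicator X \<notin> J \<and> J0 \<subseteq> J}"
  have "\<exists>M\<in>\<I>. \<forall>Y\<in>\<I>. M \<subseteq> Y \<longrightarrow> Y = M"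
  proof (rule subset_Zorn_nonempty)
    show "\<I> \<noteq> {}"
      using J0 by (auto simp: \<I>_def)
    fix C assume C: "C \<noteq> {}" "subset.chain \<I> C"
    have CI: "C \<subseteq> \<I>"
      using C by (simp add: subset.chain_def)
    have tot: "J \<subseteq> J' \<or> J' \<subseteq> J" if "J \<in> C" "J' \<in> C" for J J'
      using C that by (auto simp: subset.chain_def)
    have "mult_ideal (\<Union>C)"
      unfolding mult_ideal_def
    proof (intro conjI ballI allI impI)
      show "\<Union>C \<subseteq> Collect multiplier" "0 \<in> \<Union>C"
        using CI C(1) unfolding \<I>_def mult_ideal_def by blast+
    next
      fix f g assume "f \<in> \<Union>C" "g \<in> \<Union>C"
      then obtain J where "J \<in> C" "f \<in> J" "g \<in> J"
        using tot by blast
      then show "f + g \<in> \<Union>C"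
        using CI unfolding \<I>_def mult_ideal_def by blast
    next
      fix \<psi> f assume "multiplier \<psi>" "f \<in> \<Union>C"
      then show "\<psi> * f \<in> \<Union>C"
        using CI unfolding \<I>_def mult_ideal_def by blast
    qed
    then show "\<Union>C \<in> \<I>"
      using CI C(1) unfolding \<I>_def by blast
  qed
  then obtain J where "J \<in> \<I>" and max: "\<And>J'. \<lbrakk>J' \<in> \<I>; J \<subseteq> J'\<rbrakk> \<Longrightarrow> J' = J"
    by blast
  then show ?thesis
    by (intro that[of J]) (auto simp: \<I>_def)
qed

definition mult_bound :: "'x cfun \<Rightarrow> real \<Rightarrow> bool" where
  "mult_bound \<psi> C \<longleftrightarrow> multiplier \<psi> \<and> 0 \<le> C \<and> (\<forall>f\<in>H. nrm (\<psi> * f) \<le> C * nrm f)"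

text \<open>The Neumann series is summed vector by vector in \<open>H\<close>: the fixed point of
  \<open>g = f + (1 - \<eta>) g\<close> solves \<open>\<eta> g = f\<close>. Solving for
  \<open>kern x\<close>, which is nonzero at \<open>x\<close>, shows that \<open>\<eta>\<close> has
  no zeros, and then division by \<open>\<eta>\<close> maps \<open>H\<close> into itself.\<close>

lemma multiplier_near_unit_invertible:
  assumes kxx: "\<And>x. x \<in> X \<Longrightarrow> k x x \<noteq> 0"
    and \<eta>: "multiplier \<eta>" and bd: "mult_bound (indicator X - \<eta>) C" and C: "C < 1"
  obtains \<theta> where "multiplier \<theta>" "\<theta> * \<eta> = indicator X"
proof -
  let ?\<kappa> = "indicator X - \<eta>"
  have \<kappa>: "multiplier ?\<kappa>" and C0: "0 \<le> C" and \<kappa>C: "\<And>f. f \<in> H \<Longrightarrow> nrm (?\<kappa> * f) \<le> C * nrm f"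
    using bd by (auto simp: mult_bound_def)
  have solve: "\<exists>g\<in>H. \<eta> * g = f" if f: "f \<in> H" for f
  proof -
    define s where "s = rec_nat 0 (\<lambda>_ g. f + ?\<kappa> * g)"
    have s0: "s 0 = 0" and sS: "s (Suc n) = f + ?\<kappa> * s n" for n
      by (simp_all add: s_def)
    have s: "s n \<in> H" for n
    proof (induction n)
      case (Suc n)
      show ?case
        unfolding sS by (rule add_mem[OF f multiplier_mem[OF \<kappa> Suc]])
    qed (simp add: s0)
    have step: "nrm (s (Suc n) - s n) \<le> nrm f * C ^ n" for n
    proof (induction n)
      case (Suc n)
      have "s (Suc (Suc n)) - s (Suc n) = ?\<kappa> * (s (Suc n) - s n)"
        unfolding sS[of "Suc n"] sS[of n] by (simp only: right_diff_distrib) simp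
      then have "nrm (s (Suc (Suc n)) - s (Suc n)) \<le> C * nrm (s (Suc n) - s n)"
        using \<kappa>C s by simp
      also have "\<dots> \<le> C * (nrm f * C ^ n)"
        using Suc C0 by (rule mult_left_mono)
      finally show ?case
        unfolding power_Suc by (simp only: mult_ac)
    qed (simp add: sS s0)
    obtain g where g: "hconv s g"
      using geometric_hconv[OF s step C0 C] by blast
    have gH: "g \<in> H"
      using g by (simp add: hconv_def)
    have "\<eta> x * g x = f x" for x
    proof (cases "x \<in> X")
      case True
      have "(\<lambda>n. s (Suc n) x) \<longlonglongrightarrow> g x"
        using hconv_eval[OF g] by (rule LIMSEQ_Suc)
      moreover have "(\<lambda>n. s (Suc n) x) \<longlonglongrightarrow> f x + ?\<kappa> x * g x"
        unfolding sS plus_fun_apply times_fun_apply by (intro tendsto_intros hconv_eval[OF g])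
      ultimately have "g x = f x + ?\<kappa> x * g x"
        using LIMSEQ_unique by blast
      then show ?thesis
        using True by (simp add: algebra_simps)
    qed (use vanish[OF f] \<eta> in \<open>auto simp: multiplier_def\<close>)
    then have "\<eta> * g = f"
      by (auto simp: fun_eq_iff)
    with gH show ?thesis by blast
  qed
  have nz: "\<eta> x \<noteq> 0" if x: "x \<in> X" for x
  proof -
    obtain g where "\<eta> * g = kern x"
      using solve[OF kern_mem[OF x]] by blast
    then have "\<eta> x * g x = k x x"
      using x by (metis kern_def times_fun_apply)
    with kxx[OF x] show ?thesis by auto
  qed
  define \<theta> where "\<theta> x = (if x \<in> X then 1 / \<eta> x else 0)" for x
  have "\<theta> * f \<in> H" if f: "f \<in> H" for f
  proof -
    obtain g where g: "g \<in> H" "\<eta> * g = f"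
      using solve[OF f] by blast
    have "(\<theta> * f) x = g x" for x
      using g(2) nz[of x] vanish[OF g(1), of x] by (auto simp: \<theta>_def)
    then have "\<theta> * f = g"
      by (auto simp: fun_eq_iff)
    with g show ?thesis by simp
  qed
  then have "multiplier \<theta>"
    by (simp add: multiplier_def \<theta>_def)
  moreover have "\<theta> * \<eta> = indicator X"
    using nz \<eta> by (auto simp: \<theta>_def fun_eq_iff indicator_def)
  ultimately show ?thesis
    using that by blast
qed

lemma mult_bound_plus: "\<lbrakk>mult_bound \<psi> C; mult_bound \<phi> D\<rbrakk> \<Longrightarrow> mult_bound (\<psi> + \<phi>) (C + D)"
proof -
  assume *: "mult_bound \<psi> C" "mult_bound \<phi> D"
  have "nrm ((\<psi> + \<phi>) * f) \<le> (C + D) * nrm f" if "f \<in> H" for f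
    using nrm_triangle[of "\<psi> * f" "\<phi> * f"] * that unfolding distrib_right mult_bound_def
    by fastforce
  then show ?thesis
    using * by (simp add: mult_bound_def multiplier_add)
qed

lemma mult_bound_times: "\<lbrakk>mult_bound \<psi> C; mult_bound \<phi> D\<rbrakk> \<Longrightarrow> mult_bound (\<psi> * \<phi>) (C * D)"
proof -
  assume *: "mult_bound \<psi> C" "mult_bound \<phi> D"
  have "nrm (\<psi> * \<phi> * f) \<le> C * D * nrm f" if f: "f \<in> H" for f
  proof -
    have "nrm (\<psi> * (\<phi> * f)) \<le> C * nrm (\<phi> * f)"
      using * f by (simp add: mult_bound_def)
    also have "\<dots> \<le> C * (D * nrm f)"
      using * f by (intro mult_left_mono) (auto simp: mult_bound_def)
    finally show ?thesis
      by (simp add: mult.assoc)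
  qed
  then show ?thesis
    using * by (simp add: mult_bound_def multiplier_times)
qed

lemma mult_bound_scale: "mult_bound \<psi> C \<Longrightarrow> mult_bound (cscale t \<psi>) (cmod t * C)"
  by (auto simp: mult_bound_def multiplier_scale times_cscale mult_left_mono mult.assoc)

text \<open>The distance to \<open>J\<close> is a submultiplicative seminorm; the unit has distance
  at least 1, since an element of \<open>J\<close> closer to it would be invertible. Gelfand-Mazur
  gives a scalar \<open>c\<close> for which \<open>\<psi> - c\<close> has no inverse modulo
  \<open>J\<close>, so \<open>J\<close> and \<open>\<psi> - c\<close> generate a proper ideal, which
  is \<open>J\<close> by maximality.\<close>

lemma maximal_mult_ideal_codim_1:
  assumes kxx: "\<And>x. x \<in> X \<Longrightarrow> k x x \<noteq> 0"
    and J: "mult_ideal J" "indicator X \<notin> J"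
    and max: "\<And>J'. \<lbrakk>mult_ideal J'; indicator X \<notin> J'; J \<subseteq> J'\<rbrakk> \<Longrightarrow> J' = J"
    and \<psi>: "multiplier \<psi>"
  obtains c where "\<psi> - cscale c (indicator X) \<in> J"
proof -
  let ?e = "indicator X :: 'x cfun"
  have JM: "multiplier f" if "f \<in> J" for f
    using J that by (auto simp: mult_ideal_def)
  have Jadd: "f + g \<in> J" if "f \<in> J" "g \<in> J" for f g
    using J that by (auto simp: mult_ideal_def)
  have Jmult: "\<phi> * f \<in> J" if "multiplier \<phi>" "f \<in> J" for \<phi> f
    using J that by (auto simp: mult_ideal_def)
  \<comment> \<open>All operator bounds of elements of the coset of \<open>\<phi>\<close> modulo
    \<open>J\<close>; the quotient norm is their infimum.\<close>
  define B where "B \<phi> = {C. \<exists>\<eta>\<in>J. mult_bound (\<phi> - \<eta>) C}" for \<phi>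
  have B_ne: "B \<phi> \<noteq> {}" if \<phi>: "multiplier \<phi>" for \<phi>
  proof -
    obtain C where "C \<ge> 0" "\<And>f. f \<in> H \<Longrightarrow> nrm (\<phi> * f) \<le> C * nrm f"
      using multiplier_bounded[OF \<phi>] by blast
    then have "mult_bound (\<phi> - 0) C"
      using \<phi> by (simp add: mult_bound_def)
    then have "C \<in> B \<phi>"
      unfolding B_def using J(1) by (auto simp: mult_ideal_def intro!: bexI[of _ 0])
    then show ?thesis by blast
  qed
  have B0: "C \<ge> 0" if "C \<in> B \<phi>" for C \<phi>
    using that by (auto simp: B_def mult_bound_def)
  have Bbdd: "bdd_below (B \<phi>)" for \<phi>
    using B0 by (meson bdd_belowI)
  have B_plus: "C + D \<in> B (\<phi> + \<theta>)" if mem: "C \<in> B \<phi>" "D \<in> B \<theta>" for C D \<phi> \<theta>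
  proof -
    obtain \<eta> \<zeta> where "\<eta> \<in> J" "mult_bound (\<phi> - \<eta>) C" "\<zeta> \<in> J" "mult_bound (\<theta> - \<zeta>) D"
      using mem unfolding B_def by blast
    moreover from this have "mult_bound ((\<phi> - \<eta>) + (\<theta> - \<zeta>)) (C + D)"
      by (intro mult_bound_plus)
    moreover have "(\<phi> - \<eta>) + (\<theta> - \<zeta>) = (\<phi> + \<theta>) - (\<eta> + \<zeta>)"
      by simp
    ultimately show ?thesis
      unfolding B_def using Jadd by force
  qed
  have B_times: "C * D \<in> B (\<phi> * \<theta>)"
    if mem: "C \<in> B \<phi>" "D \<in> B \<theta>" and "multiplier \<phi>" "multiplier \<theta>" for C D \<phi> \<theta>
  proof -
    obtain \<eta> \<zeta> where *: "\<eta> \<in> J" "mult_bound (\<phi> - \<eta>) C" "\<zeta> \<in> J" "mult_bound (\<theta> - \<zeta>) D"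
      using mem unfolding B_def by blast
    have "mult_bound ((\<phi> - \<eta>) * (\<theta> - \<zeta>)) (C * D)"
      using * by (intro mult_bound_times)
    moreover have "(\<phi> - \<eta>) * (\<theta> - \<zeta>) = \<phi> * \<theta> - (\<phi> * \<zeta> + (\<theta> - \<zeta>) * \<eta>)"
      by (simp add: algebra_simps)
    moreover have "\<phi> * \<zeta> + (\<theta> - \<zeta>) * \<eta> \<in> J"
      using * that JM by (intro Jadd Jmult multiplier_diff) auto
    ultimately show ?thesis
      unfolding B_def by force
  qed
  have B_scale: "cmod t * C \<in> B (cscale t \<phi>)" if mem: "C \<in> B \<phi>" for C t \<phi>
  proof -
    obtain \<eta> where *: "\<eta> \<in> J" "mult_bound (\<phi> - \<eta>) C"
      using mem unfolding B_def by blast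
    have "mult_bound (cscale t (\<phi> - \<eta>)) (cmod t * C)"
      using * by (intro mult_bound_scale)
    then show ?thesis
      using * mult_ideal_scale[OF J(1)] by (auto simp: B_def cfun.scale_right_diff_distrib)
  qed
  \<comment> \<open>Functions are arbitrary off the domain and become multipliers after
    multiplication by \<open>?e\<close>; thus constant functions can act as scalars.\<close>
  define A where "A = {f. multiplier (?e * f)}"
  define q where "q f = Inf (B (?e * f))" for f
  have q_le: "q f \<le> C" if "C \<in> B (?e * f)" for f C
    unfolding q_def using that Bbdd by (rule cInf_lower)
  have eK: "?e * ((\<lambda>_. c) * f) = cscale c (?e * f)" for c and f :: "'x cfun"
    by (auto simp: cscale_def fun_eq_iff)
  have ee: "?e * (f * g) = (?e * f) * (?e * g)" for f g :: "'x cfun"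
    by (auto simp: fun_eq_iff indicator_def)
  have e1: "?e * 1 = ?e"
    by simp
  have scale_le: "q ((\<lambda>_. c) * f) \<le> cmod c * q f" if "f \<in> A" for c f
  proof -
    have "q ((\<lambda>_. c) * f) \<le> cmod c * C" if "C \<in> B (?e * f)" for C
      by (rule q_le) (simp only: eK B_scale[OF that])
    then show ?thesis
      unfolding q_def[of f] using that B_ne by (intro le_mult_Inf) (auto simp: A_def)
  qed
  have algebra: "seminormed_function_algebra A q"
  proof
    show "(\<lambda>_. c) \<in> A" for c
    proof -
      have "?e * (\<lambda>_. c) = cscale c ?e"
        by (auto simp: cscale_def fun_eq_iff)
      then show ?thesis
        by (simp add: A_def multiplier_scale multiplier_unit)
    qed
  next
    fix f g assume fg: "f \<in> A" "g \<in> A"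
    show "f + g \<in> A" "f * g \<in> A"
      using fg multiplier_add multiplier_times by (simp_all add: A_def distrib_left ee)
    show "q (f + g) \<le> q f + q g"
      unfolding q_def[of f] q_def[of g] using fg B_ne B_plus
      by (intro le_Inf_plus q_le) (auto simp: A_def distrib_left)
    show "q (f * g) \<le> q f * q g"
      unfolding q_def[of f] q_def[of g] using fg B_ne B_times B0
      by (intro le_Inf_times q_le) (auto simp: A_def ee)
  next
    fix f c assume f: "f \<in> A"
    have "cmod c * q f \<le> q ((\<lambda>_. c) * f)"
    proof (cases "c = 0")
      case True
      have "q ((\<lambda>_. c) * f) \<ge> 0"
        unfolding q_def using f B_ne B0 multiplier_scale
        by (intro cInf_greatest) (auto simp: A_def eK)
      with True show ?thesis by simp
    next
      case False
      have "(\<lambda>_. c) * f \<in> A"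
        using f by (simp only: A_def mem_Collect_eq eK multiplier_scale)
      from scale_le[OF this, of "1 / c"]
      have "q ((\<lambda>_. 1 / c) * ((\<lambda>_. c) * f)) \<le> q ((\<lambda>_. c) * f) / cmod c"
        by (simp add: norm_divide)
      moreover have "(\<lambda>_. 1 / c) * ((\<lambda>_. c) * f) = f"
        using False by (auto simp: fun_eq_iff)
      ultimately show ?thesis
        using False by (simp add: field_simps)
    qed
    then show "q ((\<lambda>_. c) * f) = cmod c * q f"
      using scale_le[OF f, of c] by simp
  qed
  have "q 1 \<ge> 1"
    unfolding q_def e1
  proof (rule cInf_greatest[OF B_ne[OF multiplier_unit]], rule ccontr)
    fix C assume "C \<in> B ?e" "\<not> 1 \<le> C"
    then obtain \<eta> where \<eta>: "\<eta> \<in> J" "mult_bound (?e - \<eta>) C" "C < 1"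
      by (auto simp: B_def)
    obtain \<theta> where "multiplier \<theta>" "\<theta> * \<eta> = ?e"
      using multiplier_near_unit_invertible[OF kxx JM[OF \<eta>(1)] \<eta>(2,3)] by blast
    then show False
      using Jmult[OF _ \<eta>(1)] J(2) by metis
  qed
  then have q1: "q 1 \<noteq> 0" by simp
  have "\<psi> \<in> A"
    using \<psi> by (simp add: A_def multiplier_times_unit)
  obtain c where c: "\<And>\<theta>. \<theta> \<in> A \<Longrightarrow> q (((\<lambda>_. c) - \<psi>) * \<theta> - 1) \<noteq> 0"
    using seminormed_function_algebra.Gelfand_Mazur[OF algebra \<open>\<psi> \<in> A\<close> q1] by blast
  let ?\<phi> = "\<psi> - cscale c ?e"
  have \<phi>: "multiplier ?\<phi>"
    using \<psi> by (intro multiplier_diff multiplier_scale multiplier_unit)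
  define J' where "J' = {f + ?\<phi> * \<theta> | f \<theta>. f \<in> J \<and> multiplier \<theta>}"
  have "mult_ideal J'"
    unfolding mult_ideal_def
  proof (intro conjI ballI allI impI)
    show "J' \<subseteq> Collect multiplier"
      unfolding J'_def using \<phi> JM multiplier_add multiplier_times by blast
    have "0 + ?\<phi> * 0 \<in> J'"
      unfolding J'_def using J by (auto simp: mult_ideal_def intro!: exI[of _ 0])
    then show "0 \<in> J'" by simp
  next
    fix f g assume "f \<in> J'" "g \<in> J'"
    then obtain f' g' \<theta> \<zeta> where *: "f' \<in> J" "g' \<in> J" "multiplier \<theta>" "multiplier \<zeta>"
      "f = f' + ?\<phi> * \<theta>" "g = g' + ?\<phi> * \<zeta>"
      by (auto simp: J'_def)
    then have "f + g = (f' + g') + ?\<phi> * (\<theta> + \<zeta>)"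
      by (simp only: distrib_left add_ac)
    with * show "f + g \<in> J'"
      unfolding J'_def using Jadd multiplier_add by blast
  next
    fix h f assume "multiplier h" "f \<in> J'"
    then obtain f' \<theta> where *: "f' \<in> J" "multiplier \<theta>" "f = f' + ?\<phi> * \<theta>"
      by (auto simp: J'_def)
    then have "h * f = h * f' + ?\<phi> * (h * \<theta>)"
      by (simp only: distrib_left mult_ac)
    with * \<open>multiplier h\<close> show "h * f \<in> J'"
      unfolding J'_def using Jmult multiplier_times by blast
  qed
  moreover have "J \<subseteq> J'"
  proof
    fix f assume "f \<in> J"
    then have "f + ?\<phi> * 0 \<in> J'"
      unfolding J'_def using multiplier_zero by blast
    then show "f \<in> J'" by simp
  qed
  moreover have "?e \<notin> J'"
  proof
    assume "?e \<in> J'"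
    then obtain f \<theta> where f: "f \<in> J" and \<theta>: "multiplier \<theta>" and e: "?e = f + ?\<phi> * \<theta>"
      unfolding J'_def by blast
    \<comment> \<open>The sign passes from \<open>\<psi> - c\<close>, which generates
      \<open>J'\<close>, to \<open>c - \<psi>\<close>, for which Gelfand-Mazur excludes an
      inverse.\<close>
    let ?\<theta>' = "cscale (- 1) \<theta>"
    have \<theta>': "multiplier ?\<theta>'"
      using \<theta> by (rule multiplier_scale)
    then have "?\<theta>' \<in> A"
      by (simp only: A_def mem_Collect_eq multiplier_times_unit)
    have eq: "?e * (((\<lambda>_. c) - \<psi>) * ?\<theta>' - 1) = cscale (- 1) f"
    proof
      fix x
      have "?e x = f x + (\<psi> x - c * ?e x) * \<theta> x"
        using fun_cong[OF e, of x] by (simp add: cscale_def)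
      moreover have "x \<notin> X \<Longrightarrow> f x = 0"
        using JM[OF f] by (simp add: multiplier_def)
      ultimately show "(?e * (((\<lambda>_. c) - \<psi>) * ?\<theta>' - 1)) x = cscale (- 1) f x"
        by (cases "x \<in> X") (simp_all add: cscale_def algebra_simps)
    qed
    have B0f: "0 \<in> B (cscale (- 1) f)"
    proof -
      have "mult_bound (cscale (- 1) f - cscale (- 1) f) 0"
        by (simp add: mult_bound_def flip: zero_fun_def)
      then show ?thesis
        unfolding B_def using mult_ideal_scale[OF J(1) f] by blast
    qed
    then have "q (((\<lambda>_. c) - \<psi>) * ?\<theta>' - 1) \<le> 0"
      by (intro q_le) (simp only: eq)
    moreover have "q (((\<lambda>_. c) - \<psi>) * ?\<theta>' - 1) \<ge> 0"
      unfolding q_def eq using B0 B0f by (intro cInf_greatest) auto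
    ultimately show False
      using c[OF \<open>?\<theta>' \<in> A\<close>] by simp
  qed
  ultimately have "J' = J"
    using max by blast
  moreover have "0 + ?\<phi> * ?e \<in> J'"
  proof -
    have "0 \<in> J"
      using J by (simp add: mult_ideal_def)
    then show ?thesis
      unfolding J'_def using multiplier_unit by blast
  qed
  moreover have "0 + ?\<phi> * ?e = ?\<phi>"
    using multiplier_times_unit[OF \<phi>] by (simp add: mult.commute)
  ultimately show ?thesis
    using that by simp
qed

text \<open>\<open>\<omega> \<psi>\<close> is the unique scalar congruent to \<open>\<psi>\<close>
  modulo a maximal ideal containing \<open>J0\<close>; uniqueness turns the ideal laws into the
  character laws.\<close>

lemma mult_ideal_character:
  assumes kxx: "\<And>x. x \<in> X \<Longrightarrow> k x x \<noteq> 0"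
    and J0: "mult_ideal J0" "indicator X \<notin> J0"
  obtains \<omega> where "\<omega> (indicator X) = 1" "\<And>\<psi>. \<psi> \<in> J0 \<Longrightarrow> \<omega> \<psi> = 0"
    "\<And>\<psi> \<phi>. \<lbrakk>multiplier \<psi>; multiplier \<phi>\<rbrakk> \<Longrightarrow> \<omega> (\<psi> + \<phi>) = \<omega> \<psi> + \<omega> \<phi>"
    "\<And>\<psi> \<phi>. \<lbrakk>multiplier \<psi>; multiplier \<phi>\<rbrakk> \<Longrightarrow> \<omega> (\<psi> * \<phi>) = \<omega> \<psi> * \<omega> \<phi>"
    "\<And>t \<psi>. multiplier \<psi> \<Longrightarrow> \<omega> (cscale t \<psi>) = t * \<omega> \<psi>"
proof -
  let ?e = "indicator X :: 'x cfun"
  obtain J where J: "mult_ideal J" "?e \<notin> J" "J0 \<subseteq> J"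
    and max: "\<And>J'. \<lbrakk>mult_ideal J'; ?e \<notin> J'; J \<subseteq> J'\<rbrakk> \<Longrightarrow> J' = J"
    using maximal_mult_ideal[OF J0] by blast
  have "\<exists>c. multiplier \<psi> \<longrightarrow> \<psi> - cscale c ?e \<in> J" for \<psi>
    using maximal_mult_ideal_codim_1[OF kxx J(1,2) max] by metis
  then obtain \<omega> where \<omega>: "\<And>\<psi>. multiplier \<psi> \<Longrightarrow> \<psi> - cscale (\<omega> \<psi>) ?e \<in> J"
    by metis
  have uniq: "\<omega> \<psi> = c" if "multiplier \<psi>" "\<psi> - cscale c ?e \<in> J" for \<psi> c
  proof (rule ccontr)
    assume ne: "\<omega> \<psi> \<noteq> c"
    have "(\<psi> - cscale c ?e) - (\<psi> - cscale (\<omega> \<psi>) ?e) \<in> J"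
      by (rule mult_ideal_diff[OF J(1) that(2) \<omega>[OF that(1)]])
    then have "cscale (1 / (\<omega> \<psi> - c)) ((\<psi> - cscale c ?e) - (\<psi> - cscale (\<omega> \<psi>) ?e)) \<in> J"
      by (rule mult_ideal_scale[OF J(1)])
    moreover have "cscale (1 / (\<omega> \<psi> - c)) ((\<psi> - cscale c ?e) - (\<psi> - cscale (\<omega> \<psi>) ?e)) = ?e"
      using ne by (auto simp: cscale_def fun_eq_iff field_simps)
    ultimately show False
      using J(2) by simp
  qed
  have Jadd: "f + g \<in> J" if "f \<in> J" "g \<in> J" for f g
    using J that by (auto simp: mult_ideal_def)
  show ?thesis
  proof (rule that)
    have "?e - cscale 1 ?e = 0" by simp
    then show "\<omega> ?e = 1"
      using J by (intro uniq multiplier_unit) (auto simp: mult_ideal_def)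
  next
    fix \<psi> assume "\<psi> \<in> J0"
    then show "\<omega> \<psi> = 0"
      using J by (intro uniq) (auto simp: mult_ideal_def)
  next
    fix \<psi> \<phi> assume *: "multiplier \<psi>" "multiplier \<phi>"
    have "(\<psi> - cscale (\<omega> \<psi>) ?e) + (\<phi> - cscale (\<omega> \<phi>) ?e) \<in> J"
      using * \<omega> by (intro Jadd) auto
    also have "(\<psi> - cscale (\<omega> \<psi>) ?e) + (\<phi> - cscale (\<omega> \<phi>) ?e) = (\<psi> + \<phi>) - cscale (\<omega> \<psi> + \<omega> \<phi>) ?e"
      by (auto simp: cscale_def fun_eq_iff algebra_simps)
    finally show "\<omega> (\<psi> + \<phi>) = \<omega> \<psi> + \<omega> \<phi>"
      using * by (intro uniq multiplier_add)
    have "\<phi> * (\<psi> - cscale (\<omega> \<psi>) ?e) + cscale (\<omega> \<psi>) (\<phi> - cscale (\<omega> \<phi>) ?e) \<in> J"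
      using * \<omega> J(1) by (intro Jadd mult_ideal_scale) (auto simp: mult_ideal_def)
    also have "\<phi> * (\<psi> - cscale (\<omega> \<psi>) ?e) + cscale (\<omega> \<psi>) (\<phi> - cscale (\<omega> \<phi>) ?e)
        = \<psi> * \<phi> - cscale (\<omega> \<psi> * \<omega> \<phi>) ?e"
    proof
      fix x
      show "(\<phi> * (\<psi> - cscale (\<omega> \<psi>) ?e) + cscale (\<omega> \<psi>) (\<phi> - cscale (\<omega> \<phi>) ?e)) x
          = (\<psi> * \<phi> - cscale (\<omega> \<psi> * \<omega> \<phi>) ?e) x"
        using * by (cases "x \<in> X") (auto simp: cscale_def multiplier_def algebra_simps)
    qed
    finally show "\<omega> (\<psi> * \<phi>) = \<omega> \<psi> * \<omega> \<phi>"
      using * by (intro uniq multiplier_times)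
  next
    fix t \<psi> assume *: "multiplier \<psi>"
    have "cscale t (\<psi> - cscale (\<omega> \<psi>) ?e) \<in> J"
      using * \<omega> J(1) by (intro mult_ideal_scale)
    also have "cscale t (\<psi> - cscale (\<omega> \<psi>) ?e) = cscale t \<psi> - cscale (t * \<omega> \<psi>) ?e"
      by (auto simp: cscale_def fun_eq_iff algebra_simps)
    finally show "\<omega> (cscale t \<psi>) = t * \<omega> \<psi>"
      using * by (intro uniq multiplier_scale)
  qed
qed

end

section \<open>Quotients and their supports\<close>

lemma cpolynomial_monomial: "cpolynomial (\<lambda>z :: complex ^ 'd. c * (\<Prod>j\<in>UNIV. z $ j ^ \<alpha> j))"
  unfolding cpolynomial_def by (intro exI[of _ "{\<alpha>}"] exI[of _ "\<lambda>_. c"]) simp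

lemma cpolynomial_add:
  fixes p q :: "(complex ^ 'd) cfun"
  assumes "cpolynomial p" "cpolynomial q"
  shows "cpolynomial (\<lambda>z. p z + q z)"
proof -
  obtain I c J d where *: "finite I" "p = (\<lambda>z. \<Sum>\<alpha>\<in>I. c \<alpha> * (\<Prod>j\<in>UNIV. z $ j ^ \<alpha> j))"
    "finite J" "q = (\<lambda>z. \<Sum>\<alpha>\<in>J. d \<alpha> * (\<Prod>j\<in>UNIV. z $ j ^ \<alpha> j))"
    using assms by (auto simp: cpolynomial_def)
  let ?c = "\<lambda>\<alpha>. (if \<alpha> \<in> I then c \<alpha> else 0) + (if \<alpha> \<in> J then d \<alpha> else 0)"
  have "(\<lambda>z. p z + q z) = (\<lambda>z. \<Sum>\<alpha>\<in>I \<union> J. ?c \<alpha> * (\<Prod>j\<in>UNIV. z $ j ^ \<alpha> j))"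
  proof
    fix z :: "complex ^ 'd"
    have "p z = (\<Sum>\<alpha>\<in>I \<union> J. (if \<alpha> \<in> I then c \<alpha> else 0) * (\<Prod>j\<in>UNIV. z $ j ^ \<alpha> j))"
      unfolding *(2) using * by (intro sum.mono_neutral_cong_left) auto
    moreover have "q z = (\<Sum>\<alpha>\<in>I \<union> J. (if \<alpha> \<in> J then d \<alpha> else 0) * (\<Prod>j\<in>UNIV. z $ j ^ \<alpha> j))"
      unfolding *(4) using * by (intro sum.mono_neutral_cong_left) auto
    ultimately show "p z + q z = (\<Sum>\<alpha>\<in>I \<union> J. ?c \<alpha> * (\<Prod>j\<in>UNIV. z $ j ^ \<alpha> j))"
      by (simp only: distrib_right sum.distrib)
  qed
  then show ?thesis
    unfolding cpolynomial_def using * by (intro exI[of _ "I \<union> J"] exI[of _ ?c]) auto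
qed

lemma cpolynomial_const: "cpolynomial (\<lambda>z :: complex ^ 'd. c)"
  using cpolynomial_monomial[of c "\<lambda>_. 0"] by simp

lemma cpolynomial_coord: "cpolynomial (\<lambda>z :: complex ^ 'd. z $ i)"
proof -
  have "(\<lambda>z :: complex ^ 'd. 1 * (\<Prod>j\<in>UNIV. z $ j ^ (if j = i then 1 else 0))) = (\<lambda>z. z $ i)"
  proof
    fix z :: "complex ^ 'd"
    have "(\<Prod>j\<in>UNIV. z $ j ^ (if j = i then 1 else 0)) = (\<Prod>j\<in>UNIV. if j = i then z $ j else 1)"
      by (intro prod.cong) auto
    then show "1 * (\<Prod>j\<in>UNIV. z $ j ^ (if j = i then 1 else 0)) = z $ i"
      by simp
  qed
  with cpolynomial_monomial[of 1 "\<lambda>j. if j = i then 1 else 0"] show ?thesis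
    by simp
qed

lemma cpolynomial_sum:
  "(\<And>i. i \<in> I \<Longrightarrow> cpolynomial (p i)) \<Longrightarrow> cpolynomial (\<lambda>z. \<Sum>i\<in>I. p i z)"
  by (induction I rule: infinite_finite_induct) (auto intro: cpolynomial_const cpolynomial_add)

lemma cpolynomial_mult:
  fixes p q :: "(complex ^ 'd) cfun"
  assumes "cpolynomial p" "cpolynomial q"
  shows "cpolynomial (\<lambda>z. p z * q z)"
proof -
  obtain I c J d where *: "p = (\<lambda>z. \<Sum>\<alpha>\<in>I. c \<alpha> * (\<Prod>j\<in>UNIV. z $ j ^ \<alpha> j))"
    "q = (\<lambda>z. \<Sum>\<alpha>\<in>J. d \<alpha> * (\<Prod>j\<in>UNIV. z $ j ^ \<alpha> j))"
    using assms by (auto simp: cpolynomial_def)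
  have "(\<lambda>z. p z * q z) = (\<lambda>z. \<Sum>\<alpha>\<in>I. \<Sum>\<beta>\<in>J. (c \<alpha> * d \<beta>) * (\<Prod>j\<in>UNIV. z $ j ^ (\<alpha> j + \<beta> j)))"
    by (simp add: * sum_product power_add prod.distrib mult_ac)
  then show ?thesis
    by (simp only:) (intro cpolynomial_sum cpolynomial_monomial)
qed

lemma cpolynomial_power: "cpolynomial p \<Longrightarrow> cpolynomial (\<lambda>z. p z ^ n)"
  by (induction n) (auto intro: cpolynomial_const cpolynomial_mult)

lemma cpolynomial_diff:
  "\<lbrakk>cpolynomial p; cpolynomial q\<rbrakk> \<Longrightarrow> cpolynomial (\<lambda>z. p z - q z)"
  using cpolynomial_add[OF _ cpolynomial_mult[OF cpolynomial_const[of "- 1"]], of p q] by simp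

text \<open>Generation by constants and coordinates under sums and products fits characters and
  compressions, which respect exactly these operations.\<close>

lemma cpolynomial_induct [consumes 1, case_names const coord add mult]:
  fixes p :: "(complex ^ 'd) cfun"
  assumes "cpolynomial p" and const: "\<And>c. P (\<lambda>_. c)" and coord: "\<And>j. P (\<lambda>z. z $ j)"
    and add: "\<And>p q. \<lbrakk>cpolynomial p; cpolynomial q; P p; P q\<rbrakk> \<Longrightarrow> P (\<lambda>z. p z + q z)"
    and mult: "\<And>p q. \<lbrakk>cpolynomial p; cpolynomial q; P p; P q\<rbrakk> \<Longrightarrow> P (\<lambda>z. p z * q z)"
  shows "P p"
proof -
  have power: "cpolynomial (\<lambda>z :: complex ^ 'd. z $ j ^ n) \<and> P (\<lambda>z. z $ j ^ n)" for j n
    by (induction n) (auto intro: const cpolynomial_const cpolynomial_coord coord cpolynomial_mult mult)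
  have prod: "cpolynomial (\<lambda>z :: complex ^ 'd. \<Prod>j\<in>S. z $ j ^ \<alpha> j) \<and> P (\<lambda>z. \<Prod>j\<in>S. z $ j ^ \<alpha> j)"
    if "finite S" for S \<alpha>
    using that
  proof (induction S)
    case (insert i S)
    then show ?case
      using power[of i "\<alpha> i"] by (auto intro: cpolynomial_mult mult)
  qed (auto intro: const cpolynomial_const)
  obtain I c where *: "finite I" "p = (\<lambda>z. \<Sum>\<alpha>\<in>I. c \<alpha> * (\<Prod>j\<in>UNIV. z $ j ^ \<alpha> j))"
    using assms(1) by (auto simp: cpolynomial_def)
  have "P (\<lambda>z. \<Sum>\<alpha>\<in>I. c \<alpha> * (\<Prod>j\<in>UNIV. z $ j ^ \<alpha> j))"
    using *(1)
  proof (induction I)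
    case (insert \<beta> I)
    have "P (\<lambda>z. c \<beta> * (\<Prod>j\<in>UNIV. z $ j ^ \<beta> j))"
      using prod[of UNIV \<beta>] by (intro mult const cpolynomial_const) auto
    with insert have "P (\<lambda>z. c \<beta> * (\<Prod>j\<in>UNIV. z $ j ^ \<beta> j) + (\<Sum>\<alpha>\<in>I. c \<alpha> * (\<Prod>j\<in>UNIV. z $ j ^ \<alpha> j)))"
      by (intro add cpolynomial_sum cpolynomial_monomial)
    then show ?case
      using insert by simp
  qed (simp add: const)
  with * show ?thesis by simp
qed

lemma cpolynomial_continuous: "cpolynomial p \<Longrightarrow> continuous_on S p"
  by (induction p rule: cpolynomial_induct) (auto intro!: continuous_intros)

lemma on_ball_add: "on_ball (\<lambda>z. p z + q z) = on_ball p + on_ball q"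
  and on_ball_diff: "on_ball (\<lambda>z. p z - q z) = on_ball p - on_ball q"
  and on_ball_mult: "on_ball (\<lambda>z. p z * q z) = on_ball p * on_ball q"
  and on_ball_const: "on_ball (\<lambda>z. c) = cscale c (indicator (ball 0 1))"
  and on_ball_cmult: "on_ball (\<lambda>z. c * p z) = cscale c (on_ball p)"
  by (auto simp: on_ball_def cscale_def fun_eq_iff indicator_def)

section \<open>The coinvariant space and compressions to it\<close>

locale cnp_quotient = maximal_cnp_space a b H ip
  for a b :: "nat \<Rightarrow> real" and H :: "(complex ^ 'd) cfun set"
    and ip :: "(complex ^ 'd) cfun \<Rightarrow> (complex ^ 'd) cfun \<Rightarrow> complex" +
  fixes \<aa> :: "(complex ^ 'd) cfun set"
  assumes ideal: "multiplier_ideal H \<aa>"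
begin

lemma multipliers_eq: "multipliers H = Collect multiplier"
  by (auto simp: multipliers_def multiplier_def)

lemma multiplier_on_ball: "cpolynomial p \<Longrightarrow> multiplier (on_ball p)"
proof (induction p rule: cpolynomial_induct)
  case (coord j)
  then show ?case
    using multiplier_coord by (simp add: coord_def)
next
  case (add p q)
  show ?case
    unfolding on_ball_add by (rule multiplier_add[OF add(3,4)])
next
  case (mult p q)
  show ?case
    unfolding on_ball_mult by (rule multiplier_times[OF mult(3,4)])
qed (simp add: on_ball_const multiplier_scale multiplier_unit)

abbreviation "N \<equiv> quotient_space H ip \<aa>"

lemma ideal_multiplier: "\<phi> \<in> \<aa> \<Longrightarrow> multiplier \<phi>"
  using ideal by (auto simp: multiplier_ideal_def multipliers_eq)

text \<open>Orthogonality to the generators passes to the span by linearity and to its closure by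
  Cauchy-Schwarz.\<close>

lemma N_iff: "g \<in> N \<longleftrightarrow> g \<in> H \<and> (\<forall>\<phi>\<in>\<aa>. \<forall>f\<in>H. ip g (\<phi> * f) = 0)"
proof -
  let ?S = "{mult_op H \<phi> f | \<phi> f. \<phi> \<in> \<aa> \<and> f \<in> H}"
  have S: "?S = {\<phi> * f | \<phi> f. \<phi> \<in> \<aa> \<and> f \<in> H}"
    by (auto simp: mult_op_def)
  have gen: "\<phi> * f \<in> closed_span H ip ?S" if "\<phi> \<in> \<aa>" "f \<in> H" for \<phi> f
  proof -
    have "\<phi> * f \<in> cfun.span ?S"
      unfolding S using that by (intro cfun.span_base) auto
    then show ?thesis
      unfolding closed_span_def using that ideal_multiplier by (auto intro!: bexI[of _ "\<phi> * f"])
  qed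
  have orth: "ip g h = 0"
    if g: "g \<in> H" "\<forall>\<phi>\<in>\<aa>. \<forall>f\<in>H. ip g (\<phi> * f) = 0" and h: "h \<in> closed_span H ip ?S" for g h
  proof -
    have sp: "u \<in> H \<and> ip g u = 0" if "u \<in> cfun.span ?S" for u
      using that unfolding S
    proof (induction rule: cfun.span_induct_alt)
      case (step c x y)
      then have x: "x \<in> H" "ip g x = 0" and y: "y \<in> H" "ip g y = 0"
        using g ideal_multiplier by auto
      have "ip g (cscale c x + y) = 0"
        unfolding ip_add_right[OF scale_mem[OF x(1)] y(1) g(1)] ip_scale_right[OF g(1) x(1)]
        using x y by simp
      then show ?case
        using add_mem[OF scale_mem[OF x(1)] y(1)] by (rule conjI[rotated])
    next
      case base
      show ?case
        by (rule conjI[OF zero_mem ip_zero_right[OF g(1)]])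
    qed
    have hH: "h \<in> H"
      using h by (simp add: closed_span_def)
    have "cmod (ip g h) \<le> 0 + e" if "e > 0" for e
    proof -
      define d where "d = e / (nrm g + 1)"
      have "d > 0"
        using that g by (simp add: d_def add_nonneg_pos)
      then obtain u where u: "u \<in> cfun.span ?S" "nrm (h - u) < d"
        using h by (auto simp: closed_span_def)
      have "ip g h = ip g (h - u)"
        using sp[OF u(1)] g hH by (simp add: ip_diff_right)
      also have "cmod \<dots> \<le> nrm g * nrm (h - u)"
        using sp[OF u(1)] g hH by (simp add: Cauchy_Schwarz)
      also have "\<dots> \<le> nrm g * d"
        using u(2) g by (intro mult_left_mono) auto
      also have "\<dots> \<le> (nrm g + 1) * d"
        using \<open>d > 0\<close> by (intro mult_right_mono) auto
      also have "\<dots> = e"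
        using nrm_nonneg[OF g(1)] by (simp add: d_def)
      finally show ?thesis by simp
    qed
    then show ?thesis
      using field_le_epsilon[of "cmod (ip g h)" 0] by simp
  qed
  show ?thesis
    unfolding quotient_space_def orth_compl_def using gen orth by blast
qed

lemma N_H: "g \<in> N \<Longrightarrow> g \<in> H"
  by (simp add: N_iff)

lemma subspace_N: "cfun.subspace N"
proof (rule cfun.subspaceI)
  show "0 \<in> N"
    using ideal_multiplier by (simp add: N_iff)
qed (use ideal_multiplier in \<open>auto simp: N_iff ip_add_left ip_scale_left\<close>)

lemma N_zero [simp]: "0 \<in> N"
  and N_add [simp]: "\<lbrakk>f \<in> N; g \<in> N\<rbrakk> \<Longrightarrow> f + g \<in> N"
  and N_diff [simp]: "\<lbrakk>f \<in> N; g \<in> N\<rbrakk> \<Longrightarrow> f - g \<in> N"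
  and N_scale [simp]: "f \<in> N \<Longrightarrow> cscale c f \<in> N"
  using subspace_N cfun.subspace_0 cfun.subspace_add cfun.subspace_diff cfun.subspace_scale by blast+

lemma N_closed:
  assumes "\<And>n. s n \<in> N" "hconv s g"
  shows "g \<in> N"
  unfolding N_iff
proof (intro conjI ballI)
  show "g \<in> H"
    using assms by (simp add: hconv_def)
  fix \<phi> f assume "\<phi> \<in> \<aa>" "f \<in> H"
  then have "(\<lambda>n. ip (s n) (\<phi> * f)) \<longlonglongrightarrow> ip g (\<phi> * f)"
    using assms ideal_multiplier by (intro hconv_ip hconv_const) auto
  then have "(\<lambda>n. 0) \<longlonglongrightarrow> ip g (\<phi> * f)"
    using assms \<open>\<phi> \<in> \<aa>\<close> \<open>f \<in> H\<close> by (simp add: N_iff)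
  then show "ip g (\<phi> * f) = 0"
    by (simp add: LIMSEQ_const_iff)
qed

text \<open>Coinvariance: in the pairing with \<open>\<phi> * f\<close> the multiplier
  \<open>\<psi>\<close> moves into the ideal as \<open>\<psi> * \<phi>\<close>. So adjoints restrict
  to \<open>N\<close> without a projection, and many estimates are made for them instead of for
  compressions.\<close>

lemma N_adj [simp]:
  assumes \<psi>: "multiplier \<psi>" and g: "g \<in> N"
  shows "adj \<psi> g \<in> N"
  unfolding N_iff
proof (intro conjI ballI)
  fix \<phi> f assume *: "\<phi> \<in> \<aa>" "f \<in> H"
  have "\<psi> * \<phi> \<in> \<aa>"
    using ideal \<psi> * by (auto simp: multiplier_ideal_def multipliers_eq)
  then have "ip g (\<psi> * \<phi> * f) = 0"
    using g * by (simp add: N_iff)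
  then show "ip (adj \<psi> g) (\<phi> * f) = 0"
    using \<psi> g * ideal_multiplier by (simp add: ip_adj_left N_H mult.assoc)
qed (use assms N_H in auto)

lemma N_L [simp]: "g \<in> N \<Longrightarrow> L j g \<in> N"
  by (simp add: multiplier_coord)

lemma N_eqI: "\<lbrakk>f \<in> N; g \<in> N; \<And>v. v \<in> N \<Longrightarrow> ip f v = ip g v\<rbrakk> \<Longrightarrow> f = g"
  by (metis N_H N_diff eq_iff_diff_eq_0 ip_diff_left ip_self nrm_eq_0_iff of_real_eq_0_iff zero_eq_power2)

lemma orth_proj:
  assumes h: "h \<in> H"
  shows "orth_proj ip N h \<in> N \<and> (\<forall>v\<in>N. ip (h - orth_proj ip N h) v = 0)"
proof -
  obtain s p where s: "\<And>n. s n \<in> N" "hconv s p" and p: "\<And>v. v \<in> N \<Longrightarrow> ip v h = ip v p"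
    by (rule Riesz_parametrized[OF subspace_N, of "\<lambda>f. f" "\<lambda>v. ip v h" "nrm h"])
      (use h in \<open>auto simp: N_H ip_add_left ip_scale_left Cauchy_Schwarz mult.commute[of "nrm h"]\<close>)
  have pN: "p \<in> N"
    using s N_closed by blast
  have "ip (h - p) v = 0" if "v \<in> N" for v
    using p[OF that] that h pN by (metis N_H diff_self ip_commute ip_diff_left)
  then have P: "p \<in> N \<and> (\<forall>v\<in>N. ip (h - p) v = 0)"
    using pN by blast
  show ?thesis
    unfolding orth_proj_def
  proof (rule theI[of "\<lambda>p. p \<in> N \<and> (\<forall>v\<in>N. ip (h - p) v = 0)", OF P])
    fix p' assume p': "p' \<in> N \<and> (\<forall>v\<in>N. ip (h - p') v = 0)"
    show "p' = p"
    proof (rule N_eqI)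
      fix v assume v: "v \<in> N"
      have "ip (h - p') v = ip (h - p) v"
        using p' P v by metis
      then show "ip p' v = ip p v"
        using p' pN h v by (simp add: N_H ip_diff_left)
    qed (use p' pN in auto)
  qed
qed

abbreviation "compr \<equiv> compression H ip \<aa>"

lemma comp_mem [simp]: "\<lbrakk>multiplier \<psi>; f \<in> N\<rbrakk> \<Longrightarrow> compr \<psi> f \<in> N"
  using orth_proj[of "\<psi> * f"] by (simp add: compression_def mult_op_def N_H)

lemma ip_comp: "\<lbrakk>multiplier \<psi>; f \<in> N; v \<in> N\<rbrakk> \<Longrightarrow> ip (compr \<psi> f) v = ip (\<psi> * f) v"
proof -
  assume \<psi>: "multiplier \<psi>" and f: "f \<in> N" and v: "v \<in> N"
  note fH = multiplier_mem[OF \<psi> N_H[OF f]]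
  have eq: "compr \<psi> f = orth_proj ip N (\<psi> * f)"
    using f by (simp add: compression_def mult_op_def N_H)
  have "ip (\<psi> * f - compr \<psi> f) v = 0" and mem: "compr \<psi> f \<in> N"
    unfolding eq using orth_proj[OF fH] v by blast+
  then show ?thesis
    unfolding ip_diff_left[OF fH N_H[OF mem] N_H[OF v]] by simp
qed

lemma comp_outside: "f \<notin> N \<Longrightarrow> compr \<psi> f = 0"
  by (simp add: compression_def)

lemma comp_eqI:
  "\<lbrakk>multiplier \<psi>; f \<in> N; g \<in> N; \<And>v. v \<in> N \<Longrightarrow> ip (\<psi> * f) v = ip g v\<rbrakk> \<Longrightarrow> compr \<psi> f = g"
  by (rule N_eqI) (auto simp: ip_comp)

lemma comp_zero: "multiplier \<psi> \<Longrightarrow> compr \<psi> 0 = 0"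
  by (rule comp_eqI) (auto simp: N_H)

lemma comp_plus: "\<lbrakk>multiplier \<psi>; multiplier \<phi>\<rbrakk> \<Longrightarrow> compr (\<psi> + \<phi>) = compr \<psi> + compr \<phi>"
proof
  fix f assume *: "multiplier \<psi>" "multiplier \<phi>"
  show "compr (\<psi> + \<phi>) f = (compr \<psi> + compr \<phi>) f"
  proof (cases "f \<in> N")
    case True
    then have "compr (\<psi> + \<phi>) f = compr \<psi> f + compr \<phi> f"
      using * by (intro comp_eqI) (auto simp: multiplier_add distrib_right ip_add_left ip_comp N_H)
    then show ?thesis by simp
  qed (simp add: comp_outside)
qed

lemma comp_scale: "multiplier \<psi> \<Longrightarrow> compr (cscale t \<psi>) = (\<lambda>f. cscale t (compr \<psi> f))"
proof
  fix f assume *: "multiplier \<psi>"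
  show "compr (cscale t \<psi>) f = cscale t (compr \<psi> f)"
  proof (cases "f \<in> N")
    case True
    then show ?thesis
      using * by (intro comp_eqI) (auto simp: multiplier_scale times_cscale ip_scale_left ip_comp N_H)
  qed (simp add: comp_outside)
qed

text \<open>\<open>adj \<psi>\<close> maps \<open>N\<close> into itself, so moving
  \<open>\<psi>\<close> to the other side of the pairing removes the projection between the two
  factors.\<close>

lemma comp_times: "\<lbrakk>multiplier \<psi>; multiplier \<phi>\<rbrakk> \<Longrightarrow> compr (\<psi> * \<phi>) = compr \<psi> \<circ> compr \<phi>"
proof
  fix f assume *: "multiplier \<psi>" "multiplier \<phi>"
  show "compr (\<psi> * \<phi>) f = (compr \<psi> \<circ> compr \<phi>) f"
  proof (cases "f \<in> N")
    case True
    have "ip (\<psi> * \<phi> * f) v = ip (compr \<psi> (compr \<phi> f)) v" if "v \<in> N" for v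
    proof -
      have "ip (compr \<psi> (compr \<phi> f)) v = ip (compr \<phi> f) (adj \<psi> v)"
        using True that * by (simp add: ip_comp ip_adj N_H)
      also have "\<dots> = ip (\<phi> * f) (adj \<psi> v)"
        using True that * by (simp add: ip_comp)
      also have "\<dots> = ip (\<psi> * \<phi> * f) v"
        using True that * by (simp add: ip_adj N_H mult.assoc)
      finally show ?thesis ..
    qed
    then show ?thesis
      using True * by (simp add: comp_eqI multiplier_times)
  qed (simp add: comp_outside comp_zero *)
qed

lemma comp_unit: "f \<in> N \<Longrightarrow> compr (indicator (ball 0 1)) f = f"
  by (rule comp_eqI) (auto simp: multiplier_unit unit_times N_H)

lemma comp_bounded_ops:
  assumes \<psi>: "multiplier \<psi>"
  shows "compr \<psi> \<in> bounded_ops N ip"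
proof -
  obtain C where C: "C \<ge> 0" "\<And>f. f \<in> H \<Longrightarrow> nrm (\<psi> * f) \<le> C * nrm f"
    using multiplier_bounded[OF \<psi>] by blast
  have "nrm (compr \<psi> f) \<le> C * nrm f" if f: "f \<in> N" for f
  proof (cases "compr \<psi> f = 0")
    case False
    let ?g = "compr \<psi> f"
    have g: "?g \<in> N"
      using \<psi> f by simp
    have "nrm ?g * nrm ?g = Re (ip (\<psi> * f) ?g)"
      using Re_ip_self[OF N_H[OF g]] ip_comp[OF \<psi> f g] by (simp add: power2_eq_square)
    also have "\<dots> \<le> nrm (\<psi> * f) * nrm ?g"
      using Cauchy_Schwarz[OF multiplier_mem[OF \<psi> N_H[OF f]] N_H[OF g]]
        complex_Re_le_cmod[of "ip (\<psi> * f) ?g"] by linarith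
    finally have "nrm ?g * nrm ?g \<le> nrm (\<psi> * f) * nrm ?g" .
    moreover have "nrm ?g > 0"
      using False g by (metis N_H less_le nrm_eq_0_iff nrm_nonneg)
    ultimately show ?thesis
      using C(2)[OF N_H[OF f]] by simp
  qed (use C f N_H in simp)
  moreover have "compr \<psi> (f + g) = compr \<psi> f + compr \<psi> g" if "f \<in> N" "g \<in> N" for f g
    using that \<psi> by (intro comp_eqI) (auto simp: distrib_left ip_add_left ip_comp N_H)
  moreover have "compr \<psi> (cscale c f) = cscale c (compr \<psi> f)" if "f \<in> N" for c f
    using that \<psi> by (intro comp_eqI) (auto simp: times_cscale ip_scale_left ip_comp N_H)
  ultimately show ?thesis
    unfolding bounded_ops_def using comp_outside comp_mem[OF \<psi>]
    by (intro CollectI conjI ballI allI impI exI[of _ C])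
qed

section \<open>Approximate eigenvalues and the support\<close>

lemma kernel_diag_nz: "x \<in> ball 0 1 \<Longrightarrow> kernel a x (x :: complex ^ 'd) \<noteq> 0"
  by (rule kernel_nz)

text \<open>The conjugate reflects that the \<open>L j\<close> are adjoints: \<open>kern x\<close>
  has the eigenvalues \<open>cnj (x $ j)\<close>, so each kernel function carries the label of its
  own point.\<close>

definition approx_eigenvalue :: "complex ^ 'd \<Rightarrow> bool" where
  "approx_eigenvalue x \<longleftrightarrow>
     (\<forall>\<eta>>0. \<exists>y\<in>N. nrm y = 1 \<and> (\<forall>j. nrm (L j y - cscale (cnj (x $ j)) y) \<le> \<eta>))"

lemma adj_coord_shift:
  assumes "v \<in> H"
  shows "adj (coord j - cscale c (indicator (ball 0 1))) v = L j v - cscale (cnj c) v"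
  using assms by (simp add: adj_minus adj_cscale adj_unit multiplier_coord multiplier_scale multiplier_unit)

text \<open>The multipliers of zero compression and the \<open>z_j - x_j\<close> generate a proper
  ideal: if the unit were \<open>\<psi> + \<Sum> \<sigma>_j \<theta>_j\<close>, then pairing it with
  a unit vector almost annihilated by all \<open>adj (\<sigma> j)\<close> would give a number below
  1. A character vanishing on this ideal descends to the compressed multipliers and sends the
  coordinates to \<open>x\<close>.\<close>

lemma approx_eigenvalue_in_support:
  assumes x: "approx_eigenvalue x"
  shows "x \<in> ideal_support H ip \<aa>"
proof -
  let ?e = "indicator (ball 0 1) :: (complex ^ 'd) cfun"
  define \<kappa> where "\<kappa> = {\<psi>. multiplier \<psi> \<and> (\<forall>f\<in>N. \<forall>g\<in>N. ip (\<psi> * f) g = 0)}"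
  define \<sigma> where "\<sigma> j = coord j - cscale (x $ j) ?e" for j
  have \<sigma>: "multiplier (\<sigma> j)" for j
    by (simp add: \<sigma>_def multiplier_diff multiplier_coord multiplier_scale multiplier_unit)
  have msum: "multiplier (\<Sum>j\<in>S. f j)" if "\<And>j. multiplier (f j)" for S :: "'d set" and f
  proof (induction S rule: infinite_finite_induct)
    case (insert i S)
    show ?case
      unfolding sum.insert[OF insert(1,2)] by (rule multiplier_add[OF that insert(3)])
  qed (simp_all flip: zero_fun_def)
  define J where "J = {\<psi> + (\<Sum>j\<in>UNIV. \<sigma> j * \<theta> j) | \<psi> \<theta>. \<psi> \<in> \<kappa> \<and> (\<forall>j. multiplier (\<theta> j))}"
  have J_I: "f \<in> J" if "f = \<psi> + (\<Sum>j\<in>UNIV. \<sigma> j * \<theta> j)" "\<psi> \<in> \<kappa>" "\<And>j. multiplier (\<theta> j)" for f \<psi> \<theta>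
    unfolding J_def using that by (intro CollectI exI[of _ \<psi>] exI[of _ \<theta>]) simp
  have \<kappa>0: "0 \<in> \<kappa>"
    by (auto simp: \<kappa>_def N_H)
  have \<kappa>J: "\<psi> \<in> J" if "\<psi> \<in> \<kappa>" for \<psi>
  proof -
    have "\<psi> + (\<Sum>j\<in>UNIV. \<sigma> j * 0) \<in> J"
      unfolding J_def using that by (intro CollectI exI[of _ \<psi>] exI[of _ "\<lambda>_. 0"]) simp
    then show ?thesis by simp
  qed
  have \<sigma>J: "\<sigma> i \<in> J" for i
  proof -
    have "0 + (\<Sum>j\<in>UNIV. \<sigma> j * (if j = i then ?e else 0)) \<in> J"
      unfolding J_def using \<kappa>0 multiplier_zero multiplier_unit
      by (intro CollectI exI[of _ 0] exI[of _ "\<lambda>j. if j = i then ?e else 0"]) auto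
    moreover have "(\<Sum>j\<in>UNIV. \<sigma> j * (if j = i then ?e else 0)) = (\<Sum>j\<in>UNIV. if j = i then \<sigma> j else 0)"
      using multiplier_times_unit[OF \<sigma>] by (intro sum.cong) (auto simp: mult.commute)
    ultimately show ?thesis by simp
  qed
  have J: "mult_ideal J"
    unfolding mult_ideal_def
  proof (intro conjI ballI allI impI)
    show "J \<subseteq> Collect multiplier"
    proof
      fix f assume "f \<in> J"
      then obtain \<psi> \<theta> where *: "\<psi> \<in> \<kappa>" "\<And>j. multiplier (\<theta> j)" "f = \<psi> + (\<Sum>j\<in>UNIV. \<sigma> j * \<theta> j)"
        unfolding J_def by blast
      have "multiplier f"
        unfolding *(3)
      proof (rule multiplier_add)
        show "multiplier \<psi>"
          using *(1) by (simp add: \<kappa>_def)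
        show "multiplier (\<Sum>j\<in>UNIV. \<sigma> j * \<theta> j)"
          by (rule msum) (rule multiplier_times[OF \<sigma> *(2)])
      qed
      then show "f \<in> Collect multiplier" by simp
    qed
    show "0 \<in> J"
      by (rule \<kappa>J[OF \<kappa>0])
  next
    fix f g assume "f \<in> J" "g \<in> J"
    then obtain \<psi> \<theta> \<psi>' \<theta>' where *: "\<psi> \<in> \<kappa>" "\<psi>' \<in> \<kappa>" "\<And>j. multiplier (\<theta> j)" "\<And>j. multiplier (\<theta>' j)"
      "f = \<psi> + (\<Sum>j\<in>UNIV. \<sigma> j * \<theta> j)" "g = \<psi>' + (\<Sum>j\<in>UNIV. \<sigma> j * \<theta>' j)"
      unfolding J_def by blast
    have "\<psi> + \<psi>' \<in> \<kappa>"
      using *(1,2) by (auto simp: \<kappa>_def multiplier_add distrib_right ip_add_left N_H)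
    moreover have "f + g = (\<psi> + \<psi>') + (\<Sum>j\<in>UNIV. \<sigma> j * (\<theta> j + \<theta>' j))"
      unfolding * by (simp only: distrib_left sum.distrib add_ac)
    moreover have "multiplier (\<theta> j + \<theta>' j)" for j
      using * by (simp add: multiplier_add)
    ultimately show "f + g \<in> J"
      by (intro J_I[of _ "\<psi> + \<psi>'" "\<lambda>j. \<theta> j + \<theta>' j"])
  next
    fix \<phi> f assume \<phi>: "multiplier \<phi>" and "f \<in> J"
    then obtain \<psi> \<theta> where *: "\<psi> \<in> \<kappa>" "\<And>j. multiplier (\<theta> j)" "f = \<psi> + (\<Sum>j\<in>UNIV. \<sigma> j * \<theta> j)"
      unfolding J_def by blast
    have "ip (\<phi> * \<psi> * f) g = 0" if "f \<in> N" "g \<in> N" for f g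
    proof -
      have "ip (\<phi> * (\<psi> * f)) g = ip (\<psi> * f) (adj \<phi> g)"
        using \<phi> *(1) that by (simp add: ip_adj N_H \<kappa>_def)
      then show ?thesis
        using *(1) that \<phi> by (simp add: \<kappa>_def mult.assoc)
    qed
    then have "\<phi> * \<psi> \<in> \<kappa>"
      using \<phi> * by (simp add: \<kappa>_def multiplier_times)
    moreover have "\<phi> * f = \<phi> * \<psi> + (\<Sum>j\<in>UNIV. \<sigma> j * (\<phi> * \<theta> j))"
      unfolding *(3) distrib_left sum_distrib_left by (simp only: mult.left_commute)
    moreover have "multiplier (\<phi> * \<theta> j)" for j
      using \<phi> * by (simp add: multiplier_times)
    ultimately show "\<phi> * f \<in> J"
      by (intro J_I[of _ "\<phi> * \<psi>" "\<lambda>j. \<phi> * \<theta> j"])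
  qed
  have "?e \<notin> J"
  proof
    assume "?e \<in> J"
    then obtain \<psi> \<theta> where *: "\<psi> \<in> \<kappa>" "\<And>j. multiplier (\<theta> j)" "?e = \<psi> + (\<Sum>j\<in>UNIV. \<sigma> j * \<theta> j)"
      unfolding J_def by blast
    have "\<exists>C\<ge>0. \<forall>f\<in>H. nrm (\<theta> j * f) \<le> C * nrm f" for j
      using multiplier_bounded[OF *(2)] by metis
    then obtain C where C: "\<And>j. C j \<ge> 0" "\<And>j f. f \<in> H \<Longrightarrow> nrm (\<theta> j * f) \<le> C j * nrm f"
      by metis
    \<comment> \<open>Makes \<open>(\<Sum>j\<in>UNIV. C j) * \<eta>\<close> less than 1, also when
      all \<open>C j\<close> vanish. That sum will bound the squared norm of \<open>y\<close>, since
      the \<open>\<psi>\<close> part pairs to 0.\<close>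
    define \<eta> where "\<eta> = 1 / (2 * ((\<Sum>j\<in>UNIV. C j) + 1))"
    have sC: "(\<Sum>j\<in>UNIV. C j) \<ge> 0"
      using C by (simp add: sum_nonneg)
    then have \<eta>: "\<eta> > 0" "(\<Sum>j\<in>UNIV. C j) * \<eta> < 1"
      by (auto simp: \<eta>_def field_simps)
    obtain y where y: "y \<in> N" "nrm y = 1" "\<And>j. nrm (L j y - cscale (cnj (x $ j)) y) \<le> \<eta>"
      using x \<eta>(1) unfolding approx_eigenvalue_def by blast
    have "y = ?e * y"
      using y N_H by (simp add: unit_times)
    also have "\<dots> = \<psi> * y + (\<Sum>j\<in>UNIV. \<sigma> j * (\<theta> j * y))"
      unfolding *(3) distrib_right sum_distrib_right by (simp only: mult.assoc)
    finally have yeq: "y = \<psi> * y + (\<Sum>j\<in>UNIV. \<sigma> j * (\<theta> j * y))" .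
    have mem: "\<psi> * y \<in> H" "\<And>j. \<sigma> j * (\<theta> j * y) \<in> H" "\<And>j. \<theta> j * y \<in> H" "y \<in> H"
      using * y \<sigma> N_H by (auto simp: \<kappa>_def)
    have "ip y y = ip (\<psi> * y + (\<Sum>j\<in>UNIV. \<sigma> j * (\<theta> j * y))) y"
      using yeq by simp
    also have "\<dots> = ip (\<psi> * y) y + (\<Sum>j\<in>UNIV. ip (\<sigma> j * (\<theta> j * y)) y)"
      using mem by (subst ip_add_left) (auto simp: ip_sum_left sum_mem)
    also have "ip (\<psi> * y) y = 0"
      using * y by (simp add: \<kappa>_def)
    also have "(\<Sum>j\<in>UNIV. ip (\<sigma> j * (\<theta> j * y)) y) = (\<Sum>j\<in>UNIV. ip (\<theta> j * y) (adj (\<sigma> j) y))"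
      using mem by (simp add: ip_adj[OF \<sigma>])
    finally have "ip y y = (\<Sum>j\<in>UNIV. ip (\<theta> j * y) (adj (\<sigma> j) y))" by simp
    then have "1 = cmod (\<Sum>j\<in>UNIV. ip (\<theta> j * y) (adj (\<sigma> j) y))"
      using ip_self[of y] y mem by simp
    also have "\<dots> \<le> (\<Sum>j\<in>UNIV. C j * \<eta>)"
    proof (rule sum_norm_le)
      fix j
      have "cmod (ip (\<theta> j * y) (adj (\<sigma> j) y)) \<le> nrm (\<theta> j * y) * nrm (adj (\<sigma> j) y)"
        using mem \<sigma> by (simp add: Cauchy_Schwarz)
      also have "\<dots> \<le> C j * \<eta>"
        using C(2)[OF mem(4), of j] C(1)[of j] y mem \<sigma>
        by (intro mult_mono) (auto simp: \<sigma>_def adj_coord_shift)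
      finally show "cmod (ip (\<theta> j * y) (adj (\<sigma> j) y)) \<le> C j * \<eta>" .
    qed
    also have "\<dots> = (\<Sum>j\<in>UNIV. C j) * \<eta>"
      by (simp add: sum_distrib_right)
    finally show False
      using \<eta>(2) by simp
  qed
  then obtain \<omega> where \<omega>1: "\<omega> ?e = 1" and \<omega>J: "\<And>\<psi>. \<psi> \<in> J \<Longrightarrow> \<omega> \<psi> = 0"
    and \<omega>_plus: "\<And>\<psi> \<phi>. \<lbrakk>multiplier \<psi>; multiplier \<phi>\<rbrakk> \<Longrightarrow> \<omega> (\<psi> + \<phi>) = \<omega> \<psi> + \<omega> \<phi>"
    and \<omega>_times: "\<And>\<psi> \<phi>. \<lbrakk>multiplier \<psi>; multiplier \<phi>\<rbrakk> \<Longrightarrow> \<omega> (\<psi> * \<phi>) = \<omega> \<psi> * \<omega> \<phi>"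
    and \<omega>_scale: "\<And>t \<psi>. multiplier \<psi> \<Longrightarrow> \<omega> (cscale t \<psi>) = t * \<omega> \<psi>"
    using mult_ideal_character[OF kernel_diag_nz J] by blast
  \<comment> \<open>The ideal contains the multipliers of zero compression, so
    \<open>\<omega>\<close> depends on the compression alone and \<open>m\<close> below does not
    depend on the chosen preimage.\<close>
  have \<omega>_cong: "\<omega> \<psi> = \<omega> \<phi>" if *: "multiplier \<psi>" "multiplier \<phi>" "compr \<psi> = compr \<phi>" for \<psi> \<phi>
  proof -
    have "ip ((\<psi> - \<phi>) * f) g = 0" if "f \<in> N" "g \<in> N" for f g
    proof -
      have "ip (\<psi> * f) g = ip (\<phi> * f) g"
        using that * by (simp flip: ip_comp)
      then show ?thesis
        using that * by (simp add: left_diff_distrib ip_diff_left N_H)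
    qed
    then have "\<psi> - \<phi> \<in> J"
      using * by (intro \<kappa>J) (simp add: \<kappa>_def multiplier_diff)
    then have "\<omega> (\<psi> - \<phi>) = 0"
      by (rule \<omega>J)
    moreover have "\<omega> ((\<psi> - \<phi>) + \<phi>) = \<omega> (\<psi> - \<phi>) + \<omega> \<phi>"
      using * by (intro \<omega>_plus multiplier_diff)
    ultimately show ?thesis by simp
  qed
  define m where "m T = (if T \<in> compressed_multipliers H ip \<aa>
    then \<omega> (SOME \<psi>. multiplier \<psi> \<and> compr \<psi> = T) else 0)" for T
  have m: "m (compr \<psi>) = \<omega> \<psi>" if \<psi>: "multiplier \<psi>" for \<psi>
  proof -
    have "multiplier (SOME \<phi>. multiplier \<phi> \<and> compr \<phi> = compr \<psi>) \<and> compr (SOME \<phi>. multiplier \<phi> \<and> compr \<phi> = compr \<psi>) = compr \<psi>"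
      by (rule someI[of "\<lambda>\<phi>. multiplier \<phi> \<and> compr \<phi> = compr \<psi>" \<psi>]) (simp add: \<psi>)
    then have "\<omega> (SOME \<phi>. multiplier \<phi> \<and> compr \<phi> = compr \<psi>) = \<omega> \<psi>"
      using \<psi> by (intro \<omega>_cong) auto
    then show ?thesis
      using \<psi> by (simp add: m_def compressed_multipliers_def multipliers_eq)
  qed
  have "m \<in> characters (compressed_multipliers H ip \<aa>)"
    unfolding characters_def
  proof (intro CollectI conjI ballI allI impI)
    fix S T assume "S \<in> compressed_multipliers H ip \<aa>" "T \<in> compressed_multipliers H ip \<aa>"
    then obtain \<psi> \<phi> where *: "multiplier \<psi>" "S = compr \<psi>" "multiplier \<phi>" "T = compr \<phi>"
      by (auto simp: compressed_multipliers_def multipliers_eq)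
    show "m (S + T) = m S + m T"
      using m[of "\<psi> + \<phi>"] * by (simp add: comp_plus[symmetric] multiplier_add m \<omega>_plus)
    show "m (S \<circ> T) = m S * m T"
      using m[of "\<psi> * \<phi>"] * by (simp add: comp_times[symmetric] multiplier_times m \<omega>_times)
  next
    fix c S assume "S \<in> compressed_multipliers H ip \<aa>"
    then obtain \<psi> where *: "multiplier \<psi>" "S = compr \<psi>"
      by (auto simp: compressed_multipliers_def multipliers_eq)
    then show "m (\<lambda>f. cscale c (S f)) = c * m S"
      using m[of "cscale c \<psi>"] by (simp add: comp_scale[symmetric] multiplier_scale m \<omega>_scale)
  next
    have "m (compr ?e) \<noteq> 0"
      by (simp add: m multiplier_unit \<omega>1)
    then show "\<exists>S\<in>compressed_multipliers H ip \<aa>. m S \<noteq> 0"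
      by (intro bexI[of _ "compr ?e"]) (auto simp: compressed_multipliers_def multipliers_eq multiplier_unit)
  qed (simp add: m_def)
  moreover have "m (compr (coord j)) = x $ j" for j
  proof -
    have "\<omega> (\<sigma> j + cscale (x $ j) ?e) = \<omega> (\<sigma> j) + \<omega> (cscale (x $ j) ?e)"
      by (intro \<omega>_plus \<sigma> multiplier_scale multiplier_unit)
    then have "\<omega> (coord j) = x $ j"
      using \<omega>J[OF \<sigma>J[of j]] by (simp add: \<omega>_scale[OF multiplier_unit] \<omega>1) (simp add: \<sigma>_def)
    then show ?thesis
      by (simp add: m multiplier_coord)
  qed
  ultimately show ?thesis
    unfolding ideal_support_def coord_def
    by (intro CollectI exI[of _ m]) (simp add: vec_eq_iff)
qed

end

section \<open>Peak points\<close>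

lemma op_norm_zero:
  fixes V :: "'x cfun set"
  assumes "ip 0 0 = 0" "0 \<in> V"
  shows "op_norm V ip 0 = 0"
proof -
  from assms have "{hnorm ip ((0 :: 'x cop) f) | f. f \<in> V \<and> hnorm ip f \<le> 1} = {0}"
    by (auto simp: hnorm_def intro!: exI[of _ 0])
  then show ?thesis
    by (simp add: op_norm_def)
qed

lemma cmatrix_norm_1: "cmatrix_norm 1 (\<lambda>_ _. c) = cmod c"
proof -
  have "{sqrt (\<Sum>i<1::nat. (cmod (\<Sum>j<1::nat. c * v j))\<^sup>2) | v. sqrt (\<Sum>j<1::nat. (cmod (v j))\<^sup>2) \<le> 1}
      = {cmod c * cmod (v (0 :: nat)) | v. cmod (v 0) \<le> 1}"
    by (simp add: norm_mult)
  moreover have "Sup {cmod c * cmod (v (0 :: nat)) | v. cmod (v 0) \<le> 1} = cmod c"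
    by (rule cSup_eq_maximum) (auto intro!: exI[of _ "\<lambda>_. 1"] mult_left_le)
  ultimately show ?thesis
    by (simp add: cmatrix_norm_def)
qed

context cnp_quotient begin

abbreviation "poly_algebra \<equiv> compressed_poly_algebra H ip \<aa>"
abbreviation "poly_comp p \<equiv> compr (on_ball p)"

lemma poly_comp_mem:
  assumes p: "cpolynomial p"
  shows "poly_comp p \<in> poly_algebra"
proof -
  have 0: "op_norm H ip 0 = 0" "op_norm N ip 0 = 0"
    by (rule op_norm_zero; simp)+
  have "on_ball p \<in> poly_multipliers H ip"
    unfolding poly_multipliers_def using p multiplier_on_ball[OF p] 0
    by (auto simp: multipliers_eq intro!: exI[of _ p])
  then show ?thesis
    unfolding compressed_poly_algebra_def using comp_bounded_ops[OF multiplier_on_ball[OF p]] 0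
    by (auto intro!: bexI[of _ "on_ball p"])
qed

text \<open>On polynomials a character is evaluation at a point. It is not known to extend to all
  compressed multipliers, so nothing yet places this point in the support.\<close>

lemma character_poly:
  assumes \<omega>: "\<omega> \<in> characters poly_algebra" and p: "cpolynomial p"
  shows "\<omega> (poly_comp p) = p (\<chi> j. \<omega> (compr (coord j)))"
proof -
  let ?e = "indicator (ball 0 1) :: (complex ^ 'd) cfun"
  have add: "\<omega> (S + T) = \<omega> S + \<omega> T" and mult: "\<omega> (S \<circ> T) = \<omega> S * \<omega> T"
    if "S \<in> poly_algebra" "T \<in> poly_algebra" for S T
    using \<omega> that by (auto simp: characters_def)
  have scale: "\<omega> (\<lambda>f. cscale c (S f)) = c * \<omega> S" if "S \<in> poly_algebra" for c S
    using \<omega> that by (auto simp: characters_def)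
  have e: "compr ?e \<in> poly_algebra"
    using poly_comp_mem[OF cpolynomial_const[of 1]] by (simp add: on_ball_const)
  obtain S where S: "S \<in> poly_algebra" "\<omega> S \<noteq> 0"
    using \<omega> by (auto simp: characters_def)
  \<comment> \<open>The unit is the compression of the indicator. Operators vanish outside
    \<open>N\<close>, so composing with it reproduces \<open>S\<close> as a HOL function, and
    \<open>\<omega> S \<noteq> 0\<close> forces the value 1 at the unit.\<close>
  have "S \<circ> compr ?e = S"
  proof
    fix f
    have "S \<in> bounded_ops N ip"
      using S by (simp add: compressed_poly_algebra_def)
    then have "\<forall>f. f \<notin> N \<longrightarrow> S f = 0" and "\<forall>c. \<forall>f\<in>N. S (cscale c f) = cscale c (S f)"
      unfolding bounded_ops_def by blast+
    then have "S 0 = 0" and "f \<notin> N \<Longrightarrow> S f = 0"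
      using N_zero by (metis cfun.scale_zero_left)+
    then show "(S \<circ> compr ?e) f = S f"
      by (cases "f \<in> N") (simp_all add: comp_unit comp_outside)
  qed
  then have e1: "\<omega> (compr ?e) = 1"
    using mult[OF S(1) e] S(2) by simp
  show ?thesis
    using p
  proof (induction p rule: cpolynomial_induct)
    case (const c)
    then show ?case
      using scale[OF e, of c] by (simp add: on_ball_const comp_scale multiplier_unit e1)
  next
    case (coord j)
    then show ?case by (simp add: coord_def)
  next
    case (add p q)
    show ?case
      unfolding on_ball_add comp_plus[OF multiplier_on_ball[OF add(1)] multiplier_on_ball[OF add(2)]]
        \<open>\<And>S T. \<lbrakk>S \<in> poly_algebra; T \<in> poly_algebra\<rbrakk> \<Longrightarrow> \<omega> (S + T) = \<omega> S + \<omega> T\<close>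
          [OF poly_comp_mem[OF add(1)] poly_comp_mem[OF add(2)]] add(3,4) ..
  next
    case (mult p q)
    show ?case
      unfolding on_ball_mult comp_times[OF multiplier_on_ball[OF mult(1)] multiplier_on_ball[OF mult(2)]]
        \<open>\<And>S T. \<lbrakk>S \<in> poly_algebra; T \<in> poly_algebra\<rbrakk> \<Longrightarrow> \<omega> (S \<circ> T) = \<omega> S * \<omega> T\<close>
          [OF poly_comp_mem[OF mult(1)] poly_comp_mem[OF mult(2)]] mult(3,4) ..
  qed
qed

definition comp_norm :: "(complex ^ 'd) cop \<Rightarrow> real" where
  "comp_norm T = Sup {nrm (T g) | g. g \<in> N \<and> nrm g \<le> 1}"

lemma op_matrix_norm_1:
  assumes T: "\<And>f. f \<in> N \<Longrightarrow> T f \<in> N"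
  shows "op_matrix_norm N ip 1 (\<lambda>_ _. T) = comp_norm T"
proof -
  have "{sqrt (\<Sum>i<1::nat. (nrm (\<Sum>j<1::nat. T (f j)))\<^sup>2) | f.
      (\<forall>j<1. f j \<in> N) \<and> sqrt (\<Sum>j<1::nat. (nrm (f j))\<^sup>2) \<le> 1} = {nrm (T g) | g. g \<in> N \<and> nrm g \<le> 1}"
    (is "?A = ?B")
  proof (intro equalityI subsetI)
    fix r assume "r \<in> ?A"
    then obtain f where "f 0 \<in> N" "\<bar>nrm (f 0)\<bar> \<le> 1" "r = \<bar>nrm (T (f 0))\<bar>"
      by auto
    then show "r \<in> ?B"
      using T[of "f 0"] N_H by (intro CollectI exI[of _ "f 0"]) auto
  next
    fix r assume "r \<in> ?B"
    then obtain g where "g \<in> N" "nrm g \<le> 1" "r = nrm (T g)"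
      by auto
    then show "r \<in> ?A"
      using T[of g] N_H by (intro CollectI exI[of _ "\<lambda>_. g"]) auto
  qed
  then show ?thesis
    by (simp add: op_matrix_norm_def comp_norm_def)
qed

lemma nrm_comp_le:
  assumes \<psi>: "multiplier \<psi>" and f: "f \<in> N"
  shows "nrm (compr \<psi> f) \<le> comp_norm (compr \<psi>) * nrm f"
proof (cases "f = 0")
  case True
  then show ?thesis
    using comp_zero[OF \<psi>] by simp
next
  case False
  have pos: "nrm f > 0"
    using False f by (metis N_H less_le nrm_eq_0_iff nrm_nonneg)
  have T: "compr \<psi> \<in> bounded_ops N ip"
    by (rule comp_bounded_ops[OF \<psi>])
  then obtain C where C: "\<And>g. g \<in> N \<Longrightarrow> nrm (compr \<psi> g) \<le> C * nrm g"
    unfolding bounded_ops_def by blast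
  have bdd: "bdd_above {nrm (compr \<psi> g) | g. g \<in> N \<and> nrm g \<le> 1}"
  proof (rule bdd_aboveI[of _ "\<bar>C\<bar>"])
    fix r assume "r \<in> {nrm (compr \<psi> g) | g. g \<in> N \<and> nrm g \<le> 1}"
    then obtain g where g: "g \<in> N" "nrm g \<le> 1" "r = nrm (compr \<psi> g)"
      by auto
    have "r \<le> C * nrm g"
      using g C by simp
    also have "\<dots> \<le> \<bar>C\<bar> * nrm g"
      using g N_H by (intro mult_right_mono) auto
    also have "\<dots> \<le> \<bar>C\<bar> * 1"
      using g by (intro mult_left_mono) auto
    finally show "r \<le> \<bar>C\<bar>" by simp
  qed
  let ?g = "cscale (of_real (1 / nrm f)) f"
  have "nrm ?g = 1"
    unfolding nrm_scale[OF N_H[OF f]] using pos by (simp add: norm_divide)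
  then have "nrm (compr \<psi> ?g) \<le> comp_norm (compr \<psi>)"
    unfolding comp_norm_def using f bdd by (intro cSup_upper) auto
  moreover have "compr \<psi> ?g = cscale (of_real (1 / nrm f)) (compr \<psi> f)"
    using T f unfolding bounded_ops_def by blast
  moreover have "nrm (cscale (of_real (1 / nrm f)) (compr \<psi> f)) = nrm (compr \<psi> f) / nrm f"
    unfolding nrm_scale[OF N_H[OF comp_mem[OF \<psi> f]]] using pos by (simp add: norm_divide)
  ultimately have "nrm (compr \<psi> f) / nrm f \<le> comp_norm (compr \<psi>)"
    by (simp only:)
  then show ?thesis
    using pos by (simp add: field_simps)
qed

lemma comp_norm_le:
  assumes "\<And>f. f \<in> N \<Longrightarrow> nrm (T f) \<le> C * nrm f" "C \<ge> 0"
  shows "comp_norm T \<le> C"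
  unfolding comp_norm_def
proof (rule cSup_least)
  show "{nrm (T g) | g. g \<in> N \<and> nrm g \<le> 1} \<noteq> {}"
    using N_zero nrm_zero by (auto intro!: exI[of _ 0])
  fix r assume "r \<in> {nrm (T g) | g. g \<in> N \<and> nrm g \<le> 1}"
  then obtain g where g: "g \<in> N" "nrm g \<le> 1" "r = nrm (T g)"
    by auto
  then have "r \<le> C * nrm g"
    using assms by simp
  also have "\<dots> \<le> C * 1"
    using g assms by (intro mult_left_mono) auto
  finally show "r \<le> C" by simp
qed

end

text \<open>The last two assumptions say that the norm of a compressed polynomial is its maximum
  modulus on \<open>X\<close>, split into implications between bounds so that no supremum has to be
  handled.\<close>

locale isometric_quotient = cnp_quotient a b H ip \<aa>
  for a b :: "nat \<Rightarrow> real" and H :: "(complex ^ 'd) cfun set"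
    and ip :: "(complex ^ 'd) cfun \<Rightarrow> (complex ^ 'd) cfun \<Rightarrow> complex"
    and \<aa> :: "(complex ^ 'd) cfun set" +
  fixes X :: "(complex ^ 'd) set"
  assumes X_compact: "compact X" and X_ne: "X \<noteq> {}"
    and comp_le: "\<And>p M f. \<lbrakk>cpolynomial p; \<And>x. x \<in> X \<Longrightarrow> cmod (p x) \<le> M; f \<in> N\<rbrakk>
      \<Longrightarrow> nrm (poly_comp p f) \<le> M * nrm f"
    and le_comp: "\<And>p C x. \<lbrakk>cpolynomial p; C \<ge> 0; \<And>f. f \<in> N \<Longrightarrow> nrm (poly_comp p f) \<le> C * nrm f; x \<in> X\<rbrakk>
      \<Longrightarrow> cmod (p x) \<le> C"

text \<open>1 by 1 matrices suffice. Each coordinate of a character point is bounded by the norm of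
  the compressed coordinate, and the inequalities are closed conditions, so they survive passage to
  the closure.\<close>

lemma (in cnp_quotient) isometric_imp_isometric_quotient:
  assumes G: "gelfand_completely_isometric N ip poly_algebra"
  obtains X where "isometric_quotient a b H ip \<aa> X"
proof -
  let ?A = "poly_algebra"
  have gelf: "(\<exists>\<omega>\<in>characters ?A. comp_norm (poly_comp p) = cmod (\<omega> (poly_comp p))) \<and>
      (\<forall>\<omega>\<in>characters ?A. cmod (\<omega> (poly_comp p)) \<le> comp_norm (poly_comp p))"
    if p: "cpolynomial p" for p
  proof -
    have "op_matrix_norm N ip 1 (\<lambda>_ _. poly_comp p) = comp_norm (poly_comp p)"
      using multiplier_on_ball[OF p] by (intro op_matrix_norm_1) simp
    moreover have "cmatrix_norm 1 (\<lambda>i j. gelfand_transform ?A (poly_comp p) \<omega>) = cmod (\<omega> (poly_comp p))"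
      if "\<omega> \<in> characters ?A" for \<omega>
      unfolding cmatrix_norm_1 using that by (simp add: gelfand_transform_def)
    moreover have "(\<exists>\<omega>\<in>characters ?A. op_matrix_norm N ip 1 (\<lambda>_ _. poly_comp p)
          = cmatrix_norm 1 (\<lambda>i j. gelfand_transform ?A (poly_comp p) \<omega>)) \<and>
        (\<forall>\<omega>\<in>characters ?A. cmatrix_norm 1 (\<lambda>i j. gelfand_transform ?A (poly_comp p) \<omega>)
          \<le> op_matrix_norm N ip 1 (\<lambda>_ _. poly_comp p))"
      using G[unfolded gelfand_completely_isometric_def, rule_format, of 1 "\<lambda>_ _. poly_comp p"]
        poly_comp_mem[OF p] by simp
    ultimately show ?thesis
      by simp
  qed
  define Y where "Y = (\<lambda>\<omega>. (\<chi> j. \<omega> (compr (coord j))) :: complex ^ 'd) ` characters ?A"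
  have Y_le: "cmod (p x) \<le> comp_norm (poly_comp p)" if "cpolynomial p" "x \<in> Y" for p x
    using gelf[OF that(1)] that character_poly[OF _ that(1)] by (auto simp: Y_def)
  have Y_attain: "\<exists>x\<in>Y. comp_norm (poly_comp p) = cmod (p x)" if "cpolynomial p" for p
    using gelf[OF that] character_poly[OF _ that] by (auto simp: Y_def)
  have Y_ne: "Y \<noteq> {}"
    using Y_attain[OF cpolynomial_const] by blast
  have clos: "cmod (p x) \<le> comp_norm (poly_comp p)" if p: "cpolynomial p" and "x \<in> closure Y" for p x
  proof -
    have "closed {x. cmod (p x) \<le> comp_norm (poly_comp p)}"
      by (intro closed_Collect_le continuous_intros cpolynomial_continuous[OF p])
    then have "closure Y \<subseteq> {x. cmod (p x) \<le> comp_norm (poly_comp p)}"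
      using Y_le[OF p] by (intro closure_minimal) auto
    then show ?thesis
      using that by auto
  qed
  have "bounded Y"
  proof (rule boundedI)
    fix x assume x: "x \<in> Y"
    have "norm x \<le> (\<Sum>j\<in>UNIV. cmod (x $ j))"
      unfolding norm_vec_def by (rule L2_set_le_sum) simp
    also have "\<dots> \<le> (\<Sum>j\<in>UNIV. comp_norm (poly_comp (\<lambda>z :: complex ^ 'd. z $ j)))"
      by (intro sum_mono Y_le[OF cpolynomial_coord x])
    finally show "norm x \<le> (\<Sum>j\<in>UNIV. comp_norm (poly_comp (\<lambda>z :: complex ^ 'd. z $ j)))" .
  qed
  have "isometric_quotient a b H ip \<aa> (closure Y)"
  proof unfold_locales
    show "compact (closure Y)"
      using \<open>bounded Y\<close> by (simp add: compact_closure)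
    show "closure Y \<noteq> {}"
      using Y_ne by simp
  next
    fix p M f assume p: "cpolynomial p" and M: "\<And>x. x \<in> closure Y \<Longrightarrow> cmod (p x) \<le> M" and f: "f \<in> N"
    obtain x where "x \<in> Y" "comp_norm (poly_comp p) = cmod (p x)"
      using Y_attain[OF p] by blast
    then have "comp_norm (poly_comp p) \<le> M"
      using M closure_subset by auto
    then have "comp_norm (poly_comp p) * nrm f \<le> M * nrm f"
      using f N_H by (intro mult_right_mono) auto
    then show "nrm (poly_comp p f) \<le> M * nrm f"
      using nrm_comp_le[OF multiplier_on_ball[OF p] f] by linarith
  next
    fix p C x assume *: "cpolynomial p" "0 \<le> C" "\<And>f. f \<in> N \<Longrightarrow> nrm (poly_comp p f) \<le> C * nrm f"
      and x: "x \<in> closure Y"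
    have "comp_norm (poly_comp p) \<le> C"
      using * by (intro comp_norm_le) auto
    with clos[OF *(1) x] show "cmod (p x) \<le> C" by linarith
  qed
  then show ?thesis by (rule that)
qed

text \<open>Bernoulli gives \<open>1 + n s \<le> (1 + s)^n\<close>, and
  \<open>(1 - s)(1 + s) \<le> 1\<close>, where \<open>s = c t\<close>. This makes high powers of a
  peaking polynomial suppress a factor vanishing at the peak.\<close>

lemma times_power_bound:
  fixes c t :: real
  assumes "0 \<le> t" "c > 0" "c * t \<le> 1" "n \<ge> 1"
  shows "t * (1 - c * t) ^ n \<le> 1 / (c * n)"
proof -
  let ?s = "c * t"
  have s: "0 \<le> ?s" "?s \<le> 1"
    using assms by auto
  have "(1 - ?s) ^ n * (1 + n * ?s) \<le> (1 - ?s) ^ n * (1 + ?s) ^ n"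
    using s Bernoulli_inequality[of ?s n] by (intro mult_left_mono) auto
  also have "\<dots> = (1 - ?s\<^sup>2) ^ n"
    by (simp add: power2_eq_square algebra_simps flip: power_mult_distrib)
  also have "\<dots> \<le> 1"
    using s by (intro power_le_one) (auto simp: power_le_one)
  finally have "(1 - ?s) ^ n * (1 + n * ?s) \<le> 1" .
  moreover have "(1 - ?s) ^ n * (n * ?s) \<le> (1 - ?s) ^ n * (1 + n * ?s)"
    using s by (intro mult_left_mono) auto
  ultimately have "(1 - ?s) ^ n * (n * ?s) \<le> 1" by linarith
  then show ?thesis
    using assms by (simp add: field_simps)
qed

section \<open>Peaking polynomials and approximate eigenvectors\<close>

context isometric_quotient begin

lemma self_bound:
  assumes "g \<in> H" "(nrm g)\<^sup>2 \<le> c * nrm g" "c \<ge> 0"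
  shows "nrm g \<le> c"
  using assms by (cases "nrm g = 0") (auto simp: power2_eq_square dest: nrm_nonneg)

text \<open>On \<open>N\<close> the operators \<open>adj (on_ball p)\<close> and
  \<open>poly_comp p\<close> are adjoint to each other, so \<open>comp_le\<close> transfers;
  \<open>le_adj\<close> transfers \<open>le_comp\<close> in the same way.\<close>

lemma adj_le:
  assumes p: "cpolynomial p" and M: "\<And>x. x \<in> X \<Longrightarrow> cmod (p x) \<le> M" and v: "v \<in> N"
  shows "nrm (adj (on_ball p) v) \<le> M * nrm v"
proof (rule self_bound)
  note P = multiplier_on_ball[OF p]
  let ?g = "adj (on_ball p) v"
  have g: "?g \<in> N"
    using P v by simp
  then show "?g \<in> H" by (rule N_H)
  have "0 \<le> M"
    using M X_ne norm_ge_zero order_trans by blast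
  then show "0 \<le> M * nrm v"
    using v N_H by simp
  have "(nrm ?g)\<^sup>2 = Re (ip (poly_comp p ?g) v)"
    using Re_ip_self[OF N_H[OF g]] ip_comp[OF P g v] ip_adj[OF P N_H[OF v] N_H[OF g]] by simp
  also have "\<dots> \<le> nrm (poly_comp p ?g) * nrm v"
    using Cauchy_Schwarz[OF N_H[OF comp_mem[OF P g]] N_H[OF v]] complex_Re_le_cmod order_trans by blast
  also have "\<dots> \<le> (M * nrm ?g) * nrm v"
    using comp_le[OF p M g] v N_H by (intro mult_right_mono) auto
  finally show "(nrm ?g)\<^sup>2 \<le> M * nrm v * nrm ?g"
    by (simp only: mult_ac)
qed

lemma le_adj:
  assumes p: "cpolynomial p" and C: "C \<ge> 0" "\<And>v. v \<in> N \<Longrightarrow> nrm (adj (on_ball p) v) \<le> C * nrm v" and x: "x \<in> X"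
  shows "cmod (p x) \<le> C"
proof (rule le_comp[OF p C(1) _ x], rule self_bound)
  note P = multiplier_on_ball[OF p]
  fix f assume f: "f \<in> N"
  let ?g = "poly_comp p f"
  have g: "?g \<in> N"
    using P f by simp
  then show "?g \<in> H" by (rule N_H)
  show "0 \<le> C * nrm f"
    using C f N_H by simp
  have "(nrm ?g)\<^sup>2 = Re (ip f (adj (on_ball p) ?g))"
    using Re_ip_self[OF N_H[OF g]] ip_comp[OF P f g] ip_adj[OF P N_H[OF g] N_H[OF f]] by simp
  also have "\<dots> \<le> nrm f * nrm (adj (on_ball p) ?g)"
    using Cauchy_Schwarz[OF N_H[OF f] N_H[OF N_adj[OF P g]]] complex_Re_le_cmod order_trans by blast
  also have "\<dots> \<le> nrm f * (C * nrm ?g)"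
    using C(2)[OF g] f N_H by (intro mult_left_mono) auto
  finally show "(nrm ?g)\<^sup>2 \<le> C * nrm f * nrm ?g"
    by (simp only: mult_ac)
qed

text \<open>The quadratic rate strengthens \<open>|g| < 1\<close> off \<open>x\<close>; it is what
  gives powers of \<open>g\<close> an explicit decay.\<close>

definition strong_peak :: "complex ^ 'd \<Rightarrow> bool" where
  "strong_peak x \<longleftrightarrow> x \<in> X \<and> (\<exists>g c. cpolynomial g \<and> c > 0 \<and> g x = 1 \<and>
     (\<forall>z\<in>X. (cmod (g z))\<^sup>2 \<le> 1 - c * (norm (z - x))\<^sup>2))"

text \<open>
  If \<open>x\<close> maximises \<open>F z = \<bar>p z\<bar>\<^sup>2 + \<epsilon> \<parallel>z\<parallel>\<^sup>2\<close>, then the polynomial \<open>h z = p z \<cdot> cnj (p x) + \<epsilon> \<langle>z, x\<rangle>\<close>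
  takes its maximal modulus \<open>F x\<close> at \<open>x\<close>, and averaging \<open>h\<close> with the constant \<open>F x\<close> makes \<open>x\<close> the only
  such point.
\<close>

lemma maximizer_strong_peak:
  assumes p: "cpolynomial p" and \<epsilon>: "\<epsilon> > 0"
  obtains x where "strong_peak x"
    "\<And>z. z \<in> X \<Longrightarrow> (cmod (p z))\<^sup>2 + \<epsilon> * (norm z)\<^sup>2 \<le> (cmod (p x))\<^sup>2 + \<epsilon> * (norm x)\<^sup>2"
proof -
  define F where "F z = (cmod (p z))\<^sup>2 + \<epsilon> * (norm z)\<^sup>2" for z
  have "continuous_on X F"
    unfolding F_def by (intro continuous_intros cpolynomial_continuous[OF p])
  then obtain x where x: "x \<in> X" and max: "\<And>z. z \<in> X \<Longrightarrow> F z \<le> F x"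
    using continuous_attains_sup[OF X_compact X_ne] by blast
  have F0: "F z \<ge> 0" for z
    using \<epsilon> by (simp add: F_def)
  have "strong_peak x"
  proof (cases "F x = 0")
    \<comment> \<open>Here the maximal value 0 forces \<open>X\<close> to consist of the origin, and
      the constant 1 peaks.\<close>
    case True
    have z0: "z = 0" if "z \<in> X" for z
    proof -
      have "F z = 0"
        using max[OF that] F0[of z] True by simp
      moreover have "0 \<le> (cmod (p z))\<^sup>2" "0 \<le> \<epsilon> * (norm z)\<^sup>2"
        using \<epsilon> by auto
      ultimately have "\<epsilon> * (norm z)\<^sup>2 = 0"
        unfolding F_def by linarith
      then show ?thesis
        using \<epsilon> by simp
    qed
    show ?thesis
      unfolding strong_peak_def
    proof (intro conjI x exI[of _ "\<lambda>_. 1"] exI[of _ "1::real"] ballI)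
      fix z assume "z \<in> X"
      then show "(cmod 1)\<^sup>2 \<le> 1 - 1 * (norm (z - x))\<^sup>2"
        using z0[OF \<open>z \<in> X\<close>] z0[OF x] by simp
    qed (auto intro: cpolynomial_const)
  next
    case False
    define M where "M = F x"
    have M: "M > 0"
      using False F0[of x] by (simp add: M_def)
    define h where "h z = p z * cnj (p x) + of_real \<epsilon> * cdot z x" for z
    define g where "g z = of_real (1 / (2 * M)) * (h z + of_real M)" for z
    have "cpolynomial h"
      unfolding h_def cdot_def
      by (intro cpolynomial_add cpolynomial_mult p cpolynomial_const cpolynomial_sum cpolynomial_coord)
    then have gp: "cpolynomial g"
      unfolding g_def by (intro cpolynomial_mult cpolynomial_add cpolynomial_const)
    have "h x = of_real M"
      unfolding h_def cdot_self M_def F_def by (simp add: complex_norm_square[symmetric])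
    then have gx: "g x = 1"
      using M by (simp add: g_def)
    have "(cmod (g z))\<^sup>2 \<le> 1 - \<epsilon> / (4 * M) * (norm (z - x))\<^sup>2" if z: "z \<in> X" for z
    proof -
      have "cmod (h z) \<le> cmod (p z) * cmod (p x) + \<epsilon> * cmod (cdot z x)"
        unfolding h_def using \<epsilon> norm_triangle_ineq[of "p z * cnj (p x)" "of_real \<epsilon> * cdot z x"]
        by (simp add: norm_mult)
      also have "\<dots> \<le> cmod (p z) * cmod (p x) + \<epsilon> * (norm z * norm x)"
        using \<epsilon> cmod_cdot_le[of z x] by simp
      also have "\<dots> \<le> ((cmod (p z))\<^sup>2 + (cmod (p x))\<^sup>2) / 2 + \<epsilon> * (((norm z)\<^sup>2 + (norm x)\<^sup>2) / 2)"
        using \<epsilon> sum_squares_bound[of "cmod (p z)" "cmod (p x)"] sum_squares_bound[of "norm z" "norm x"]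
        by (intro add_mono mult_left_mono) auto
      also have "\<dots> = (F z + F x) / 2"
        by (simp add: F_def field_simps)
      also have "\<dots> \<le> M"
        using max[OF z] by (simp add: M_def)
      finally have hM: "(cmod (h z))\<^sup>2 \<le> M\<^sup>2"
        by (intro power_mono) auto
      have Rep: "2 * Re (p z * cnj (p x)) = (cmod (p z))\<^sup>2 + (cmod (p x))\<^sup>2 - (cmod (p z - p x))\<^sup>2"
        unfolding cmod_power2 by (simp add: power2_eq_square algebra_simps)
      \<comment> \<open>Polarising both products leaves the defect
        \<open>\<epsilon> |z - x|^2\<close>, the origin of the quadratic rate.\<close>
      have "2 * Re (h z) = 2 * Re (p z * cnj (p x)) + \<epsilon> * (2 * Re (cdot z x))"
        by (simp add: h_def)
      also have "\<dots> = F z + F x - (cmod (p z - p x))\<^sup>2 - \<epsilon> * (norm (z - x))\<^sup>2"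
        unfolding Rep Re_cdot F_def by (simp add: field_simps)
      also have "\<dots> \<le> 2 * M - \<epsilon> * (norm (z - x))\<^sup>2"
        using max[OF z] zero_le_power2[of "cmod (p z - p x)"] unfolding M_def by linarith
      finally have "M * (2 * Re (h z)) \<le> M * (2 * M - \<epsilon> * (norm (z - x))\<^sup>2)"
        using M by (intro mult_left_mono) auto
      moreover have "(cmod (h z + of_real M))\<^sup>2 = (cmod (h z))\<^sup>2 + M * (2 * Re (h z)) + M\<^sup>2"
        unfolding cmod_power2 by (simp add: power2_eq_square algebra_simps)
      ultimately have "(cmod (h z + of_real M))\<^sup>2 \<le> 4 * M\<^sup>2 - M * \<epsilon> * (norm (z - x))\<^sup>2"
        using hM by (simp add: power2_eq_square algebra_simps)
      then have "(cmod (h z + of_real M))\<^sup>2 / (4 * M\<^sup>2) \<le> (4 * M\<^sup>2 - M * \<epsilon> * (norm (z - x))\<^sup>2) / (4 * M\<^sup>2)"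
        by (intro divide_right_mono) auto
      also have "\<dots> = 1 - \<epsilon> / (4 * M) * (norm (z - x))\<^sup>2"
        using M by (simp add: field_simps power2_eq_square)
      also have "(cmod (h z + of_real M))\<^sup>2 / (4 * M\<^sup>2) = (cmod (g z))\<^sup>2"
        using M by (simp add: g_def norm_mult norm_divide power_divide power_mult_distrib)
      finally show ?thesis .
    qed
    then show ?thesis
      unfolding strong_peak_def using x gp gx M \<epsilon>
      by (intro conjI exI[of _ g] exI[of _ "\<epsilon> / (4 * M)"]) auto
  qed
  then show ?thesis
    using max that by (simp add: F_def)
qed

text \<open>\<open>q\<close> is a power of the peaking polynomial \<open>g\<close>: with
  \<open>t = |z - x|^2\<close> the squared modulus of \<open>q z * (z $ j - x $ j)\<close> is at
  most \<open>t (1 - c t)^n\<close>.\<close>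

lemma strong_peak_sequence:
  assumes x: "strong_peak x" and \<delta>: "\<delta> > 0"
  obtains q where "cpolynomial q" "q x = 1" "\<And>z. z \<in> X \<Longrightarrow> cmod (q z) \<le> 1"
    "\<And>z j. z \<in> X \<Longrightarrow> cmod (q z * (z $ j - x $ j)) \<le> \<delta>"
proof -
  obtain g c where g: "cpolynomial g" "c > 0" "g x = 1"
    "\<And>z. z \<in> X \<Longrightarrow> (cmod (g z))\<^sup>2 \<le> 1 - c * (norm (z - x))\<^sup>2"
    using x unfolding strong_peak_def by blast
  obtain n :: nat where n: "n \<ge> 1" "1 / (c * n) \<le> \<delta>\<^sup>2"
  proof -
    obtain n :: nat where "1 / (c * \<delta>\<^sup>2) < n"
      using reals_Archimedean2 by blast
    moreover from this have "0 < real n"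
      using g(2) \<delta> by (smt (verit) divide_nonneg_nonneg mult_nonneg_nonneg zero_le_power2)
    ultimately show ?thesis
      using g(2) \<delta> by (intro that[of n]) (auto simp: field_simps)
  qed
  show ?thesis
  proof (rule that[of "\<lambda>z. g z ^ n"])
    show "cpolynomial (\<lambda>z. g z ^ n)"
      using g by (intro cpolynomial_power)
    show "g x ^ n = 1"
      using g by simp
  next
    fix z assume z: "z \<in> X"
    have "(cmod (g z))\<^sup>2 \<le> 1\<^sup>2"
      using g(4)[OF z] g(2) by (smt (verit) mult_nonneg_nonneg power_one zero_le_power2)
    then have "cmod (g z) \<le> 1"
      by (rule power2_le_imp_le) simp
    then show "cmod (g z ^ n) \<le> 1"
      by (simp add: norm_power power_le_one)
  next
    fix z j assume z: "z \<in> X"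
    have "cmod (z $ j - x $ j) \<le> norm (z - x)"
      using Finite_Cartesian_Product.norm_nth_le[of "z - x" j] by simp
    then have "(cmod (g z ^ n * (z $ j - x $ j)))\<^sup>2 \<le> ((cmod (g z))\<^sup>2) ^ n * (norm (z - x))\<^sup>2"
    proof -
      have "(cmod (g z ^ n * (z $ j - x $ j)))\<^sup>2 = ((cmod (g z))\<^sup>2) ^ n * (cmod (z $ j - x $ j))\<^sup>2"
        by (simp only: norm_mult norm_power power_mult_distrib power_mult[symmetric] mult.commute)
      then show ?thesis
        using \<open>cmod (z $ j - x $ j) \<le> norm (z - x)\<close> by (simp add: mult_left_mono power_mono)
    qed
    also have "\<dots> \<le> (1 - c * (norm (z - x))\<^sup>2) ^ n * (norm (z - x))\<^sup>2"
      using g(4)[OF z] by (intro mult_right_mono power_mono) auto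
    also have "\<dots> \<le> 1 / (c * n)"
    proof -
      have "c * (norm (z - x))\<^sup>2 \<le> 1"
        using g(4)[OF z] zero_le_power2[of "cmod (g z)"] by linarith
      then show ?thesis
        using times_power_bound[of "(norm (z - x))\<^sup>2" c n] g(2) n(1) by (simp add: mult.commute)
    qed
    also have "\<dots> \<le> \<delta>\<^sup>2"
      by (rule n(2))
    finally show "cmod (g z ^ n * (z $ j - x $ j)) \<le> \<delta>"
      by (rule power2_le_imp_le) (use \<delta> in simp)
  qed
qed

lemma adj_poly_shift:
  assumes q: "cpolynomial q" and v: "v \<in> H"
  shows "adj (on_ball (\<lambda>z. q z * (z $ j - x $ j))) v
    = L j (adj (on_ball q) v) - cscale (cnj (x $ j)) (adj (on_ball q) v)"
proof -
  note Q = multiplier_on_ball[OF q]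
  have *: "on_ball (\<lambda>z. z $ j - x $ j) = coord j - cscale (x $ j) (indicator (ball 0 1))"
    unfolding on_ball_diff on_ball_const coord_def ..
  have "multiplier (coord j - cscale (x $ j) (indicator (ball 0 1)))"
    by (intro multiplier_diff multiplier_coord multiplier_scale multiplier_unit)
  then show ?thesis
    unfolding on_ball_mult * using Q v by (simp add: adj_times adj_coord_shift)
qed

text \<open>Because \<open>q x = 1\<close>, some \<open>v\<close> keeps more than half of its norm
  under \<open>adj (on_ball q)\<close>, whereas the adjoint of \<open>q (z_j - x_j)\<close> is small
  on all of \<open>N\<close>. The normalised image of \<open>v\<close> is therefore almost an
  eigenvector.\<close>

lemma strong_peak_approx_eigenvalue:
  assumes x: "strong_peak x"
  shows "approx_eigenvalue x"
  unfolding approx_eigenvalue_def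
proof (intro allI impI)
  fix \<eta> :: real assume \<eta>: "\<eta> > 0"
  obtain q where q: "cpolynomial q" "q x = 1" and qX: "\<And>z j. z \<in> X \<Longrightarrow> cmod (q z * (z $ j - x $ j)) \<le> \<eta> / 2"
    by (rule strong_peak_sequence[OF x half_gt_zero[OF \<eta>]]) (rule that; blast)
  note Q = multiplier_on_ball[OF q(1)]
  have "\<exists>v\<in>N. nrm (adj (on_ball q) v) > 1/2 * nrm v"
  proof (rule ccontr)
    assume "\<not> ?thesis"
    then have "cmod (q x) \<le> 1/2"
      using x by (intro le_adj[OF q(1)]) (auto simp: not_less strong_peak_def)
    then show False
      using q by simp
  qed
  then obtain v where v: "v \<in> N" "nrm (adj (on_ball q) v) > 1/2 * nrm v"
    by blast
  let ?w = "adj (on_ball q) v"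
  have w: "?w \<in> N"
    using Q v by simp
  have pos: "nrm ?w > 0"
    using v nrm_nonneg[OF N_H[OF v(1)]] by linarith
  have cp: "cpolynomial (\<lambda>z. q z * (z $ j - x $ j))" for j
    by (intro cpolynomial_mult q cpolynomial_diff cpolynomial_coord cpolynomial_const)
  let ?t = "complex_of_real (1 / nrm ?w)"
  let ?y = "cscale ?t ?w"
  have "nrm (L j ?y - cscale (cnj (x $ j)) ?y) \<le> \<eta>" for j
  proof -
    have "nrm (L j ?w - cscale (cnj (x $ j)) ?w) \<le> \<eta> / 2 * nrm v"
      using adj_le[OF cp qX v(1)] unfolding adj_poly_shift[OF q(1) N_H[OF v(1)]] .
    also have "\<dots> \<le> \<eta> / 2 * (2 * nrm ?w)"
      using v(2) \<eta> by (intro mult_left_mono) auto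
    finally have le: "nrm (L j ?w - cscale (cnj (x $ j)) ?w) \<le> \<eta> * nrm ?w"
      by simp
    have "L j ?y - cscale (cnj (x $ j)) ?y = cscale ?t (L j ?w - cscale (cnj (x $ j)) ?w)"
      unfolding adj_scale[OF multiplier_coord N_H[OF w]] cfun.scale_right_diff_distrib
      by (simp only: cfun.scale_scale mult.commute)
    then have "nrm (L j ?y - cscale (cnj (x $ j)) ?y) = nrm (L j ?w - cscale (cnj (x $ j)) ?w) / nrm ?w"
      using nrm_scale[of "L j ?w - cscale (cnj (x $ j)) ?w" ?t] w pos N_H
      by (simp add: norm_divide)
    also have "\<dots> \<le> \<eta>"
      using le pos by (simp add: field_simps)
    finally show ?thesis .
  qed
  moreover have "nrm ?y = 1"
    using nrm_scale[OF N_H[OF w], of ?t] pos by (simp add: norm_divide)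
  moreover have "?y \<in> N"
    using w by simp
  ultimately show "\<exists>y\<in>N. nrm y = 1 \<and> (\<forall>j. nrm (L j y - cscale (cnj (x $ j)) y) \<le> \<eta>)"
    by blast
qed

end

section \<open>Peak points inside the ball and on the sphere\<close>

context maximal_cnp_space begin

text \<open>Boundedness in \<open>H\<close> replaces unit norm and membership in \<open>N\<close>:
  the class is then closed under the \<open>L j\<close> and admits the corrected vectors of
  \<open>interior_approx_eigenvalue\<close>, whose correction by \<open>kern x\<close> is not yet
  known to stay in \<open>N\<close>.\<close>

definition approx_seq :: "complex ^ 'd \<Rightarrow> (nat \<Rightarrow> (complex ^ 'd) cfun) \<Rightarrow> bool" where
  "approx_seq x y \<longleftrightarrow> (\<forall>i. y i \<in> H) \<and> (\<exists>C. \<forall>i. nrm (y i) \<le> C) \<and>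
     (\<forall>j. (\<lambda>i. nrm (L j (y i) - cscale (cnj (x $ j)) (y i))) \<longlonglongrightarrow> 0)"

lemma L_commute: "v \<in> H \<Longrightarrow> L j (L i v) = L i (L j v)"
  using adj_times[OF multiplier_coord multiplier_coord, of v i j]
    adj_times[OF multiplier_coord multiplier_coord, of v j i] by (simp add: mult.commute)

lemma approx_seq_L:
  assumes y: "approx_seq x y"
  shows "approx_seq x (\<lambda>i. L j (y i))"
proof -
  have yH: "y i \<in> H" for i
    using y by (simp add: approx_seq_def)
  obtain C where C: "\<And>i. nrm (y i) \<le> C"
    using y by (auto simp: approx_seq_def)
  obtain D where D: "D \<ge> 0" "\<And>v. v \<in> H \<Longrightarrow> nrm (L j v) \<le> D * nrm v"
    using adj_bounded[OF multiplier_coord] by blast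
  have "nrm (L j (y i)) \<le> D * C" for i
    using D(2)[OF yH] mult_left_mono[OF C[of i] D(1)] order_trans by blast
  moreover have "(\<lambda>i. nrm (L k (L j (y i)) - cscale (cnj (x $ k)) (L j (y i)))) \<longlonglongrightarrow> 0" for k
  proof -
    have "(\<lambda>i. nrm (L k (y i) - cscale (cnj (x $ k)) (y i))) \<longlonglongrightarrow> 0"
      using y by (simp add: approx_seq_def)
    then have lim: "(\<lambda>i. D * nrm (L k (y i) - cscale (cnj (x $ k)) (y i))) \<longlonglongrightarrow> 0"
      by (rule tendsto_mult_right_zero)
    have eq: "L k (L j (y i)) - cscale (cnj (x $ k)) (L j (y i)) = L j (L k (y i) - cscale (cnj (x $ k)) (y i))" for i
      by (simp only: adj_diff[OF multiplier_coord L_mem[OF yH] scale_mem[OF yH]]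
          adj_scale[OF multiplier_coord yH] L_commute[OF yH, of j k])
    have mem: "L k (y i) - cscale (cnj (x $ k)) (y i) \<in> H" for i
      using yH by simp
    show ?thesis
      unfolding eq
      by (rule Lim_null_comparison[OF _ lim]) (use D(2)[OF mem] mem in simp)
  qed
  ultimately show ?thesis
    unfolding approx_seq_def using yH by auto
qed

text \<open>Asymptotically each \<open>L j\<close> multiplies \<open>q\<close> by
  \<open>|x_j|^2\<close>, so a sum over \<open>j\<close> multiplies it by \<open>|x|^2\<close>. The
  induction needs the relation for all approximate sequences, since it passes from \<open>y\<close>
  to \<open>L j y\<close>.\<close>

lemma wform_approx_seq:
  assumes q: "\<And>y j. approx_seq x y \<Longrightarrow> (\<lambda>i. q (L j (y i)) - (cmod (x $ j))\<^sup>2 * q (y i)) \<longlonglongrightarrow> 0"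
    and y: "approx_seq x y"
  shows "(\<lambda>i. wform q n (y i) - norm x ^ (2 * n) * q (y i)) \<longlonglongrightarrow> 0"
  using y
proof (induction n arbitrary: y)
  case (Suc n)
  have "(\<lambda>i. \<Sum>j\<in>UNIV. (wform q n (L j (y i)) - norm x ^ (2 * n) * q (L j (y i)))
      + norm x ^ (2 * n) * (q (L j (y i)) - (cmod (x $ j))\<^sup>2 * q (y i))) \<longlonglongrightarrow> (\<Sum>j\<in>(UNIV :: 'd set). 0 + norm x ^ (2 * n) * 0)"
    by (intro tendsto_sum tendsto_add tendsto_mult tendsto_const q Suc.IH approx_seq_L Suc.prems)
  moreover have "(\<Sum>j\<in>UNIV. (wform q n (L j (y i)) - norm x ^ (2 * n) * q (L j (y i)))
      + norm x ^ (2 * n) * (q (L j (y i)) - (cmod (x $ j))\<^sup>2 * q (y i)))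
      = wform q (Suc n) (y i) - norm x ^ (2 * Suc n) * q (y i)" for i
  proof -
    have "norm x ^ (2 * Suc n) * q (y i) = (\<Sum>j\<in>UNIV. norm x ^ (2 * n) * ((cmod (x $ j))\<^sup>2 * q (y i)))"
    proof -
      have "norm x ^ (2 * Suc n) * q (y i) = norm x ^ (2 * n) * ((norm x)\<^sup>2 * q (y i))"
        by (simp add: power2_eq_square)
      then show ?thesis
        by (simp only: norm_vec_sq sum_distrib_right sum_distrib_left)
    qed
    then show ?thesis
      by (simp add: sum.distrib sum_subtractf right_diff_distrib)
  qed
  ultimately show ?case
    by simp
qed simp

lemma dform_approx_seq:
  assumes y: "approx_seq x y"
  shows "(\<lambda>i. dform n (y i) - norm x ^ (2 * n) * (nrm (y i))\<^sup>2) \<longlonglongrightarrow> 0"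
proof (rule wform_approx_seq[OF _ y])
  fix y j assume y: "approx_seq x y"
  let ?c = "cnj (x $ j)"
  have yH: "y i \<in> H" and LyH: "L j (y i) \<in> H" for i
    using y by (simp_all add: approx_seq_def)
  obtain C where C: "\<And>i. nrm (y i) \<le> C"
    using y by (auto simp: approx_seq_def)
  obtain D where D: "\<And>i. nrm (L j (y i)) \<le> D"
    using approx_seq_L[OF y, of j] by (auto simp: approx_seq_def)
  have "(\<lambda>i. (D + cmod (x $ j) * C) * nrm (L j (y i) - cscale ?c (y i))) \<longlonglongrightarrow> 0"
    using y unfolding approx_seq_def by (intro tendsto_mult_right_zero) blast
  then show "(\<lambda>i. (nrm (L j (y i)))\<^sup>2 - (cmod (x $ j))\<^sup>2 * (nrm (y i))\<^sup>2) \<longlonglongrightarrow> 0"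
  proof (rule Lim_null_comparison[rotated], intro always_eventually allI)
    fix i
    let ?u = "nrm (L j (y i))" and ?v = "nrm (cscale ?c (y i))"
    have v: "?v = cmod (x $ j) * nrm (y i)"
      using yH by simp
    have nn: "0 \<le> ?u" "0 \<le> ?v"
      using yH LyH by simp_all
    have "?u\<^sup>2 - ?v\<^sup>2 = (?u + ?v) * (?u - ?v)"
      by (simp add: power2_eq_square algebra_simps)
    then have "\<bar>?u\<^sup>2 - ?v\<^sup>2\<bar> = (?u + ?v) * \<bar>?u - ?v\<bar>"
      using nn by (simp add: abs_mult)
    also have "\<dots> \<le> (D + cmod (x $ j) * C) * nrm (L j (y i) - cscale ?c (y i))"
    proof (intro mult_mono add_mono D)
      show "?v \<le> cmod (x $ j) * C"
        unfolding v by (intro mult_left_mono C) simp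
      show "\<bar>?u - ?v\<bar> \<le> nrm (L j (y i) - cscale ?c (y i))"
        by (rule nrm_reverse_triangle[OF LyH scale_mem[OF yH]])
      have "0 \<le> D"
        using nrm_nonneg[OF LyH] D order_trans by blast
      moreover have "0 \<le> C"
        using nrm_nonneg[OF yH] C order_trans by blast
      ultimately show "0 \<le> D + cmod (x $ j) * C"
        by simp
    qed simp
    finally show "norm ((nrm (L j (y i)))\<^sup>2 - (cmod (x $ j))\<^sup>2 * (nrm (y i))\<^sup>2)
        \<le> (D + cmod (x $ j) * C) * nrm (L j (y i) - cscale ?c (y i))"
      by (simp add: v power_mult_distrib)
  qed
qed

text \<open>Evaluation at the origin is bounded by the norm of \<open>kern 0\<close>, so
  \<open>|v 0|^2\<close> satisfies the one-step relation, and it starts from 0.\<close>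

lemma eform_approx_seq_null:
  assumes y: "approx_seq x y" and y0: "\<And>i. y i 0 = 0"
  shows "(\<lambda>i. eform n (y i)) \<longlonglongrightarrow> 0"
proof -
  have "(\<lambda>i. eform n (y i) - norm x ^ (2 * n) * (cmod (y i 0))\<^sup>2) \<longlonglongrightarrow> 0"
  proof (rule wform_approx_seq[OF _ y])
    fix y j assume y: "approx_seq x y"
    let ?c = "cnj (x $ j)"
    have yH: "y i \<in> H" and LyH: "L j (y i) \<in> H" for i
      using y by (simp_all add: approx_seq_def)
    obtain C where C: "\<And>i. nrm (y i) \<le> C"
      using y by (auto simp: approx_seq_def)
    obtain D where D: "\<And>i. nrm (L j (y i)) \<le> D"
      using approx_seq_L[OF y, of j] by (auto simp: approx_seq_def)
    define E where "E = nrm (kern 0)"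
    have E0: "E \<ge> 0"
      by (simp add: E_def)
    have ev: "cmod (v 0) \<le> nrm v * E" if "v \<in> H" for v
      using Cauchy_Schwarz[OF that, of "kern 0"] ip_kern[OF that, of 0] by (simp add: E_def)
    have "(\<lambda>i. ((D * E + cmod (x $ j) * (C * E)) * E) * nrm (L j (y i) - cscale ?c (y i))) \<longlonglongrightarrow> 0"
      using y unfolding approx_seq_def by (intro tendsto_mult_right_zero) blast
    then show "(\<lambda>i. (cmod (L j (y i) 0))\<^sup>2 - (cmod (x $ j))\<^sup>2 * (cmod (y i 0))\<^sup>2) \<longlonglongrightarrow> 0"
    proof (rule Lim_null_comparison[rotated], intro always_eventually allI)
      fix i
      let ?u = "L j (y i) 0" and ?v = "?c * y i 0"
      have "(cmod ?u)\<^sup>2 - (cmod ?v)\<^sup>2 = (cmod ?u + cmod ?v) * (cmod ?u - cmod ?v)"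
        by (simp add: power2_eq_square algebra_simps)
      then have "\<bar>(cmod ?u)\<^sup>2 - (cmod ?v)\<^sup>2\<bar> = (cmod ?u + cmod ?v) * \<bar>cmod ?u - cmod ?v\<bar>"
        by (simp add: abs_mult)
      also have "\<dots> \<le> (D * E + cmod (x $ j) * (C * E)) * (nrm (L j (y i) - cscale ?c (y i)) * E)"
      proof (intro mult_mono add_mono)
        show "cmod ?u \<le> D * E"
          using ev[OF LyH] mult_right_mono[OF D E0] order_trans by blast
        have "cmod (y i 0) \<le> C * E"
          using ev[OF yH] mult_right_mono[OF C E0] order_trans by blast
        then show "cmod ?v \<le> cmod (x $ j) * (C * E)"
          by (simp add: norm_mult mult_left_mono)
        have "\<bar>cmod ?u - cmod ?v\<bar> \<le> cmod (?u - ?v)"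
          by (rule norm_triangle_ineq3)
        also have "?u - ?v = (L j (y i) - cscale ?c (y i)) 0"
          by (simp add: cscale_def)
        also have "cmod \<dots> \<le> nrm (L j (y i) - cscale ?c (y i)) * E"
          by (rule ev[OF diff_mem[OF LyH scale_mem[OF yH]]])
        finally show "\<bar>cmod ?u - cmod ?v\<bar> \<le> nrm (L j (y i) - cscale ?c (y i)) * E" .
        have "0 \<le> D"
          using nrm_nonneg[OF LyH] D order_trans by blast
        moreover have "0 \<le> C"
          using nrm_nonneg[OF yH] C order_trans by blast
        ultimately show "0 \<le> D * E + cmod (x $ j) * (C * E)"
          using E0 by simp
      qed auto
      finally show "norm ((cmod ?u)\<^sup>2 - (cmod (x $ j))\<^sup>2 * (cmod (y i 0))\<^sup>2)
          \<le> ((D * E + cmod (x $ j) * (C * E)) * E) * nrm (L j (y i) - cscale ?c (y i))"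
        by (simp add: norm_mult power_mult_distrib mult_ac)
    qed
  qed
  then show ?thesis
    by (simp add: y0)
qed

lemma sum_b_tendsto: "(\<lambda>m. \<Sum>n=1..m. b n) \<longlonglongrightarrow> 1"
  using b_sums unfolding sums_def by (simp add: sum.atLeast1_atMost_eq lessThan_Suc_atMost)

text \<open>In the limit \<open>row_contraction\<close> gives
  \<open>\<Sum> b_n |x|^(2n) \<le> 1\<close>, while the \<open>b_n\<close> alone already sum to 1.
  For \<open>|x| > 1\<close> any positive \<open>b_k\<close> would exceed this.\<close>

lemma approx_seq_norm_le_1:
  assumes y: "approx_seq x y" and y1: "\<And>i. nrm (y i) = 1"
  shows "norm x \<le> 1"
proof (rule ccontr)
  assume "\<not> norm x \<le> 1"
  then have x: "norm x > 1" by simp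
  have yH: "y i \<in> H" for i
    using y by (simp add: approx_seq_def)
  have le1: "(\<Sum>n=1..m. b n * norm x ^ (2 * n)) \<le> 1" for m
  proof -
    have "(\<lambda>i. \<Sum>n=1..m. b n * (dform n (y i) - norm x ^ (2 * n) * (nrm (y i))\<^sup>2 + norm x ^ (2 * n)))
        \<longlonglongrightarrow> (\<Sum>n=1..m. b n * (0 + norm x ^ (2 * n)))"
      by (intro tendsto_intros dform_approx_seq y)
    then have lim: "(\<lambda>i. \<Sum>n=1..m. b n * dform n (y i)) \<longlonglongrightarrow> (\<Sum>n=1..m. b n * norm x ^ (2 * n))"
      by (simp add: y1)
    have "(\<Sum>n=1..m. b n * dform n (y i)) \<le> 1" for i
      using row_contraction[OF yH, of i m] zero_le_power2[of "cmod (y i 0)"] unfolding y1 power_one by linarith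
    then show ?thesis
      by (intro LIMSEQ_le_const2[OF lim]) blast
  qed
  have "\<exists>k\<ge>1. b k \<noteq> 0"
  proof (rule ccontr)
    assume "\<not> ?thesis"
    then have "(\<lambda>m. \<Sum>n=1..m. b n) = (\<lambda>m. 0)"
      by (auto simp: fun_eq_iff)
    then show False
      using sum_b_tendsto by (simp add: LIMSEQ_const_iff)
  qed
  then obtain k where k: "k \<ge> 1" "b k > 0"
    using b_nonneg by (metis less_le)
  define d where "d = b k * (norm x ^ (2 * k) - 1)"
  have "norm x ^ (2 * k) > 1"
    using x k by (intro one_less_power) auto
  then have d: "d > 0"
    using k by (simp add: d_def)
  have "(\<Sum>n=1..m. b n) \<le> 1 - d" if "m \<ge> k" for m
  proof -
    have "d \<le> (\<Sum>n=1..m. b n * (norm x ^ (2 * n) - 1))"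
      unfolding d_def using k that x b_nonneg
      by (intro member_le_sum[of k "{1..m}" "\<lambda>n. b n * (norm x ^ (2 * n) - 1)"]) (auto intro!: mult_nonneg_nonneg one_le_power)
    also have "\<dots> = (\<Sum>n=1..m. b n * norm x ^ (2 * n)) - (\<Sum>n=1..m. b n)"
      by (simp add: right_diff_distrib sum_subtractf)
    finally show ?thesis
      using le1[of m] by simp
  qed
  then have "1 \<le> 1 - d"
    by (intro LIMSEQ_le_const2[OF sum_b_tendsto]) blast
  with d show False by simp
qed

end

context cnp_quotient begin

lemma approx_eigenvalue_seq:
  assumes "approx_eigenvalue x"
  obtains y where "\<And>i. y i \<in> N" "\<And>i. nrm (y i) = 1" "approx_seq x y"
proof -
  have "\<forall>i. \<exists>y\<in>N. nrm y = 1 \<and> (\<forall>j. nrm (L j y - cscale (cnj (x $ j)) y) \<le> 1 / real (Suc i))"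
    using assms unfolding approx_eigenvalue_def by simp
  then obtain y where y: "\<And>i. y i \<in> N" "\<And>i. nrm (y i) = 1"
    and ev: "\<And>i j. nrm (L j (y i) - cscale (cnj (x $ j)) (y i)) \<le> 1 / real (Suc i)"
    by metis
  have lim: "(\<lambda>i. 1 / real (Suc i)) \<longlonglongrightarrow> 0"
    by (intro LIMSEQ_Suc lim_1_over_n)
  have mem: "L j (y i) - cscale (cnj (x $ j)) (y i) \<in> H" for i j
    using N_H[OF y(1)] by simp
  have "(\<lambda>i. nrm (L j (y i) - cscale (cnj (x $ j)) (y i))) \<longlonglongrightarrow> 0" for j
    by (rule Lim_null_comparison[OF _ lim], rule always_eventually)
      (use ev nrm_nonneg[OF mem] in \<open>simp only: real_norm_def abs_of_nonneg\<close>, blast)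
  then have "approx_seq x y"
    unfolding approx_seq_def using N_H[OF y(1)] y(2) by auto
  with y that show ?thesis by blast
qed

text \<open>
  Correcting the approximate eigenvectors by multiples of the kernel function makes them vanish at the
  origin, so that essential coisometry of the row of coordinates forces the corrections to tend to \<open>0\<close>.
\<close>

lemma interior_approx_eigenvalue:
  assumes "approx_eigenvalue x" and x: "norm x < 1"
  shows "kern x \<in> N"
proof -
  obtain y where yN: "\<And>i. y i \<in> N" and y1: "\<And>i. nrm (y i) = 1" and y: "approx_seq x y"
    using approx_eigenvalue_seq[OF assms(1)] by blast
  let ?k = "kern x"
  have xb: "x \<in> ball 0 1"
    using x by simp
  have k: "?k \<in> H"
    using xb by simp
  have k0: "?k 0 = 1"
    by (simp add: kern_def kernel_0)
  have Lk: "L j ?k = cscale (cnj (x $ j)) ?k" for j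
    using adj_kern[OF multiplier_coord xb] xb by (simp add: coord_def on_ball_def)
  define z where "z i = y i - cscale (y i 0) ?k" for i
  have yH: "y i \<in> H" for i
    using yN N_H by blast
  have zH: "z i \<in> H" for i
    using yH k by (simp add: z_def)
  have z0: "z i 0 = 0" for i
    by (simp add: z_def k0 cscale_def)
  have z: "approx_seq x z"
  proof -
    have "nrm (z i) \<le> 1 + nrm (kern 0) * nrm ?k" for i
    proof -
      have "nrm (z i) \<le> nrm (y i) + cmod (y i 0) * nrm ?k"
        using nrm_diff_le[OF yH scale_mem[OF k], of i "y i 0"] k by (simp add: z_def)
      moreover have "cmod (y i 0) \<le> nrm (kern 0)"
        using Cauchy_Schwarz[OF yH, of "kern 0" i] ip_kern[OF yH, of 0 i] y1 by simp
      then have "cmod (y i 0) * nrm ?k \<le> nrm (kern 0) * nrm ?k"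
        using k by (intro mult_right_mono) auto
      ultimately show ?thesis
        using y1[of i] by linarith
    qed
    moreover have "L j (z i) - cscale (cnj (x $ j)) (z i) = L j (y i) - cscale (cnj (x $ j)) (y i)" for i j
      unfolding z_def adj_diff[OF multiplier_coord yH scale_mem[OF k]] adj_scale[OF multiplier_coord k] Lk
      by (simp add: cfun.scale_right_diff_distrib mult.commute)
    ultimately show ?thesis
      using y zH unfolding approx_seq_def by auto
  qed
  \<comment> \<open>Strictly between \<open>|x|^2\<close> and 1. Since \<open>dform 1\<close> of
    \<open>z i\<close> is asymptotically \<open>|x|^2\<close> times the squared norm, the positive
    gap \<open>\<theta> - |x|^2\<close> forces that norm to 0.\<close>
  define \<theta> where "\<theta> = (1 + (norm x)\<^sup>2) / 2"
  have "(norm x)\<^sup>2 < 1"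
    using x by (simp add: power_less_one_iff)
  then have \<theta>: "(norm x)\<^sup>2 < \<theta>" "\<theta> < 1"
    by (simp_all add: \<theta>_def)
  obtain m where m: "\<And>v. v \<in> H \<Longrightarrow> \<theta> * (nrm v)\<^sup>2 \<le> dform 1 v + (\<Sum>n\<le>m. a n * eform n v)"
    using row_essentially_coisometric[OF \<theta>(2)] by blast
  have zlim: "(\<lambda>i. nrm (z i)) \<longlonglongrightarrow> 0"
  proof -
    have "(\<lambda>i. (1 / (\<theta> - (norm x)\<^sup>2)) * ((dform 1 (z i) - norm x ^ (2 * 1) * (nrm (z i))\<^sup>2) + (\<Sum>n\<le>m. a n * eform n (z i))))
        \<longlonglongrightarrow> (1 / (\<theta> - (norm x)\<^sup>2)) * (0 + (\<Sum>n\<le>m. a n * 0))"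
      by (intro tendsto_intros dform_approx_seq[OF z] eform_approx_seq_null[OF z z0])
    then have lim: "(\<lambda>i. (1 / (\<theta> - (norm x)\<^sup>2)) * ((dform 1 (z i) - norm x ^ (2 * 1) * (nrm (z i))\<^sup>2) + (\<Sum>n\<le>m. a n * eform n (z i))))
        \<longlonglongrightarrow> 0"
      by simp
    have "(\<lambda>i. (nrm (z i))\<^sup>2) \<longlonglongrightarrow> 0"
    proof (rule Lim_null_comparison[OF _ lim], intro always_eventually allI)
      fix i
      have "(\<theta> - (norm x)\<^sup>2) * (nrm (z i))\<^sup>2 \<le> (dform 1 (z i) - norm x ^ (2 * 1) * (nrm (z i))\<^sup>2) + (\<Sum>n\<le>m. a n * eform n (z i))"
        using m[OF zH, of i] by (simp add: left_diff_distrib)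
      then have "(nrm (z i))\<^sup>2 \<le> ((dform 1 (z i) - norm x ^ (2 * 1) * (nrm (z i))\<^sup>2) + (\<Sum>n\<le>m. a n * eform n (z i))) / (\<theta> - (norm x)\<^sup>2)"
        using \<theta>(1) by (simp add: pos_le_divide_eq mult.commute)
      then show "norm ((nrm (z i))\<^sup>2) \<le> (1 / (\<theta> - (norm x)\<^sup>2)) *
          ((dform 1 (z i) - norm x ^ (2 * 1) * (nrm (z i))\<^sup>2) + (\<Sum>n\<le>m. a n * eform n (z i)))"
        by simp
    qed
    then have "(\<lambda>i. sqrt ((nrm (z i))\<^sup>2)) \<longlonglongrightarrow> sqrt 0"
      by (rule tendsto_real_sqrt)
    then show ?thesis
      using nrm_nonneg[OF zH] by simp
  qed
  show ?thesis
    unfolding N_iff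
  proof (intro conjI ballI k)
    fix \<phi> f assume \<phi>: "\<phi> \<in> \<aa>" and f: "f \<in> H"
    let ?h = "\<phi> * f"
    have h: "?h \<in> H"
      using ideal_multiplier[OF \<phi>] f by simp
    let ?D = "cmod (ip ?k ?h)"
    \<comment> \<open>\<open>y i\<close> is orthogonal to \<open>?h\<close> and equals
      \<open>z i\<close> plus a multiple of \<open>?k\<close>. As \<open>z i\<close> tends to 0 and
      \<open>y i\<close> has norm 1, this multiple stays away from 0, so \<open>?k\<close> itself is
      orthogonal to \<open>?h\<close>.\<close>
    have "(1 - nrm (z i)) * ?D \<le> nrm ?k * (nrm (z i) * nrm ?h)" for i
    proof -
      have "ip (y i) ?h = 0"
        using yN[of i] \<phi> f by (simp add: N_iff)
      moreover have "ip (z i) ?h = ip (y i) ?h - y i 0 * ip ?k ?h"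
        unfolding z_def ip_diff_left[OF yH scale_mem[OF k] h] ip_scale_left[OF k h] ..
      ultimately have 1: "cmod (y i 0) * ?D \<le> nrm (z i) * nrm ?h"
        using Cauchy_Schwarz[OF zH h, of i] by (simp add: norm_mult)
      have "y i = z i + cscale (y i 0) ?k"
        by (simp add: z_def)
      then have "1 \<le> nrm (z i) + cmod (y i 0) * nrm ?k"
        using nrm_triangle[OF zH scale_mem[OF k], of i "y i 0"] y1[of i] k by simp
      then have "(1 - nrm (z i)) * ?D \<le> (cmod (y i 0) * nrm ?k) * ?D"
        by (intro mult_right_mono) auto
      also have "\<dots> = nrm ?k * (cmod (y i 0) * ?D)"
        by simp
      also have "\<dots> \<le> nrm ?k * (nrm (z i) * nrm ?h)"
        using 1 k by (intro mult_left_mono) auto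
      finally show ?thesis .
    qed
    moreover have "(\<lambda>i. (1 - nrm (z i)) * ?D) \<longlonglongrightarrow> (1 - 0) * ?D"
      by (intro tendsto_intros zlim)
    moreover have "(\<lambda>i. nrm ?k * (nrm (z i) * nrm ?h)) \<longlonglongrightarrow> nrm ?k * (0 * nrm ?h)"
      by (intro tendsto_intros zlim)
    ultimately have "(1 - 0) * ?D \<le> nrm ?k * (0 * nrm ?h)"
      by (meson LIMSEQ_le)
    then show "ip ?k ?h = 0"
      by simp
  qed
qed

text \<open>A fixed vector of a contraction is fixed by its adjoint as well: compare the norms of
  \<open>k + t v\<close> and of its image \<open>k + t T v\<close> to first order in
  \<open>t\<close>.\<close>

lemma contraction_fixed_vector:
  assumes T: "\<And>v. v \<in> N \<Longrightarrow> T v \<in> N" "\<And>v. v \<in> N \<Longrightarrow> nrm (T v) \<le> nrm v"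
    "\<And>u v. \<lbrakk>u \<in> N; v \<in> N\<rbrakk> \<Longrightarrow> T (u + v) = T u + T v" "\<And>c v. v \<in> N \<Longrightarrow> T (cscale c v) = cscale c (T v)"
    and k: "k \<in> N" "T k = k" and v: "v \<in> N"
  shows "ip (T v) k = ip v k"
proof -
  note H = N_H[OF k(1)] N_H[OF v] N_H[OF T(1)[OF v]]
  have exp: "(nrm (k + cscale t u))\<^sup>2 = (nrm k)\<^sup>2 + 2 * Re (t * ip u k) + (cmod t)\<^sup>2 * (nrm u)\<^sup>2"
    if u: "u \<in> H" for t u
  proof -
    have "Re (ip k (cscale t u)) = Re (ip (cscale t u) k)"
      using ip_commute[OF H(1) scale_mem[OF u]] by simp
    then show ?thesis
      unfolding nrm_add_sq[OF H(1) scale_mem[OF u]] using H u by (simp add: ip_scale_left power_mult_distrib)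
  qed
  have "2 * Re (t * (ip (T v) k - ip v k)) \<le> (cmod t)\<^sup>2 * (nrm v)\<^sup>2" for t
  proof -
    have "T (k + cscale t v) = k + cscale t (T v)"
      using T(3)[OF k(1) N_scale[OF v]] T(4)[OF v] k(2) by simp
    then have "nrm (k + cscale t (T v)) \<le> nrm (k + cscale t v)"
      using T(2)[of "k + cscale t v"] k v by simp
    then have "(nrm (k + cscale t (T v)))\<^sup>2 \<le> (nrm (k + cscale t v))\<^sup>2"
      using H by (intro power_mono) auto
    then have "2 * Re (t * ip (T v) k) + (cmod t)\<^sup>2 * (nrm (T v))\<^sup>2 \<le> 2 * Re (t * ip v k) + (cmod t)\<^sup>2 * (nrm v)\<^sup>2"
      unfolding exp[OF H(2)] exp[OF H(3)] by simp
    moreover have "0 \<le> (cmod t)\<^sup>2 * (nrm (T v))\<^sup>2"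
      by simp
    moreover have "Re (t * (ip (T v) k - ip v k)) = Re (t * ip (T v) k) - Re (t * ip v k)"
      by (simp add: right_diff_distrib)
    ultimately show ?thesis
      by linarith
  qed
  from quadratic_perturbation_zero[OF this] show ?thesis
    by simp
qed

end

section \<open>A peak point inside the ball\<close>

context isometric_quotient begin

text \<open>\<open>adj (on_ball q)\<close> for a peaking \<open>q\<close> is a contraction on
  \<open>N\<close> fixing \<open>kern x\<close>, so applying it to \<open>?w\<close> does not change
  the pairing with \<open>kern x\<close>. But it turns \<open>?w\<close> into the adjoint of
  \<open>q (z_j - x_j)\<close> at \<open>v\<close>, which is arbitrarily small. Hence the complement
  of \<open>kern x\<close> in \<open>N\<close> is invariant under the \<open>L j\<close>.\<close>

lemma strong_peak_kern_reducing:
  assumes x: "strong_peak x" and nx: "norm x < 1" and v: "v \<in> N"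
  shows "ip (L j v) (kern x) = cnj (x $ j) * ip v (kern x)"
proof -
  have kN: "kern x \<in> N"
    by (rule interior_approx_eigenvalue[OF strong_peak_approx_eigenvalue[OF x] nx])
  have xb: "x \<in> ball 0 1"
    using nx by simp
  let ?w = "L j v - cscale (cnj (x $ j)) v"
  have w: "?w \<in> N"
    using v by simp
  have "cmod (ip ?w (kern x)) \<le> 0 + e" if e: "e > 0" for e
  proof -
    define \<delta> where "\<delta> = e / (nrm v * nrm (kern x) + 1)"
    have pos: "nrm v * nrm (kern x) + 1 > 0"
      using N_H[OF v] N_H[OF kN] by (simp add: add_nonneg_pos)
    then have \<delta>: "\<delta> > 0"
      using e by (simp add: \<delta>_def)
    obtain q where q: "cpolynomial q" "q x = 1" and q1: "\<And>z. z \<in> X \<Longrightarrow> cmod (q z) \<le> 1"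
      and qX: "\<And>z j. z \<in> X \<Longrightarrow> cmod (q z * (z $ j - x $ j)) \<le> \<delta>"
      by (rule strong_peak_sequence[OF x \<delta>]) (rule that; blast)
    note Q = multiplier_on_ball[OF q(1)]
    let ?T = "adj (on_ball q)"
    have cp: "cpolynomial (\<lambda>z. q z * (z $ j - x $ j))"
      by (intro cpolynomial_mult q cpolynomial_diff cpolynomial_coord cpolynomial_const)
    have Tk: "?T (kern x) = kern x"
      using adj_kern[OF Q xb] xb q(2) by (simp add: on_ball_def)
    have "ip (?T ?w) (kern x) = ip ?w (kern x)"
    proof (rule contraction_fixed_vector[where T = ?T, OF _ _ _ _ kN Tk w])
      show "nrm (?T v) \<le> nrm v" if "v \<in> N" for v
        using adj_le[OF q(1) q1 that] by simp
    qed (use Q N_H in \<open>simp_all add: adj_add adj_scale\<close>)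
    moreover have "?T ?w = adj (on_ball (\<lambda>z. q z * (z $ j - x $ j))) v"
      unfolding adj_poly_shift[OF q(1) N_H[OF v]] adj_diff[OF Q L_mem[OF N_H[OF v]] scale_mem[OF N_H[OF v]]]
        adj_scale[OF Q N_H[OF v]]
      using adj_times[OF Q multiplier_coord N_H[OF v], of j] adj_times[OF multiplier_coord Q N_H[OF v], of j]
      by (simp add: mult.commute)
    moreover have "nrm (adj (on_ball (\<lambda>z. q z * (z $ j - x $ j))) v) \<le> \<delta> * nrm v"
      by (rule adj_le[OF cp qX v])
    ultimately have "cmod (ip ?w (kern x)) \<le> \<delta> * nrm v * nrm (kern x)"
      using Cauchy_Schwarz[OF N_H[OF N_adj[OF Q w]] N_H[OF kN]] N_H[OF kN]
      by (smt (verit) mult_right_mono nrm_nonneg)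
    also have "\<dots> \<le> \<delta> * (nrm v * nrm (kern x) + 1)"
      using \<delta> by (simp add: algebra_simps)
    also have "\<dots> = e"
      using pos by (simp add: \<delta>_def)
    finally show ?thesis by simp
  qed
  then have "ip ?w (kern x) = 0"
    using field_le_epsilon[of "cmod (ip ?w (kern x))" 0] by simp
  then show ?thesis
    unfolding ip_diff_left[OF L_mem[OF N_H[OF v]] scale_mem[OF N_H[OF v]] N_H[OF kN]]
      ip_scale_left[OF N_H[OF v] N_H[OF kN]] by simp
qed

text \<open>Let \<open>v\<close> in \<open>N\<close> be orthogonal to \<open>kern x\<close> and
  apply \<open>row_contraction\<close> to \<open>v + t kern x\<close>. The kernel part has squared
  norm \<open>|t|^2 \<kappa>\<close>, of which the sum with weights \<open>b_n\<close> uses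
  \<open>|t|^2 \<kappa> (1 - 1/\<kappa>)\<close>, so exactly \<open>|t|^2\<close> is left:
  \<open>|v 0 + t|^2 \<le> |v|^2 + |t|^2\<close> for every \<open>t\<close>. This forces
  \<open>v 0 = 0\<close>, and invariance of the complement makes all Taylor coefficients
  vanish.\<close>

lemma interior_strong_peak:
  assumes x: "strong_peak x" and nx: "norm x < 1"
  shows "N \<subseteq> cfun.span {kern x}"
proof -
  let ?k = "kern x"
  have kN: "?k \<in> N"
    by (rule interior_approx_eigenvalue[OF strong_peak_approx_eigenvalue[OF x] nx])
  note kH = N_H[OF kN]
  have xb: "x \<in> ball 0 1"
    using nx by simp
  have k0: "?k 0 = 1"
    by (simp add: kern_def kernel_0)
  have Lk: "L j ?k = cscale (cnj (x $ j)) ?k" for j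
    using adj_kern[OF multiplier_coord xb] xb by (simp add: coord_def on_ball_def)
  define \<kappa> where "\<kappa> = (nrm ?k)\<^sup>2"
  have \<kappa>: "kernel a x x = of_real \<kappa>"
    using ip_self[OF kH] ip_kern_kern[OF xb xb] by (simp add: \<kappa>_def)
  have \<kappa>_pos: "\<kappa> > 0"
  proof -
    have "?k \<noteq> 0"
      using k0 by auto
    then show ?thesis
      using kH by (simp add: \<kappa>_def)
  qed
  define W where "W = {v \<in> N. ip v ?k = 0}"
  have W_L: "L j v \<in> W" if "v \<in> W" for v j
    using that strong_peak_kern_reducing[OF x nx] by (simp add: W_def)
  have W_H: "v \<in> H" if "v \<in> W" for v
    using that N_H by (simp add: W_def)
  have pyth: "dform n (v + cscale t ?k) = dform n v + (cmod t)\<^sup>2 * (norm x ^ (2 * n) * \<kappa>)" if "v \<in> W" for n v t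
    using that
  proof (induction n arbitrary: v t)
    case 0
    have "ip v (cscale t ?k) = 0"
      using 0 ip_scale_right[OF W_H[OF 0] kH] by (simp add: W_def)
    then show ?case
      unfolding wform.simps nrm_add_sq[OF W_H[OF 0] scale_mem[OF kH]] nrm_scale[OF kH]
      by (simp add: \<kappa>_def power_mult_distrib)
  next
    case (Suc n)
    have L: "L j (v + cscale t ?k) = L j v + cscale (t * cnj (x $ j)) ?k" for j
      unfolding adj_add[OF multiplier_coord W_H[OF Suc.prems] scale_mem[OF kH]] adj_scale[OF multiplier_coord kH] Lk
      by simp
    have "dform (Suc n) (v + cscale t ?k)
        = (\<Sum>j\<in>UNIV. dform n (L j v) + (cmod (t * cnj (x $ j)))\<^sup>2 * (norm x ^ (2 * n) * \<kappa>))"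
      unfolding wform.simps L using Suc.IH[OF W_L[OF Suc.prems]] by (rule sum.cong[OF refl])
    also have "\<dots> = dform (Suc n) v + (\<Sum>j\<in>UNIV. (cmod (x $ j))\<^sup>2) * ((cmod t)\<^sup>2 * (norm x ^ (2 * n) * \<kappa>))"
      by (simp add: sum.distrib norm_mult power_mult_distrib sum_distrib_left sum_distrib_right mult_ac)
    also have "\<dots> = dform (Suc n) v + (cmod t)\<^sup>2 * (norm x ^ (2 * Suc n) * \<kappa>)"
      unfolding norm_vec_sq[symmetric] by (simp add: power2_eq_square mult_ac)
    finally show ?case .
  qed
  have b_lim: "(\<lambda>m. \<Sum>n=1..m. b n * norm x ^ (2 * n)) \<longlonglongrightarrow> 1 - 1 / \<kappa>"
  proof -
    have "(\<lambda>n. complex_of_real (b (Suc n)) * cdot x x ^ Suc n) sums (1 - 1 / kernel a x x)"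
      by (rule b_series[OF xb xb])
    then have "(\<lambda>n. complex_of_real (b (Suc n) * norm x ^ (2 * Suc n))) sums of_real (1 - 1 / \<kappa>)"
      unfolding cdot_self \<kappa> by (simp only: power_mult of_real_mult of_real_power of_real_diff of_real_1 of_real_divide)
    then have "(\<lambda>n. b (Suc n) * norm x ^ (2 * Suc n)) sums (1 - 1 / \<kappa>)"
      by (simp only: sums_of_real_iff)
    then show ?thesis
      unfolding sums_def by (simp add: sum.atLeast1_atMost_eq lessThan_Suc_atMost)
  qed
  have W0: "v 0 = 0" if v: "v \<in> W" for v
  proof -
    have le: "(cmod (v 0 + t))\<^sup>2 \<le> (nrm v)\<^sup>2 + (cmod t)\<^sup>2" for t
    proof -
      have "(cmod (v 0 + t))\<^sup>2 \<le> (nrm v)\<^sup>2 + (cmod t)\<^sup>2 * \<kappa> * (1 - (\<Sum>n=1..m. b n * norm x ^ (2 * n)))" for m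
      proof -
        let ?u = "v + cscale t ?k"
        have "0 \<le> (\<Sum>n=1..m. b n * dform n v)"
          using b_nonneg by (intro sum_nonneg mult_nonneg_nonneg wform_nonneg) auto
        moreover have "(\<Sum>n=1..m. b n * dform n ?u) = (\<Sum>n=1..m. b n * dform n v)
            + (cmod t)\<^sup>2 * \<kappa> * (\<Sum>n=1..m. b n * norm x ^ (2 * n))"
          unfolding pyth[OF v] by (simp add: distrib_left sum.distrib sum_distrib_left mult_ac)
        moreover have "(nrm ?u)\<^sup>2 = (nrm v)\<^sup>2 + (cmod t)\<^sup>2 * \<kappa>"
          using pyth[OF v, of 0 t] by simp
        moreover have "?u 0 = v 0 + t"
          by (simp add: k0 cscale_def)
        ultimately show ?thesis
          using row_contraction[OF add_mem[OF W_H[OF v] scale_mem[OF kH, of t]], of m]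
          by (simp add: right_diff_distrib)
      qed
      moreover have "(\<lambda>m. (nrm v)\<^sup>2 + (cmod t)\<^sup>2 * \<kappa> * (1 - (\<Sum>n=1..m. b n * norm x ^ (2 * n))))
          \<longlonglongrightarrow> (nrm v)\<^sup>2 + (cmod t)\<^sup>2 * \<kappa> * (1 - (1 - 1 / \<kappa>))"
        by (intro tendsto_intros b_lim)
      ultimately have "(cmod (v 0 + t))\<^sup>2 \<le> (nrm v)\<^sup>2 + (cmod t)\<^sup>2 * \<kappa> * (1 - (1 - 1 / \<kappa>))"
        by (intro LIMSEQ_le_const) auto
      then show ?thesis
        using \<kappa>_pos by simp
    qed
    \<comment> \<open>With \<open>t = s * v 0\<close> the left side contains a cross term
      \<open>2 s |v 0|^2\<close> that the right side lacks, and \<open>s\<close> is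
      arbitrary.\<close>
    have bd: "2 * s * (cmod (v 0))\<^sup>2 \<le> (nrm v)\<^sup>2" if "s \<ge> 0" for s :: real
    proof -
      have "v 0 + of_real s * v 0 = of_real (1 + s) * v 0"
        by (simp add: algebra_simps)
      then have "cmod (v 0 + of_real s * v 0) = (1 + s) * cmod (v 0)"
        using that by (simp add: norm_mult del: of_real_add)
      then have "((1 + s) * cmod (v 0))\<^sup>2 \<le> (nrm v)\<^sup>2 + (s * cmod (v 0))\<^sup>2"
        using le[of "of_real s * v 0"] that by (simp add: norm_mult)
      moreover have "((1 + s) * cmod (v 0))\<^sup>2 = (s * cmod (v 0))\<^sup>2 + 2 * s * (cmod (v 0))\<^sup>2 + (cmod (v 0))\<^sup>2"
        by (simp add: power2_eq_square algebra_simps)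
      ultimately show ?thesis
        using zero_le_power2[of "cmod (v 0)"] by linarith
    qed
    show ?thesis
    proof (rule ccontr)
      assume "v 0 \<noteq> 0"
      then have "2 * ((nrm v)\<^sup>2 + 1) \<le> (nrm v)\<^sup>2"
        using bd[of "((nrm v)\<^sup>2 + 1) / (cmod (v 0))\<^sup>2"] by simp
      moreover have "r < 2 * (r + 1)" if "0 \<le> r" for r :: real
        using that by simp
      ultimately show False
        using zero_le_power2[of "nrm v"] not_le by blast
    qed
  qed
  have W_zero: "v = 0" if v: "v \<in> W" for v
  proof (rule eform_eq_0_imp_zero[OF W_H[OF v]])
    show "eform n v = 0" for n
      using v by (induction n arbitrary: v) (auto simp: W0 W_L)
  qed
  show ?thesis
  proof
    fix v assume v: "v \<in> N"
    let ?c = "ip v ?k / of_real \<kappa>"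
    have "ip (v - cscale ?c ?k) ?k = 0"
      unfolding ip_diff_left[OF N_H[OF v] scale_mem[OF kH] kH] ip_scale_left[OF kH kH] ip_self[OF kH]
      using \<kappa>_pos by (simp add: \<kappa>_def)
    then have "v - cscale ?c ?k \<in> W"
      using v kN by (simp add: W_def)
    then have "v - cscale ?c ?k = 0"
      by (rule W_zero)
    then have "v = cscale ?c ?k"
      by simp
    then show "v \<in> cfun.span {?k}"
      by (metis cfun.span_base cfun.span_scale insertI1)
  qed
qed

end

section \<open>All peak points on the sphere: a functional calculus on C(K)\<close>

locale sphere_isometric_quotient = isometric_quotient a b H ip \<aa> X
  for a b :: "nat \<Rightarrow> real" and H :: "(complex ^ 'd) cfun set"
    and ip :: "(complex ^ 'd) cfun \<Rightarrow> (complex ^ 'd) cfun \<Rightarrow> complex"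
    and \<aa> :: "(complex ^ 'd) cfun set" and X :: "(complex ^ 'd) set" +
  assumes peak_sphere: "\<And>x. strong_peak x \<Longrightarrow> norm x = 1"
    and approx: "approximation_set (ideal_support H ip \<aa> \<inter> sphere 0 1)"
begin

abbreviation "K \<equiv> ideal_support H ip \<aa> \<inter> sphere 0 1"

lemma strong_peak_in_K: "strong_peak x \<Longrightarrow> x \<in> K"
  using peak_sphere strong_peak_approx_eigenvalue approx_eigenvalue_in_support by auto

text \<open>A maximiser \<open>x\<close> of \<open>|p|^2 + \<epsilon> |z|^2\<close> is a peak point,
  so it lies in \<open>K\<close> and has norm 1. Thus
  \<open>|p z|^2 \<le> |p x|^2 + \<epsilon>\<close>, and \<open>\<epsilon>\<close> tends to
  0.\<close>

lemma K_dominates: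
  assumes p: "cpolynomial p" and M: "\<And>x. x \<in> K \<Longrightarrow> cmod (p x) \<le> M" and z: "z \<in> X"
  shows "cmod (p z) \<le> M"
proof -
  have le: "(cmod (p z))\<^sup>2 \<le> M\<^sup>2 + \<epsilon>" and M0: "M \<ge> 0" if \<epsilon>: "\<epsilon> > 0" for \<epsilon>
  proof -
    obtain x where x: "strong_peak x"
      and max: "\<And>z. z \<in> X \<Longrightarrow> (cmod (p z))\<^sup>2 + \<epsilon> * (norm z)\<^sup>2 \<le> (cmod (p x))\<^sup>2 + \<epsilon> * (norm x)\<^sup>2"
      using maximizer_strong_peak[OF p \<epsilon>] by blast
    have px: "cmod (p x) \<le> M"
      by (rule M[OF strong_peak_in_K[OF x]])
    then show "M \<ge> 0"
      using norm_ge_zero order_trans by blast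
    have "(cmod (p x))\<^sup>2 \<le> M\<^sup>2"
      using px by (intro power_mono) auto
    moreover have "0 \<le> \<epsilon> * (norm z)\<^sup>2"
      using \<epsilon> by simp
    ultimately show "(cmod (p z))\<^sup>2 \<le> M\<^sup>2 + \<epsilon>"
      using max[OF z] peak_sphere[OF x] by simp
  qed
  have "(cmod (p z))\<^sup>2 \<le> M\<^sup>2"
    using le by (rule field_le_epsilon)
  then show ?thesis
    using M0[of 1] power2_le_imp_le by simp
qed

lemma adj_le_K: "\<lbrakk>cpolynomial p; \<And>x. x \<in> K \<Longrightarrow> cmod (p x) \<le> M; v \<in> N\<rbrakk> \<Longrightarrow> nrm (adj (on_ball p) v) \<le> M * nrm v"
  using adj_le K_dominates by metis

lemma comp_le_K: "\<lbrakk>cpolynomial p; \<And>x. x \<in> K \<Longrightarrow> cmod (p x) \<le> M; v \<in> N\<rbrakk> \<Longrightarrow> nrm (poly_comp p v) \<le> M * nrm v"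
  using comp_le K_dominates by metis

text \<open>
  The functional calculus of the compressed coordinates extends to \<open>C(K)\<close>; \<open>star_at f\<close> says that the
  extension respects the involution at \<open>f\<close>.
\<close>

definition star_at :: "(complex ^ 'd \<Rightarrow> complex) \<Rightarrow> bool" where
  "star_at f \<longleftrightarrow> (\<forall>\<eta>>0. \<exists>p q. cpolynomial p \<and> cpolynomial q \<and>
     (\<forall>x\<in>K. cmod (p x - f x) \<le> \<eta> \<and> cmod (q x - cnj (f x)) \<le> \<eta>) \<and>
     (\<forall>v\<in>N. nrm (adj (on_ball p) v - poly_comp q v) \<le> \<eta> * nrm v))"

lemma star_at_add:
  assumes f: "star_at f" and g: "star_at g"
  shows "star_at (\<lambda>x. f x + g x)"
  unfolding star_at_def
proof (intro allI impI)
  fix \<eta> :: real assume \<eta>: "\<eta> > 0"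
  obtain p q where pq: "cpolynomial p" "cpolynomial q"
    "\<And>x. x \<in> K \<Longrightarrow> cmod (p x - f x) \<le> \<eta> / 2" "\<And>x. x \<in> K \<Longrightarrow> cmod (q x - cnj (f x)) \<le> \<eta> / 2"
    "\<And>v. v \<in> N \<Longrightarrow> nrm (adj (on_ball p) v - poly_comp q v) \<le> \<eta> / 2 * nrm v"
    using f half_gt_zero[OF \<eta>] unfolding star_at_def by metis
  obtain p' q' where pq': "cpolynomial p'" "cpolynomial q'"
    "\<And>x. x \<in> K \<Longrightarrow> cmod (p' x - g x) \<le> \<eta> / 2" "\<And>x. x \<in> K \<Longrightarrow> cmod (q' x - cnj (g x)) \<le> \<eta> / 2"
    "\<And>v. v \<in> N \<Longrightarrow> nrm (adj (on_ball p') v - poly_comp q' v) \<le> \<eta> / 2 * nrm v"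
    using g half_gt_zero[OF \<eta>] unfolding star_at_def by metis
  note M = multiplier_on_ball[OF pq(1)] multiplier_on_ball[OF pq(2)]
    multiplier_on_ball[OF pq'(1)] multiplier_on_ball[OF pq'(2)]
  show "\<exists>p q. cpolynomial p \<and> cpolynomial q \<and>
     (\<forall>x\<in>K. cmod (p x - (f x + g x)) \<le> \<eta> \<and> cmod (q x - cnj (f x + g x)) \<le> \<eta>) \<and>
     (\<forall>v\<in>N. nrm (adj (on_ball p) v - poly_comp q v) \<le> \<eta> * nrm v)"
  proof (rule exI[of _ "\<lambda>x. p x + p' x"], rule exI[of _ "\<lambda>x. q x + q' x"], intro conjI ballI cpolynomial_add pq pq')
    fix x assume x: "x \<in> K"
    have "cmod ((p x - f x) + (p' x - g x)) \<le> \<eta> / 2 + \<eta> / 2"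
      by (intro norm_triangle_mono pq pq' x)
    then show "cmod (p x + p' x - (f x + g x)) \<le> \<eta>"
      by (simp add: algebra_simps)
    have "cmod ((q x - cnj (f x)) + (q' x - cnj (g x))) \<le> \<eta> / 2 + \<eta> / 2"
      by (intro norm_triangle_mono pq pq' x)
    then show "cmod (q x + q' x - cnj (f x + g x)) \<le> \<eta>"
      by (simp add: algebra_simps)
  next
    fix v assume v: "v \<in> N"
    have eq: "adj (on_ball (\<lambda>x. p x + p' x)) v - poly_comp (\<lambda>x. q x + q' x) v
        = (adj (on_ball p) v - poly_comp q v) + (adj (on_ball p') v - poly_comp q' v)"
      unfolding on_ball_add adj_plus[OF M(1,3) N_H[OF v]] comp_plus[OF M(2,4)] by simp
    have "nrm ((adj (on_ball p) v - poly_comp q v) + (adj (on_ball p') v - poly_comp q' v))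
        \<le> nrm (adj (on_ball p) v - poly_comp q v) + nrm (adj (on_ball p') v - poly_comp q' v)"
      using M v by (intro nrm_triangle) (simp_all add: N_H)
    also have "\<dots> \<le> \<eta> / 2 * nrm v + \<eta> / 2 * nrm v"
      by (intro add_mono pq pq' v)
    finally show "nrm (adj (on_ball (\<lambda>x. p x + p' x)) v - poly_comp (\<lambda>x. q x + q' x) v) \<le> \<eta> * nrm v"
      unfolding eq by simp
  qed
qed

lemma star_at_cmult:
  assumes f: "star_at f"
  shows "star_at (\<lambda>x. c * f x)"
  unfolding star_at_def
proof (intro allI impI)
  fix \<eta> :: real assume \<eta>: "\<eta> > 0"
  define \<delta> where "\<delta> = \<eta> / (cmod c + 1)"
  have \<delta>: "\<delta> > 0"
    using \<eta> by (simp add: \<delta>_def add_nonneg_pos)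
  have c\<delta>: "cmod c * \<delta> \<le> \<eta>"
  proof -
    have "cmod c * \<delta> \<le> (cmod c + 1) * \<delta>"
      using \<delta> by (intro mult_right_mono) auto
    also have "\<dots> = \<eta>"
      using norm_ge_zero[of c] unfolding \<delta>_def by (simp add: add_nonneg_eq_0_iff)
    finally show ?thesis .
  qed
  obtain p q where pq: "cpolynomial p" "cpolynomial q"
    "\<And>x. x \<in> K \<Longrightarrow> cmod (p x - f x) \<le> \<delta>" "\<And>x. x \<in> K \<Longrightarrow> cmod (q x - cnj (f x)) \<le> \<delta>"
    "\<And>v. v \<in> N \<Longrightarrow> nrm (adj (on_ball p) v - poly_comp q v) \<le> \<delta> * nrm v"
    using f \<delta> unfolding star_at_def by metis
  note M = multiplier_on_ball[OF pq(1)] multiplier_on_ball[OF pq(2)]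
  show "\<exists>p q. cpolynomial p \<and> cpolynomial q \<and>
     (\<forall>x\<in>K. cmod (p x - c * f x) \<le> \<eta> \<and> cmod (q x - cnj (c * f x)) \<le> \<eta>) \<and>
     (\<forall>v\<in>N. nrm (adj (on_ball p) v - poly_comp q v) \<le> \<eta> * nrm v)"
  proof (rule exI[of _ "\<lambda>x. c * p x"], rule exI[of _ "\<lambda>x. cnj c * q x"],
      intro conjI ballI cpolynomial_mult cpolynomial_const pq)
    fix x assume x: "x \<in> K"
    have "cmod (c * p x - c * f x) = cmod c * cmod (p x - f x)"
      by (simp only: norm_mult flip: right_diff_distrib)
    also have "\<dots> \<le> cmod c * \<delta>"
      by (intro mult_left_mono pq x) simp
    finally show "cmod (c * p x - c * f x) \<le> \<eta>"
      using c\<delta> by simp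
    have "cmod (cnj c * q x - cnj (c * f x)) = cmod c * cmod (q x - cnj (f x))"
      by (simp only: complex_cnj_mult norm_mult complex_mod_cnj flip: right_diff_distrib)
    also have "\<dots> \<le> cmod c * \<delta>"
      by (intro mult_left_mono pq x) simp
    finally show "cmod (cnj c * q x - cnj (c * f x)) \<le> \<eta>"
      using c\<delta> by simp
  next
    fix v assume v: "v \<in> N"
    have eq: "adj (on_ball (\<lambda>x. c * p x)) v - poly_comp (\<lambda>x. cnj c * q x) v
        = cscale (cnj c) (adj (on_ball p) v - poly_comp q v)"
      unfolding on_ball_cmult adj_cscale[OF M(1) N_H[OF v]] comp_scale[OF M(2)] cfun.scale_right_diff_distrib ..
    have "nrm (cscale (cnj c) (adj (on_ball p) v - poly_comp q v)) = cmod c * nrm (adj (on_ball p) v - poly_comp q v)"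
      using M v by (subst nrm_scale) (simp_all add: N_H)
    also have "\<dots> \<le> cmod c * (\<delta> * nrm v)"
      by (intro mult_left_mono pq v) simp
    also have "\<dots> \<le> \<eta> * nrm v"
      using mult_right_mono[OF c\<delta> nrm_nonneg[OF N_H[OF v]]] by (simp add: mult.assoc)
    finally show "nrm (adj (on_ball (\<lambda>x. c * p x)) v - poly_comp (\<lambda>x. cnj c * q x) v) \<le> \<eta> * nrm v"
      unfolding eq .
  qed
qed

text \<open>A contraction with contractive inverse is unitary.\<close>

lemma star_at_unimodular:
  assumes w: "continuous_on K w" and w1: "\<And>x. x \<in> K \<Longrightarrow> cmod (w x) = 1"
  shows "star_at w"
  unfolding star_at_def
proof (intro allI impI)
  fix \<eta> :: real assume \<eta>: "\<eta> > 0"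
  \<comment> \<open>The factor 12: both squared norms below are at most
    \<open>(1 + 3 \<delta>) |v|^2\<close> and the real part of the inner product is at least
    \<open>(1 - 3 \<delta>) |v|^2\<close>, so the squared distance is at most
    \<open>12 \<delta> |v|^2\<close>.\<close>
  define \<delta> where "\<delta> = min 1 (min \<eta> (\<eta>\<^sup>2 / 12))"
  have \<delta>: "\<delta> > 0" "\<delta> \<le> 1" "\<delta> \<le> \<eta>" "12 * \<delta> \<le> \<eta>\<^sup>2"
    using \<eta> by (auto simp: \<delta>_def min_def)
  have dense: "\<exists>p. cpolynomial p \<and> (\<forall>x\<in>K. cmod (f x - p x) < \<delta>)" if "continuous_on K f" for f
    using approx that \<delta>(1) unfolding approximation_set_def by blast
  obtain p where p: "cpolynomial p" "\<And>x. x \<in> K \<Longrightarrow> cmod (p x - w x) \<le> \<delta>"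
    using dense[OF w] by (metis less_imp_le norm_minus_commute)
  obtain q where q: "cpolynomial q" "\<And>x. x \<in> K \<Longrightarrow> cmod (q x - cnj (w x)) \<le> \<delta>"
    using dense[OF continuous_on_cnj[OF w]] by (metis less_imp_le norm_minus_commute)
  note P = multiplier_on_ball[OF p(1)] and Q = multiplier_on_ball[OF q(1)]
  have p1: "cmod (p x) \<le> 1 + \<delta>" and q1: "cmod (q x) \<le> 1 + \<delta>" if "x \<in> K" for x
    using norm_triangle_sub[of "p x" "w x"] norm_triangle_sub[of "q x" "cnj (w x)"] p(2)[OF that] q(2)[OF that] w1[OF that]
    by simp_all
  have pq: "cmod (1 - p x * q x) \<le> 3 * \<delta>" if x: "x \<in> K" for x
  proof -
    have "w x * cnj (w x) = 1"
      using w1[OF x] complex_norm_square[of "w x"] by simp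
    then have "1 - p x * q x = - ((p x - w x) * cnj (w x) + p x * (q x - cnj (w x)))"
      by (simp add: algebra_simps)
    then have "cmod (1 - p x * q x) \<le> cmod (p x - w x) * cmod (w x) + cmod (p x) * cmod (q x - cnj (w x))"
      using norm_triangle_ineq[of "(p x - w x) * cnj (w x)" "p x * (q x - cnj (w x))"]
      by (simp only: norm_minus_cancel norm_mult complex_mod_cnj)
    also have "\<dots> \<le> \<delta> * 1 + (1 + \<delta>) * \<delta>"
      using p(2)[OF x] q(2)[OF x] w1[OF x] p1[OF x] \<delta> by (intro add_mono mult_mono) auto
    also have "\<dots> \<le> 3 * \<delta>"
      using \<delta> by (simp add: algebra_simps)
    finally show ?thesis .
  qed
  have "nrm (adj (on_ball p) v - poly_comp q v) \<le> \<eta> * nrm v" if v: "v \<in> N" for v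
  proof -
    let ?A = "adj (on_ball p) v" and ?B = "poly_comp q v" and ?D = "adj (on_ball (\<lambda>x. 1 - p x * q x)) v"
    have cp: "cpolynomial (\<lambda>x. 1 - p x * q x)"
      by (intro cpolynomial_diff cpolynomial_const cpolynomial_mult p q)
    have A: "?A \<in> N" and B: "?B \<in> N" and D: "?D \<in> N"
      using P Q v multiplier_on_ball[OF cp] by simp_all
    have nA: "nrm ?A \<le> (1 + \<delta>) * nrm v"
      by (rule adj_le_K[OF p(1) p1 v])
    have nB: "nrm ?B \<le> (1 + \<delta>) * nrm v"
      by (rule comp_le_K[OF q(1) q1 v])
    have nD: "nrm ?D \<le> 3 * \<delta> * nrm v"
      by (rule adj_le_K[OF cp pq v])
    \<comment> \<open>On \<open>K\<close> the product \<open>p q\<close> is nearly 1, so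
      \<open>adj (on_ball q)\<close> undoes \<open>adj (on_ball p)\<close> up to \<open>?D\<close>.
      This makes the inner product of \<open>?A\<close> and \<open>?B\<close> nearly
      \<open>|v|^2\<close>.\<close>
    have "?D = v - adj (on_ball q) ?A"
      unfolding on_ball_diff on_ball_mult on_ball_const
      using P Q v by (simp add: adj_minus adj_times multiplier_times multiplier_unit adj_unit N_H)
    then have qA: "adj (on_ball q) ?A = v - ?D"
      by simp
    have "ip ?B ?A = ip v (v - ?D)"
      using ip_comp[OF Q v A] ip_adj[OF Q N_H[OF A] N_H[OF v]] unfolding qA by simp
    then have "Re (ip ?A ?B) = (nrm v)\<^sup>2 - Re (ip v ?D)"
      using ip_commute[OF N_H[OF B] N_H[OF A]] ip_diff_right[OF N_H[OF v] N_H[OF D] N_H[OF v]] Re_ip_self[OF N_H[OF v]]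
      by simp
    moreover have "Re (ip v ?D) \<le> 3 * \<delta> * (nrm v)\<^sup>2"
    proof -
      have "Re (ip v ?D) \<le> nrm v * nrm ?D"
        using Cauchy_Schwarz[OF N_H[OF v] N_H[OF D]] complex_Re_le_cmod order_trans by blast
      also have "\<dots> \<le> nrm v * (3 * \<delta> * nrm v)"
        using nD N_H[OF v] by (intro mult_left_mono) auto
      finally show ?thesis
        by (simp only: power2_eq_square mult_ac)
    qed
    moreover have "(nrm ?A)\<^sup>2 \<le> ((1 + \<delta>) * nrm v)\<^sup>2" "(nrm ?B)\<^sup>2 \<le> ((1 + \<delta>) * nrm v)\<^sup>2"
      using nA nB N_H[OF A] N_H[OF B] by (auto intro!: power_mono)
    moreover have "((1 + \<delta>) * nrm v)\<^sup>2 \<le> (nrm v)\<^sup>2 + 3 * \<delta> * (nrm v)\<^sup>2"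
    proof -
      have "(1 + \<delta>)\<^sup>2 \<le> 1 + 3 * \<delta>"
        using \<delta> by (simp add: power2_eq_square algebra_simps)
      then have "(1 + \<delta>)\<^sup>2 * (nrm v)\<^sup>2 \<le> (1 + 3 * \<delta>) * (nrm v)\<^sup>2"
        by (intro mult_right_mono) auto
      then show ?thesis
        unfolding power_mult_distrib by (simp only: distrib_right mult_1_left)
    qed
    ultimately have "(nrm (?A - ?B))\<^sup>2 \<le> 12 * \<delta> * (nrm v)\<^sup>2"
      using nrm_diff_sq[OF N_H[OF A] N_H[OF B]] by linarith
    also have "\<dots> \<le> \<eta>\<^sup>2 * (nrm v)\<^sup>2"
      using \<delta>(4) by (intro mult_right_mono) auto
    finally have "(nrm (?A - ?B))\<^sup>2 \<le> (\<eta> * nrm v)\<^sup>2"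
      by (simp add: power_mult_distrib)
    then show ?thesis
      by (rule power2_le_imp_le) (use \<eta> N_H[OF v] in simp)
  qed
  moreover have "cmod (p x - w x) \<le> \<eta>" "cmod (q x - cnj (w x)) \<le> \<eta>" if "x \<in> K" for x
    using p(2)[OF that] q(2)[OF that] \<delta>(3) by linarith+
  ultimately show "\<exists>p q. cpolynomial p \<and> cpolynomial q \<and>
     (\<forall>x\<in>K. cmod (p x - w x) \<le> \<eta> \<and> cmod (q x - cnj (w x)) \<le> \<eta>) \<and>
     (\<forall>v\<in>N. nrm (adj (on_ball p) v - poly_comp q v) \<le> \<eta> * nrm v)"
    using p(1) q(1) by blast
qed

text \<open>A real function bounded by 1 is the average of the unimodular functions with real part
  \<open>r\<close> and imaginary parts plus and minus \<open>sqrt (1 - r^2)\<close>.\<close>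

lemma star_at_real:
  assumes r: "continuous_on K r" and r1: "\<And>x. x \<in> K \<Longrightarrow> \<bar>r x\<bar> \<le> 1"
  shows "star_at (\<lambda>x. complex_of_real (r x))"
proof -
  have star: "star_at (\<lambda>x. Complex (r x) (s * sqrt (1 - (r x)\<^sup>2)))" if s: "s\<^sup>2 = 1" for s
  proof (rule star_at_unimodular)
    have "continuous_on K (\<lambda>x. of_real (r x) + \<i> * of_real (s * sqrt (1 - (r x)\<^sup>2)))"
      by (intro continuous_intros r)
    then show "continuous_on K (\<lambda>x. Complex (r x) (s * sqrt (1 - (r x)\<^sup>2)))"
      by (simp add: Complex_eq)
  next
    fix x assume "x \<in> K"
    then have "(r x)\<^sup>2 \<le> 1"
      using r1 by (simp add: abs_square_le_1)
    then show "cmod (Complex (r x) (s * sqrt (1 - (r x)\<^sup>2))) = 1"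
      using s by (simp add: complex_norm power_mult_distrib)
  qed
  have "star_at (\<lambda>x. 1/2 * (Complex (r x) (1 * sqrt (1 - (r x)\<^sup>2)) + Complex (r x) (- 1 * sqrt (1 - (r x)\<^sup>2))))"
    by (intro star_at_cmult star_at_add star) simp_all
  moreover have "1/2 * (Complex (r x) (1 * sqrt (1 - (r x)\<^sup>2)) + Complex (r x) (- 1 * sqrt (1 - (r x)\<^sup>2)))
      = complex_of_real (r x)" for x
    by (simp add: complex_eq_iff)
  ultimately show ?thesis
    by (simp only:)
qed

lemma K_coord: "x \<in> K \<Longrightarrow> cmod (x $ j) \<le> 1"
  using Finite_Cartesian_Product.norm_nth_le[of x j] by simp

lemma star_at_coord: "star_at (\<lambda>x. x $ j)"
proof -
  have "star_at (\<lambda>x. complex_of_real (Re (x $ j)) + \<i> * complex_of_real (Im (x $ j)))"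
    using K_coord abs_Re_le_cmod abs_Im_le_cmod order_trans
    by (intro star_at_add star_at_cmult star_at_real continuous_intros) blast+
  then show ?thesis
    by (simp flip: complex_eq)
qed

text \<open>Let polynomials \<open>q_j\<close> approximate \<open>cnj z_j\<close> on
  \<open>K\<close> so that \<open>q_j(Z) v\<close> is close to \<open>L j v\<close>. Then
  \<open>\<Sum> |L_j v|^2\<close> is close to
  \<open>\<Sum> \<langle>q_j(Z) v, L_j v\<rangle>\<close>, the pairing of \<open>v\<close> with the
  adjoint of \<open>\<Sum> z_j q_j\<close> applied to \<open>v\<close>, and this polynomial is
  nearly \<open>|z|^2 = 1\<close> on \<open>K\<close>.\<close>

lemma row_isometric:
  assumes v: "v \<in> N"
  shows "(\<Sum>j\<in>UNIV. (nrm (L j v))\<^sup>2) = (nrm v)\<^sup>2"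
proof -
  let ?S = "\<Sum>j\<in>UNIV. (nrm (L j v))\<^sup>2" and ?d = "real (CARD('d))"
  note vH = N_H[OF v]
  have "\<bar>?S - (nrm v)\<^sup>2\<bar> \<le> 0 + e" if e: "e > 0" for e
  proof -
    \<comment> \<open>The total error is \<open>3 d \<eta> |v|^2\<close>: twice
      \<open>\<eta> |v|^2\<close> per coordinate from \<open>err\<close>, and
      \<open>d \<eta> |v|^2\<close> from \<open>?D\<close>. The added 1 covers
      \<open>v = 0\<close>.\<close>
    define \<eta> where "\<eta> = e / (3 * ?d * (nrm v)\<^sup>2 + 1)"
    have pos: "3 * ?d * (nrm v)\<^sup>2 + 1 > 0"
      by (simp add: add_nonneg_pos)
    have \<eta>: "\<eta> > 0"
      using e pos by (simp add: \<eta>_def)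
    \<comment> \<open>\<open>star_at\<close> approximates the coordinate by some \<open>p\<close>;
      replacing \<open>p\<close> by the coordinate itself costs a second
      \<open>\<eta>\<close>.\<close>
    have "\<exists>q. cpolynomial q \<and> (\<forall>x\<in>K. cmod (q x - cnj (x $ j)) \<le> \<eta>) \<and>
        nrm (L j v - poly_comp q v) \<le> 2 * \<eta> * nrm v" for j
    proof -
      obtain p q where pq: "cpolynomial p" "cpolynomial q"
        "\<And>x. x \<in> K \<Longrightarrow> cmod (p x - x $ j) \<le> \<eta>" "\<And>x. x \<in> K \<Longrightarrow> cmod (q x - cnj (x $ j)) \<le> \<eta>"
        "nrm (adj (on_ball p) v - poly_comp q v) \<le> \<eta> * nrm v"
        using star_at_coord[of j] \<eta> v unfolding star_at_def by metis
      have cp: "cpolynomial (\<lambda>x :: complex ^ 'd. x $ j - p x)"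
        by (intro cpolynomial_diff cpolynomial_coord pq)
      have "nrm (adj (on_ball (\<lambda>x. x $ j - p x)) v) \<le> \<eta> * nrm v"
        using pq(3) by (intro adj_le_K[OF cp _ v]) (simp add: norm_minus_commute)
      moreover have "adj (on_ball (\<lambda>x. x $ j - p x)) v = L j v - adj (on_ball p) v"
        unfolding on_ball_diff coord_def[symmetric] by (rule adj_minus[OF multiplier_coord multiplier_on_ball[OF pq(1)] vH])
      ultimately have "nrm (L j v - adj (on_ball p) v) \<le> \<eta> * nrm v"
        by simp
      moreover have "nrm (L j v - poly_comp q v) \<le> nrm (L j v - adj (on_ball p) v) + nrm (adj (on_ball p) v - poly_comp q v)"
        using multiplier_on_ball[OF pq(1)] multiplier_on_ball[OF pq(2)] v by (intro nrm_triangle_diff) (simp_all add: N_H)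
      ultimately have "nrm (L j v - poly_comp q v) \<le> 2 * \<eta> * nrm v"
        using pq(5) by linarith
      with pq show ?thesis by blast
    qed
    then obtain q where q: "\<And>j. cpolynomial (q j)" "\<And>j x. x \<in> K \<Longrightarrow> cmod (q j x - cnj (x $ j)) \<le> \<eta>"
      "\<And>j. nrm (L j v - poly_comp (q j) v) \<le> 2 * \<eta> * nrm v"
      by metis
    note Q = multiplier_on_ball[OF q(1)]
    define g where "g x = (\<Sum>j\<in>UNIV. x $ j * q j x)" for x :: "complex ^ 'd"
    have gp: "cpolynomial g"
      unfolding g_def by (intro cpolynomial_sum cpolynomial_mult cpolynomial_coord q)
    have adj_sum: "adj (on_ball (\<lambda>x. \<Sum>j\<in>J. x $ j * q j x)) v = (\<Sum>j\<in>J. adj (on_ball (q j)) (L j v))" if "finite J" for J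
      using that
    proof (induction J)
      case empty
      have "adj (on_ball (\<lambda>x :: complex ^ 'd. 0)) v = 0"
        unfolding on_ball_const adj_cscale[OF multiplier_unit vH] by simp
      then show ?case
        unfolding sum.empty .
    next
      case (insert j J)
      have c: "cpolynomial (\<lambda>x :: complex ^ 'd. x $ j * q j x)" "cpolynomial (\<lambda>x. \<Sum>j\<in>J. x $ j * q j x)"
        by (intro cpolynomial_sum cpolynomial_mult cpolynomial_coord q)+
      have eq_j: "adj (on_ball (\<lambda>x. x $ j * q j x)) v = adj (on_ball (q j)) (L j v)"
        unfolding on_ball_mult coord_def[symmetric] by (rule adj_times[OF multiplier_coord Q vH])
      have eq: "on_ball (\<lambda>x. \<Sum>j\<in>insert j J. x $ j * q j x)
          = on_ball (\<lambda>x. x $ j * q j x) + on_ball (\<lambda>x. \<Sum>j\<in>J. x $ j * q j x)"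
        using insert(1,2) by (simp flip: on_ball_add)
      have "adj (on_ball (\<lambda>x. \<Sum>j\<in>insert j J. x $ j * q j x)) v
          = adj (on_ball (\<lambda>x. x $ j * q j x)) v + adj (on_ball (\<lambda>x. \<Sum>j\<in>J. x $ j * q j x)) v"
        unfolding eq by (rule adj_plus[OF multiplier_on_ball[OF c(1)] multiplier_on_ball[OF c(2)] vH])
      also have "\<dots> = (\<Sum>j\<in>insert j J. adj (on_ball (q j)) (L j v))"
        unfolding eq_j insert(3) sum.insert[OF insert(1,2)] ..
      finally show ?case .
    qed
    have gK: "cmod (1 - g x) \<le> ?d * \<eta>" if x: "x \<in> K" for x
    proof -
      have "1 = cdot x x"
        using x by (simp add: cdot_self)
      then have "1 - g x = (\<Sum>j\<in>UNIV. x $ j * (cnj (x $ j) - q j x))"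
        by (simp add: cdot_def g_def right_diff_distrib sum_subtractf)
      also have "cmod \<dots> \<le> (\<Sum>j\<in>(UNIV :: 'd set). \<eta>)"
      proof (rule sum_norm_le)
        fix j
        have "cmod (x $ j * (cnj (x $ j) - q j x)) \<le> 1 * \<eta>"
          unfolding norm_mult using K_coord[OF x] q(2)[OF x] by (intro mult_mono) (auto simp: norm_minus_commute)
        then show "cmod (x $ j * (cnj (x $ j) - q j x)) \<le> \<eta>" by simp
      qed
      finally show ?thesis by simp
    qed
    let ?D = "adj (on_ball (\<lambda>x. 1 - g x)) v"
    have cp: "cpolynomial (\<lambda>x. 1 - g x)"
      by (intro cpolynomial_diff cpolynomial_const gp)
    have D: "?D \<in> H" "nrm ?D \<le> ?d * \<eta> * nrm v"
      using multiplier_on_ball[OF cp] vH adj_le_K[OF cp gK v] by simp_all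
    have "?D = v - (\<Sum>j\<in>UNIV. adj (on_ball (q j)) (L j v))"
      using adj_minus[OF multiplier_scale[OF multiplier_unit] multiplier_on_ball[OF gp] vH, of 1]
        adj_sum[of UNIV] vH
      unfolding on_ball_diff on_ball_const g_def[abs_def] by (simp add: adj_unit)
    then have sum_eq: "(\<Sum>j\<in>UNIV. adj (on_ball (q j)) (L j v)) = v - ?D"
      by simp
    have Ljv: "L j v \<in> N" for j
      using v by simp
    have ip_eq: "ip (poly_comp (q j) v) (L j v) = ip v (adj (on_ball (q j)) (L j v))" for j
      using ip_comp[OF Q v Ljv] ip_adj[OF Q N_H[OF Ljv] vH] by simp
    have "(\<Sum>j\<in>UNIV. ip (poly_comp (q j) v) (L j v)) = ip v (v - ?D)"
      unfolding ip_eq sum_eq[symmetric] using Q Ljv vH by (intro ip_sum_right[symmetric]) (simp_all add: N_H)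
    also have "\<dots> = of_real ((nrm v)\<^sup>2) - ip v ?D"
      unfolding ip_diff_right[OF vH D(1) vH] ip_self[OF vH] ..
    finally have main: "(\<Sum>j\<in>UNIV. ip (poly_comp (q j) v) (L j v)) = of_real ((nrm v)\<^sup>2) - ip v ?D" .
    have err: "cmod (of_real ((nrm (L j v))\<^sup>2) - ip (poly_comp (q j) v) (L j v)) \<le> 2 * \<eta> * (nrm v)\<^sup>2" for j
    proof -
      have qv: "poly_comp (q j) v \<in> H"
        using Q v N_H by simp
      have cn: "nrm (L j v) \<le> 1 * nrm v"
        unfolding coord_def by (rule adj_le_K[OF cpolynomial_coord K_coord v])
      have eq: "of_real ((nrm (L j v))\<^sup>2) - ip (poly_comp (q j) v) (L j v) = ip (L j v - poly_comp (q j) v) (L j v)"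
        unfolding ip_diff_left[OF N_H[OF Ljv] qv N_H[OF Ljv]] ip_self[OF N_H[OF Ljv]] ..
      have "nrm (L j v - poly_comp (q j) v) * nrm (L j v) \<le> (2 * \<eta> * nrm v) * (1 * nrm v)"
        using q(3) cn \<eta> vH N_H[OF Ljv] by (intro mult_mono) auto
      also have "\<dots> = 2 * \<eta> * (nrm v)\<^sup>2"
        by (simp add: power2_eq_square)
      finally show ?thesis
        unfolding eq by (rule order_trans[OF Cauchy_Schwarz[OF diff_mem[OF N_H[OF Ljv] qv] N_H[OF Ljv]]])
    qed
    have diff: "complex_of_real (?S - (nrm v)\<^sup>2)
        = (\<Sum>j\<in>UNIV. of_real ((nrm (L j v))\<^sup>2) - ip (poly_comp (q j) v) (L j v)) - ip v ?D"
    proof -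
      have "A - B = A - (B - D) - D" for A B D :: complex
        by simp
      then show ?thesis
        by (simp only: sum_subtractf main of_real_diff of_real_sum)
    qed
    have "\<bar>?S - (nrm v)\<^sup>2\<bar> = cmod ((\<Sum>j\<in>UNIV. of_real ((nrm (L j v))\<^sup>2) - ip (poly_comp (q j) v) (L j v)) - ip v ?D)"
      unfolding diff[symmetric] by (simp only: norm_of_real)
    also have "\<dots> \<le> (\<Sum>j\<in>(UNIV :: 'd set). 2 * \<eta> * (nrm v)\<^sup>2) + nrm v * (?d * \<eta> * nrm v)"
    proof (rule order_trans[OF norm_triangle_ineq4], rule add_mono)
      show "cmod (\<Sum>j\<in>UNIV. of_real ((nrm (L j v))\<^sup>2) - ip (poly_comp (q j) v) (L j v)) \<le> (\<Sum>j\<in>(UNIV :: 'd set). 2 * \<eta> * (nrm v)\<^sup>2)"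
        by (rule sum_norm_le) (rule err)
      show "cmod (ip v ?D) \<le> nrm v * (?d * \<eta> * nrm v)"
        using Cauchy_Schwarz[OF vH D(1)] mult_left_mono[OF D(2) nrm_nonneg[OF vH]] by linarith
    qed
    also have "\<dots> = (3 * ?d * (nrm v)\<^sup>2) * \<eta>"
      by (simp add: power2_eq_square algebra_simps)
    also have "\<dots> \<le> (3 * ?d * (nrm v)\<^sup>2 + 1) * \<eta>"
      using \<eta> by (intro mult_right_mono) auto
    also have "\<dots> = e"
      using pos by (simp add: \<eta>_def)
    finally show ?thesis by simp
  qed
  then show ?thesis
    using field_le_epsilon[of "\<bar>?S - (nrm v)\<^sup>2\<bar>" 0] by simp
qed

text \<open>Every \<open>dform n\<close> equals the squared norm on \<open>N\<close>, so
  \<open>row_contraction\<close> leaves \<open>(1 - \<Sum> b_n) |v|^2\<close> for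
  \<open>|v 0|^2\<close>. Applied to all words in the \<open>L j\<close> this gives
  \<open>eform n v = 0\<close> for every \<open>n\<close>.\<close>

lemma N_trivial: "v \<in> N \<Longrightarrow> v = 0"
proof -
  have dn: "dform n v = (nrm v)\<^sup>2" if "v \<in> N" for n v
    using that
  proof (induction n arbitrary: v)
    case (Suc n)
    then show ?case
      using row_isometric[OF Suc.prems] by simp
  qed simp
  have v0: "v 0 = 0" if v: "v \<in> N" for v
  proof -
    have "(cmod (v 0))\<^sup>2 \<le> (nrm v)\<^sup>2 - (\<Sum>n=1..m. b n) * (nrm v)\<^sup>2" for m
      using row_contraction[OF N_H[OF v], of m] unfolding dn[OF v] by (simp add: sum_distrib_right)
    moreover have "(\<lambda>m. (nrm v)\<^sup>2 - (\<Sum>n=1..m. b n) * (nrm v)\<^sup>2) \<longlonglongrightarrow> (nrm v)\<^sup>2 - 1 * (nrm v)\<^sup>2"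
      by (intro tendsto_intros sum_b_tendsto)
    ultimately have "(cmod (v 0))\<^sup>2 \<le> (nrm v)\<^sup>2 - 1 * (nrm v)\<^sup>2"
      by (intro LIMSEQ_le_const) auto
    then show ?thesis by simp
  qed
  assume v: "v \<in> N"
  show "v = 0"
  proof (rule eform_eq_0_imp_zero[OF N_H[OF v]])
    show "eform n v = 0" for n
      using v by (induction n arbitrary: v) (auto simp: v0)
  qed
qed

end

theorem theorem1p3:
  fixes a b :: "nat \<Rightarrow> real"
    and H :: "(complex ^ 'd \<Rightarrow> complex) set"
    and ip :: "(complex ^ 'd \<Rightarrow> complex) \<Rightarrow> (complex ^ 'd \<Rightarrow> complex) \<Rightarrow> complex"
    and \<aa> :: "(complex ^ 'd \<Rightarrow> complex) set"
  assumes "regular_ui_cnp_space a b H ip"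
    and "maximal_cnp b"
    and "multiplier_ideal H \<aa>"
    and "\<aa> \<noteq> multipliers H"
    and "weak_star_closed H ip \<aa>"
    and "\<exists>B \<subseteq> quotient_space H ip \<aa>. cfun.independent B \<and> card B = 2"
    and "approximation_set (ideal_support H ip \<aa> \<inter> sphere 0 1)"
  shows "\<not> gelfand_completely_isometric (quotient_space H ip \<aa>) ip (compressed_poly_algebra H ip \<aa>)"
proof
  assume G: "gelfand_completely_isometric (quotient_space H ip \<aa>) ip (compressed_poly_algebra H ip \<aa>)"
  interpret cnp_quotient a b H ip \<aa>
    using assms(1-3) by unfold_locales
  obtain X where "isometric_quotient a b H ip \<aa> X"
    using isometric_imp_isometric_quotient[OF G] by blast
  then interpret isometric_quotient a b H ip \<aa> X .
  obtain B where B: "B \<subseteq> N" "cfun.independent B" "card B = 2"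
    using assms(6) by blast
  have dim: "card B \<le> card T" if "finite T" "N \<subseteq> cfun.span T" for T
    using cfun.independent_span_bound[OF that(1) B(2)] B(1) that(2) by blast
  \<comment> \<open>A peak point inside the ball would put \<open>N\<close> into the span of one
    kernel function, against two independent vectors in \<open>B\<close>.\<close>
  have "norm x = 1" if x: "strong_peak x" for x
  proof -
    obtain y where y: "\<And>i. y i \<in> N" "\<And>i. nrm (y i) = 1" "approx_seq x y"
      by (rule approx_eigenvalue_seq[OF strong_peak_approx_eigenvalue[OF x]]) (rule that; blast)
    have "norm x \<le> 1"
      by (rule approx_seq_norm_le_1[OF y(3,2)])
    moreover have "\<not> norm x < 1"
      using dim[OF _ interior_strong_peak[OF x]] B(3) by auto
    ultimately show ?thesis by simp
  qed
  then interpret sphere_isometric_quotient a b H ip \<aa> X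
    using assms(7) by unfold_locales
  have "N \<subseteq> cfun.span {}"
    using N_trivial by auto
  then show False
    using dim[of "{}"] B(3) by simp
qed

end
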